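(* Let $\mathcal{X}\subseteq\mathbb{R}^n$ and let $\mathcal{K}$ be a kernel on $\mathcal{X}$ with feature map $\psi$ into an RKHS $\mathcal{H}$ such that $\|\psi(\mathbf{x})\|\le 1$ for all $\mathbf{x}\in\mathcal{X}$. Let $\mathcal{D}$ be a distribution on $\mathcal{X}\times[0,1]$ such that $\mathbb{E}[y\mid\mathbf{x}]=u(\langle \mathbf{v},\psi(\mathbf{x})\rangle+\xi(\mathbf{x}))$, where $u:\mathbb{R}\to[0,1]$ is a known $L$-Lipschitz non-decreasing function, $\xi:\mathbb{R}^n\to[-M,M]$ for some $M>0$ satisfies $\mathbb{E}[\xi(\mathbf{x})^2]\le\epsilon$, and $\mathbf{v}\in\mathcal{H}$ satisfies $\|\mathbf{v}\|\le B$. Let $(\mathbf{x}_i,y_i)_{i=1}^m$ be drawn i.i.d. from $\mathcal{D}$, and let the held-out sample $(\mathbf{a}_j,b_j)_{j=1}^N$ also be drawn i.i.d. from $\mathcal{D}$. Then for every $\delta\in(0,1)$, with probability at least $1-\delta$, Alphatron run with $\lambda=1/L$, $T=CBL\sqrt{m/\log(1/\delta)}$ and $N=C'm\log(T/\delta)$, for large enough constants $C,C'>0$, outputs a hypothesis $h$ such that \[\varepsilon(h)\le O\left(L\sqrt{\epsilon}+LM\sqrt[4]{\frac{\log(1/\delta)}{m}}+BL\sqrt{\frac{\log(1/\delta)}{m}}\right).\]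
   Context: Alphatron is the following algorithm. Input: data $(\mathbf{x}_i,y_i)_{i=1}^m\in\mathbb{R}^n\times[0,1]$, a non-decreasing $L$-Lipschitz $u:\mathbb{R}\to[0,1]$, a kernel $\mathcal{K}$, a learning rate $\lambda>0$, a number of iterations $T$, and held-out data $(\mathbf{a}_j,b_j)_{j=1}^N\in\mathbb{R}^n\times[0,1]$. Set $\alpha^1=0\in\mathbb{R}^m$. For $t=1,\dots,T$: let $h^t(\mathbf{x})=u\big(\sum_{i=1}^m\alpha_i^t\mathcal{K}(\mathbf{x},\mathbf{x}_i)\big)$ and for each $i$ set $\alpha_i^{t+1}=\alpha_i^t+\frac{\lambda}{m}(y_i-h^t(\mathbf{x}_i))$. Output $h^r$ where $r=\arg\min_{t\in\{1,\dots,T\}}\sum_{j=1}^N(h^t(\mathbf{a}_j)-b_j)^2$. For a hypothesis $h$, $\varepsilon(h)=\mathbb{E}_{(\mathbf{x},y)\sim\mathcal{D}}[(h(\mathbf{x})-\mathbb{E}[y\mid\mathbf{x}])^2]$.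
   Formalization: The constants C, C' and the O-constant may depend on an arbitrary upper bound δ0<1 on δ; with constants uniform over all δ in (0,1) the claim fails as δ→1 (m=1, one-point X, y uniform on {0,1}: error stays 1/4 while the bound tends to 0). *)

theory Defs
  imports "HOL-Probability.Probability"
begin

(* R^n, with points represented as functions on {..<n}.  The dimension is a number and the
   RKHS below is a set of functions, rather than types, so that the absolute constants of the
   theorem can be quantified outside of both. *)
abbreviation euclid :: "nat \<Rightarrow> (nat \<Rightarrow> real) measure" where
  "euclid n \<equiv> PiM {..<n} (\<lambda>_. borel)"

definition hnorm :: "(('a \<Rightarrow> real) \<Rightarrow> ('a \<Rightarrow> real) \<Rightarrow> real) \<Rightarrow> ('a \<Rightarrow> real) \<Rightarrow> real" where
  "hnorm ip f = sqrt (ip f f)"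

(* A reproducing kernel Hilbert space: a Hilbert space of functions on Z (extended by 0 outside
   of Z) on which all point evaluations are bounded.  Only the values of ip on H matter. *)
locale rkhs =
  fixes Z :: "'a set"
    and H :: "('a \<Rightarrow> real) set"
    and ip :: "('a \<Rightarrow> real) \<Rightarrow> ('a \<Rightarrow> real) \<Rightarrow> real"
  assumes supported: "\<And>f z. f \<in> H \<Longrightarrow> z \<notin> Z \<Longrightarrow> f z = 0"
    and zero_mem: "(\<lambda>_. 0) \<in> H"
    and add_mem: "\<And>f g. f \<in> H \<Longrightarrow> g \<in> H \<Longrightarrow> (\<lambda>z. f z + g z) \<in> H"
    and scale_mem: "\<And>c f. f \<in> H \<Longrightarrow> (\<lambda>z. c * f z) \<in> H"
    and ip_sym: "\<And>f g. f \<in> H \<Longrightarrow> g \<in> H \<Longrightarrow> ip f g = ip g f"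
    and ip_add: "\<And>f g k. f \<in> H \<Longrightarrow> g \<in> H \<Longrightarrow> k \<in> H \<Longrightarrow> ip (\<lambda>z. f z + g z) k = ip f k + ip g k"
    and ip_scale: "\<And>c f g. f \<in> H \<Longrightarrow> g \<in> H \<Longrightarrow> ip (\<lambda>z. c * f z) g = c * ip f g"
    and ip_nonneg: "\<And>f. f \<in> H \<Longrightarrow> 0 \<le> ip f f"
    and ip_definite: "\<And>f. f \<in> H \<Longrightarrow> ip f f = 0 \<Longrightarrow> f = (\<lambda>_. 0)"
    and complete: "\<And>F. (\<And>k. F k \<in> H) \<Longrightarrow>
        (\<And>e. e > 0 \<Longrightarrow> \<exists>k0. \<forall>j\<ge>k0. \<forall>k\<ge>k0. hnorm ip (\<lambda>z. F j z - F k z) < e) \<Longrightarrow>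
        \<exists>f\<in>H. (\<lambda>k. hnorm ip (\<lambda>z. F k z - f z)) \<longlonglongrightarrow> 0"
    and evaluation_bounded: "\<And>z. z \<in> Z \<Longrightarrow> \<exists>c. \<forall>f\<in>H. \<bar>f z\<bar> \<le> c * hnorm ip f"

(* E[y | x] as a random variable on the space of pairs (x, y): the conditional expectation of
   the second component given the sigma-algebra generated by the first. *)
definition cond_mean :: "'a measure \<Rightarrow> ('a \<times> real) measure \<Rightarrow> 'a \<times> real \<Rightarrow> real" where
  "cond_mean MX D = real_cond_exp D (vimage_algebra (space D) fst MX) snd"

definition excess_err :: "'a measure \<Rightarrow> ('a \<times> real) measure \<Rightarrow> ('a \<Rightarrow> real) \<Rightarrow> real" where
  "excess_err MX D h = (\<integral>z. (h (fst z) - cond_mean MX D z)\<^sup>2 \<partial>D)"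

(* H may be a space of functions on any Z; the canonical instance is Z = X with
   \<psi> x = K x.  The data set X carries the trace of the Borel sets of R^n.  kernel_measurable and
   feature_measurable make the hypotheses and the target u(<v, \<psi> x> + \<xi> x) random variables
   (the latter follows from the former by projecting onto the closed span of \<psi> ` X). *)
locale alphatron_setting = rkhs Z H ip + prob_space D
  for Z :: "(nat \<Rightarrow> real) set"
    and H :: "((nat \<Rightarrow> real) \<Rightarrow> real) set"
    and ip :: "((nat \<Rightarrow> real) \<Rightarrow> real) \<Rightarrow> ((nat \<Rightarrow> real) \<Rightarrow> real) \<Rightarrow> real"
    and D :: "((nat \<Rightarrow> real) \<times> real) measure" +
  fixes n :: nat
    and X :: "(nat \<Rightarrow> real) set"
    and K :: "(nat \<Rightarrow> real) \<Rightarrow> (nat \<Rightarrow> real) \<Rightarrow> real"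
    and \<psi> :: "(nat \<Rightarrow> real) \<Rightarrow> ((nat \<Rightarrow> real) \<Rightarrow> real)"
    and v :: "(nat \<Rightarrow> real) \<Rightarrow> real"
    and u :: "real \<Rightarrow> real"
    and \<xi> :: "(nat \<Rightarrow> real) \<Rightarrow> real"
    and L B M \<epsilon> :: real
  assumes X_subset: "X \<subseteq> space (euclid n)"
    and feature_mem: "\<And>x. x \<in> X \<Longrightarrow> \<psi> x \<in> H"
    and kernel_eq: "\<And>x x'. x \<in> X \<Longrightarrow> x' \<in> X \<Longrightarrow> K x x' = ip (\<psi> x) (\<psi> x')"
    and feature_norm: "\<And>x. x \<in> X \<Longrightarrow> hnorm ip (\<psi> x) \<le> 1"
    and kernel_measurable: "(\<lambda>(x, x'). K x x') \<in> borel_measurable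
          (restrict_space (euclid n) X \<Otimes>\<^sub>M restrict_space (euclid n) X)"
    and feature_measurable: "\<And>w. w \<in> H \<Longrightarrow>
          (\<lambda>x. ip w (\<psi> x)) \<in> borel_measurable (restrict_space (euclid n) X)"
    and sets_D: "sets D = sets (restrict_space (euclid n) X \<Otimes>\<^sub>M restrict_space borel {0..1})"
    and L_pos: "0 < L"
    and u_range: "\<And>s. u s \<in> {0..1}"
    and u_mono: "mono u"
    and u_lipschitz: "L-lipschitz_on UNIV u"
    and M_pos: "0 < M"
    and xi_measurable: "\<xi> \<in> borel_measurable (restrict_space (euclid n) X)"
    and xi_bound: "\<And>x. x \<in> space (euclid n) \<Longrightarrow> \<xi> x \<in> {-M..M}"
    and xi_second_moment: "(\<integral>z. (\<xi> (fst z))\<^sup>2 \<partial>D) \<le> \<epsilon>"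
    and B_pos: "0 < B"
    and v_mem: "v \<in> H"
    and v_norm: "hnorm ip v \<le> B"
    and cond_mean_eq: "AE z in D. cond_mean (restrict_space (euclid n) X) D z
          = u (ip v (\<psi> (fst z)) + \<xi> (fst z))"

definition kernel_hyp ::
  "(real \<Rightarrow> real) \<Rightarrow> ('a \<Rightarrow> 'a \<Rightarrow> real) \<Rightarrow> nat \<Rightarrow> (nat \<Rightarrow> 'a \<times> real) \<Rightarrow> (nat \<Rightarrow> real) \<Rightarrow> 'a \<Rightarrow> real" where
  "kernel_hyp u K m S a x = u (\<Sum>i<m. a i * K x (fst (S i)))"

(* The coefficients \<alpha>^t, with iterations numbered from t = 1 (the value at t = 0 is a dummy);
   the training sample is S i = (x_i, y_i) for i < m. *)
fun alpha ::
  "(real \<Rightarrow> real) \<Rightarrow> ('a \<Rightarrow> 'a \<Rightarrow> real) \<Rightarrow> real \<Rightarrow> nat \<Rightarrow> (nat \<Rightarrow> 'a \<times> real) \<Rightarrow> nat \<Rightarrow> nat \<Rightarrow> real" where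
  "alpha u K lr m S 0 = (\<lambda>i. 0)"
| "alpha u K lr m S (Suc 0) = (\<lambda>i. 0)"
| "alpha u K lr m S (Suc (Suc t)) = (\<lambda>i. alpha u K lr m S (Suc t) i
     + lr / real m * (snd (S i) - kernel_hyp u K m S (alpha u K lr m S (Suc t)) (fst (S i))))"

definition alphatron_hyp ::
  "(real \<Rightarrow> real) \<Rightarrow> ('a \<Rightarrow> 'a \<Rightarrow> real) \<Rightarrow> real \<Rightarrow> nat \<Rightarrow> (nat \<Rightarrow> 'a \<times> real) \<Rightarrow> nat \<Rightarrow> 'a \<Rightarrow> real" where
  "alphatron_hyp u K lr m S t = kernel_hyp u K m S (alpha u K lr m S t)"

(* h is a possible output on training sample S and held-out sample A: ties in the argmin may be
   broken in any way. *)
definition alphatron_output ::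
  "(real \<Rightarrow> real) \<Rightarrow> ('a \<Rightarrow> 'a \<Rightarrow> real) \<Rightarrow> real \<Rightarrow> nat \<Rightarrow> nat \<Rightarrow> nat \<Rightarrow>
   (nat \<Rightarrow> 'a \<times> real) \<Rightarrow> (nat \<Rightarrow> 'a \<times> real) \<Rightarrow> ('a \<Rightarrow> real) \<Rightarrow> bool" where
  "alphatron_output u K lr T m N S A h \<longleftrightarrow>
     (\<exists>r. is_arg_min (\<lambda>t. \<Sum>j<N. (alphatron_hyp u K lr m S t (fst (A j)) - snd (A j))\<^sup>2)
            (\<lambda>t. t \<in> {1..T}) r
        \<and> h = alphatron_hyp u K lr m S r)"

(* Real-valued iteration and sample counts are rounded up.  The held-out size uses the rounded
   T \<ge> 1. *)
definition num_iter :: "real \<Rightarrow> real \<Rightarrow> real \<Rightarrow> nat \<Rightarrow> real \<Rightarrow> nat" where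
  "num_iter C B L m \<delta> = nat \<lceil>C * B * L * sqrt (real m / ln (1 / \<delta>))\<rceil>"

definition num_heldout :: "real \<Rightarrow> nat \<Rightarrow> nat \<Rightarrow> real \<Rightarrow> nat" where
  "num_heldout C' m T \<delta> = nat \<lceil>C' * real m * ln (real T / \<delta>)\<rceil>"

(* On the reading of "for every \<delta> in (0,1)" in the theorem: its constants depend on nothing but an
   arbitrary upper bound \<delta>0 < 1 on \<delta>.  They cannot be uniform on all of (0,1), because the claimed
   bound degenerates as \<delta> tends to 1: take m = 1, X a single point, \<psi> = 1, u(s) = min(1, max(0, s)),
   L = 1, v = B = 1/2, \<xi> = 0, \<epsilon> = 0 and y uniform on {0, 1}.  Then every h^t is constant 0 or 1, so
   the error is always 1/4, while log(1/\<delta>) tends to 0. *)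

end

(*
  The population error is split into an optimization, a generalization and a selection part.

  Optimization: if the empirical error of an iterate w is large compared with the norm of the
  average noise vector, the average of |xi| and B L sqrt(log(1/delta)/m), then one step decreases
  |w - v|^2 by a fixed amount.  Hence some iterate t <= T has small empirical error while
  |w - v| <= B.

  Generalization: the loss (h - u<v, psi>)^2 of such an iterate is at most B L, and by symmetrization
  and contraction its mean exceeds its empirical average by O(B L sqrt(log(1/delta)/m)).

  Selection: the held-out error relative to the target satisfies a Bernstein condition, so the
  selected hypothesis is within a constant factor of the best one up to O(log(T/delta)/N) = O(1/m).
  If C B L <= sqrt(log(1/delta)/m), then T = 1 and the constant hypothesis u 0 is already good
  enough; otherwise 1/m is O(B L sqrt(log(1/delta)/m)).
*)

theory Submission
  imports Defs
begin

section \<open>Averages over signs\<close>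

text \<open>Small \<open>B * L\<close> shapes the proof. A loss bounded only by 1 would deviate by
  the order of \<open>q = sqrt (ln (1 / \<delta>) / m)\<close>, and the rate allows
  \<open>B * L * q\<close>; so the range of the loss must shrink with \<open>B * L\<close>. The true
  target is unsuitable for that, since it differs from the hypotheses also through \<xi>; passing to
  the target without \<xi> costs only \<open>L * \<bar>\<xi>\<bar>\<close>. For the same reason the
  squared noise, of order \<open>q\<^sup>2\<close>, is affordable only if
  \<open>q \<le> C * B * L\<close>, a second use of the case split on \<open>T\<close>. The fourth
  root is not a concentration rate: the average of \<bar>\<xi>\<bar> deviates by the order of
  \<open>M * q\<close>, but never exceeds \<open>M\<close>, and the smaller of 1 and
  \<open>q\<close> is at most \<open>sqrt q\<close>. The lower bound on
  \<open>ln (1 / \<delta>)\<close> that comes from \<open>\<delta>0\<close> absorbs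
  \<open>1 / sqrt m\<close> and the constants \<open>ln 4\<close> and \<open>ln 8\<close> of the
  union bounds into multiples of \<open>q\<close>. \<open>H\<close> carries no sigma-algebra. Norms
  of random vectors are therefore rewritten as finite kernel sums wherever they occur in
  events.\<close>

lemma sum_Pow_insert:
  fixes F :: "'a set \<Rightarrow> 'b::comm_monoid_add"
  assumes "finite I" "i \<notin> I"
  shows "(\<Sum>J\<in>Pow (insert i I). F J) = (\<Sum>J\<in>Pow I. F J + F (insert i J))"
proof -
  have "(\<Sum>J\<in>Pow (insert i I). F J) = (\<Sum>J\<in>Pow I. F J) + (\<Sum>J\<in>insert i ` Pow I. F J)"
    unfolding Pow_insert using assms by (intro sum.union_disjoint) auto
  also have "(\<Sum>J\<in>insert i ` Pow I. F J) = (\<Sum>J\<in>Pow I. F (insert i J))"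
    using assms by (subst sum.reindex) (auto simp: inj_on_def intro!: insert_ident[THEN iffD1])
  finally show ?thesis by (simp add: sum.distrib)
qed

text \<open>Hoeffding's lemma for the uniform distribution on the two points \<open>a\<close> and
  \<open>b\<close>.\<close>

lemma exp_average_le:
  fixes a b :: real
  shows "(exp a + exp b) / 2 \<le> exp ((a + b) / 2 + (a - b)\<^sup>2 / 8)"
proof (induction a b rule: linorder_wlog)
  case (le a b)
  have pos: "0 < 1 + (exp (b - a) - 1) / 2"
    using exp_gt_zero[of "b - a"] by (simp add: field_simps del: exp_gt_zero)
  have "ln (1 + (exp (b - a) - 1) / 2) \<le> (b - a) / 2 + (b - a)\<^sup>2 / 8"
    using Hoeffdings_lemma_aux[of "b - a" "1/2"] le by (simp add: diff_divide_distrib)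
  hence "1 + (exp (b - a) - 1) / 2 \<le> exp ((b - a) / 2 + (b - a)\<^sup>2 / 8)"
    using pos by (metis exp_le_cancel_iff exp_ln)
  hence "exp a * (1 + (exp (b - a) - 1) / 2) \<le> exp a * exp ((b - a) / 2 + (b - a)\<^sup>2 / 8)"
    by (intro mult_left_mono) auto
  also have "exp a * (1 + (exp (b - a) - 1) / 2) = (exp a + exp b) / 2"
    by (simp add: field_simps exp_diff)
  also have "exp a * exp ((b - a) / 2 + (b - a)\<^sup>2 / 8) = exp ((a + b) / 2 + (a - b)\<^sup>2 / 8)"
    by (simp add: exp_add[symmetric] power2_commute[of a b]) (simp add: field_simps)
  finally show ?case .
qed (simp add: add.commute power2_commute)

text \<open>Bounded differences for a uniformly random subset \<open>J\<close> of \<open>I\<close>.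
  Averaging over the membership of one index costs a factor \<open>exp (c\<^sup>2 / 8)\<close> by
  the two-point bound, and the average \<open>G\<close> again has differences at most
  \<open>c\<close>, so the remaining indices are handled by induction.\<close>

lemma sum_Pow_exp_le:
  fixes F :: "'a set \<Rightarrow> real" and c :: real
  assumes "finite I"
    and "\<And>i J. i \<in> I \<Longrightarrow> J \<subseteq> I \<Longrightarrow> i \<notin> J \<Longrightarrow> \<bar>F (insert i J) - F J\<bar> \<le> c"
  shows "(\<Sum>J\<in>Pow I. exp (F J)) \<le> 2 ^ card I * exp ((\<Sum>J\<in>Pow I. F J) / 2 ^ card I + card I * c\<^sup>2 / 8)"
  using assms
proof (induction I arbitrary: F rule: finite_induct)
  case (insert i I)
  define G where "G J = (F J + F (insert i J)) / 2" for J
  have G: "\<bar>G (insert k J) - G J\<bar> \<le> c" if "k \<in> I" "J \<subseteq> I" "k \<notin> J" for k J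
  proof -
    have "\<bar>F (insert k J) - F J\<bar> \<le> c"
      using that insert.hyps by (intro insert.prems) auto
    moreover have "\<bar>F (insert k (insert i J)) - F (insert i J)\<bar> \<le> c"
      using that insert.hyps by (intro insert.prems) auto
    hence "\<bar>F (insert i (insert k J)) - F (insert i J)\<bar> \<le> c"
      by (simp only: insert_commute[of k i])
    ultimately show ?thesis
      unfolding G_def add_divide_distrib by linarith
  qed
  have two: "exp (F J) + exp (F (insert i J)) \<le> 2 * exp (c\<^sup>2 / 8) * exp (G J)" if "J \<subseteq> I" for J
  proof -
    have "\<bar>F (insert i J) - F J\<bar> \<le> c"
      using that insert.hyps by (intro insert.prems) auto
    hence sq: "(F J - F (insert i J))\<^sup>2 \<le> c\<^sup>2"
      by (subst abs_le_square_iff[symmetric]) auto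
    have "(exp (F J) + exp (F (insert i J))) / 2 \<le> exp (G J + (F J - F (insert i J))\<^sup>2 / 8)"
      unfolding G_def by (rule exp_average_le)
    also have "\<dots> \<le> exp (G J + c\<^sup>2 / 8)"
      using sq by simp
    finally show ?thesis by (simp add: exp_add mult_ac)
  qed
  have "(\<Sum>J\<in>Pow (insert i I). exp (F J)) = (\<Sum>J\<in>Pow I. exp (F J) + exp (F (insert i J)))"
    by (rule sum_Pow_insert) fact+
  also have "\<dots> \<le> (\<Sum>J\<in>Pow I. 2 * exp (c\<^sup>2 / 8) * exp (G J))"
    by (intro sum_mono two) auto
  also have "\<dots> = 2 * exp (c\<^sup>2 / 8) * (\<Sum>J\<in>Pow I. exp (G J))"
    by (simp add: sum_distrib_left)
  also have "\<dots> \<le> 2 * exp (c\<^sup>2 / 8) *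
      (2 ^ card I * exp ((\<Sum>J\<in>Pow I. G J) / 2 ^ card I + card I * c\<^sup>2 / 8))"
    by (intro mult_left_mono insert.IH G) auto
  also have "(\<Sum>J\<in>Pow I. G J) = (\<Sum>J\<in>Pow (insert i I). F J) / 2"
    using insert.hyps by (subst sum_Pow_insert) (auto simp: G_def sum_divide_distrib)
  also have "2 * exp (c\<^sup>2 / 8) * (2 ^ card I *
        exp ((\<Sum>J\<in>Pow (insert i I). F J) / 2 / 2 ^ card I + card I * c\<^sup>2 / 8))
      = 2 ^ card (insert i I) *
        (exp (c\<^sup>2 / 8) * exp ((\<Sum>J\<in>Pow (insert i I). F J) / 2 ^ card (insert i I) + card I * c\<^sup>2 / 8))"
    using insert.hyps by simp
  also have "exp (c\<^sup>2 / 8) * exp ((\<Sum>J\<in>Pow (insert i I). F J) / 2 ^ card (insert i I) + card I * c\<^sup>2 / 8)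
      = exp ((\<Sum>J\<in>Pow (insert i I). F J) / 2 ^ card (insert i I) + card (insert i I) * c\<^sup>2 / 8)"
    using insert.hyps by (simp add: algebra_simps add_divide_distrib flip: exp_add)
  finally show ?case .
qed auto

section \<open>Rademacher signs and the contraction principle\<close>

text \<open>A sign vector is encoded by the set of its negative entries, so a Rademacher expectation
  over \<open>I\<close> is a sum over \<open>Pow I\<close> divided by \<open>2 ^ card I\<close>. The
  same set later selects the coordinates to be swapped with the ghost sample.\<close>

definition rsign :: "'a set \<Rightarrow> 'a \<Rightarrow> real" where
  "rsign J i = (if i \<in> J then -1 else 1)"

lemma Max_image_le:
  fixes F :: "'a \<Rightarrow> 'b::linorder"
  shows "finite W \<Longrightarrow> W \<noteq> {} \<Longrightarrow> (\<And>w. w \<in> W \<Longrightarrow> F w \<le> c) \<Longrightarrow> Max (F ` W) \<le> c"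
  by auto

text \<open>Contraction for a single sign. If \<open>w\<close> and \<open>w'\<close> attain the two
  maxima on the left, then \<open>f w - f w'\<close> is at most \<open>t w - t w'\<close> or
  \<open>t w' - t w\<close>; in the first case \<open>w\<close>, \<open>w'\<close> and in the second
  \<open>w'\<close>, \<open>w\<close> are candidates for the two maxima on the right.\<close>

lemma Max_plus_minus_contraction:
  fixes A f t :: "'w \<Rightarrow> real"
  assumes W: "finite W" "W \<noteq> {}"
    and lip: "\<And>w w'. w \<in> W \<Longrightarrow> w' \<in> W \<Longrightarrow> \<bar>f w - f w'\<bar> \<le> \<bar>t w - t w'\<bar>"
  shows "Max ((\<lambda>w. A w + f w) ` W) + Max ((\<lambda>w. A w - f w) ` W)
       \<le> Max ((\<lambda>w. A w + t w) ` W) + Max ((\<lambda>w. A w - t w) ` W)" (is "?L \<le> ?R")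
proof -
  have ge: "A w + t w \<le> Max ((\<lambda>w. A w + t w) ` W)" "A w - t w \<le> Max ((\<lambda>w. A w - t w) ` W)"
    if "w \<in> W" for w
    using W that by auto
  have "Max ((\<lambda>w. A w + f w) ` W) \<in> (\<lambda>w. A w + f w) ` W" "Max ((\<lambda>w. A w - f w) ` W) \<in> (\<lambda>w. A w - f w) ` W"
    using W by (intro Max_in; simp)+
  then obtain w w' where w: "w \<in> W" "w' \<in> W"
    "?L = A w + f w + (A w' - f w')"
    by auto
  show ?thesis
    using lip[OF w(1,2)] ge[OF w(1)] ge[OF w(2)] w(3) by linarith
qed

text \<open>The Ledoux-Talagrand contraction principle without absolute values, so no condition at 0
  is needed. The offset \<open>A\<close> is arbitrary because the induction moves the term of the
  removed index into it.\<close>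

lemma rademacher_contraction:
  fixes A :: "'w \<Rightarrow> real" and f t :: "'a \<Rightarrow> 'w \<Rightarrow> real"
  assumes "finite I" and W: "finite W" "W \<noteq> {}"
    and "\<And>i w w'. i \<in> I \<Longrightarrow> w \<in> W \<Longrightarrow> w' \<in> W \<Longrightarrow> \<bar>f i w - f i w'\<bar> \<le> \<bar>t i w - t i w'\<bar>"
  shows "(\<Sum>J\<in>Pow I. Max ((\<lambda>w. A w + (\<Sum>i\<in>I. rsign J i * f i w)) ` W))
       \<le> (\<Sum>J\<in>Pow I. Max ((\<lambda>w. A w + (\<Sum>i\<in>I. rsign J i * t i w)) ` W))"
  using assms(1,4)
proof (induction I arbitrary: A rule: finite_induct)
  case (insert k I)
  define B where "B g J w = (\<Sum>i\<in>I. rsign J i * g i w)" for g :: "'a \<Rightarrow> 'w \<Rightarrow> real" and J w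
  have split: "(\<Sum>J\<in>Pow (insert k I). Max ((\<lambda>w. A w + (\<Sum>i\<in>insert k I. rsign J i * g i w)) ` W))
      = (\<Sum>J\<in>Pow I. Max ((\<lambda>w. (A w + g k w) + B g J w) ` W))
      + (\<Sum>J\<in>Pow I. Max ((\<lambda>w. (A w - g k w) + B g J w) ` W))" for g
  proof -
    have "(\<Sum>i\<in>insert k I. rsign J i * g i w) = g k w + B g J w"
         "(\<Sum>i\<in>insert k I. rsign (insert k J) i * g i w) = - g k w + B g J w" if "J \<subseteq> I" for J w
    proof -
      have "k \<notin> J" using that insert.hyps by auto
      moreover have "(\<Sum>i\<in>I. rsign (insert k J) i * g i w) = B g J w"
        unfolding B_def using insert.hyps by (intro sum.cong) (auto simp: rsign_def)
      ultimately show "(\<Sum>i\<in>insert k I. rsign J i * g i w) = g k w + B g J w"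
         "(\<Sum>i\<in>insert k I. rsign (insert k J) i * g i w) = - g k w + B g J w"
        using insert.hyps by (simp_all add: B_def[symmetric]) (simp_all add: rsign_def)
    qed
    note eq = this
    have "(\<Sum>J\<in>Pow (insert k I). Max ((\<lambda>w. A w + (\<Sum>i\<in>insert k I. rsign J i * g i w)) ` W))
      = (\<Sum>J\<in>Pow I. Max ((\<lambda>w. (A w + g k w) + B g J w) ` W)
          + Max ((\<lambda>w. (A w - g k w) + B g J w) ` W))"
      unfolding sum_Pow_insert[OF insert.hyps]
    proof (intro sum.cong refl)
      fix J assume "J \<in> Pow I"
      hence J: "J \<subseteq> I" by simp
      show "Max ((\<lambda>w. A w + (\<Sum>i\<in>insert k I. rsign J i * g i w)) ` W)
          + Max ((\<lambda>w. A w + (\<Sum>i\<in>insert k I. rsign (insert k J) i * g i w)) ` W)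
        = Max ((\<lambda>w. (A w + g k w) + B g J w) ` W) + Max ((\<lambda>w. (A w - g k w) + B g J w) ` W)"
        unfolding eq[OF J] by (simp only: add.assoc diff_conv_add_uminus)
    qed
    thus ?thesis by (simp add: sum.distrib)
  qed
  have "(\<Sum>J\<in>Pow (insert k I). Max ((\<lambda>w. A w + (\<Sum>i\<in>insert k I. rsign J i * f i w)) ` W))
      \<le> (\<Sum>J\<in>Pow I. Max ((\<lambda>w. (A w + f k w) + B t J w) ` W))
      + (\<Sum>J\<in>Pow I. Max ((\<lambda>w. (A w - f k w) + B t J w) ` W))"
    \<comment> \<open>The induction hypothesis is used with the offsets \<open>A + f k\<close> and
      \<open>A - f k\<close>. Afterwards the sum \<open>B t J\<close> over the other indices is part
      of the offset, and only the sign of \<open>k\<close> remains.\<close>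
    unfolding split unfolding B_def by (intro add_mono insert.IH insert.prems) auto
  also have "\<dots> = (\<Sum>J\<in>Pow I. Max ((\<lambda>w. (A w + B t J w) + f k w) ` W)
      + Max ((\<lambda>w. (A w + B t J w) - f k w) ` W))"
    by (simp add: sum.distrib algebra_simps)
  also have "\<dots> \<le> (\<Sum>J\<in>Pow I. Max ((\<lambda>w. (A w + B t J w) + t k w) ` W)
      + Max ((\<lambda>w. (A w + B t J w) - t k w) ` W))"
    by (intro sum_mono Max_plus_minus_contraction W insert.prems) auto
  also have "\<dots> = (\<Sum>J\<in>Pow I. Max ((\<lambda>w. (A w + t k w) + B t J w) ` W))
      + (\<Sum>J\<in>Pow I. Max ((\<lambda>w. (A w - t k w) + B t J w) ` W))"
    by (simp add: sum.distrib algebra_simps)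
  finally show ?case unfolding split .
qed auto

section \<open>Concentration on product spaces\<close>

lemma (in finite_measure) integrable_bounded:
  fixes f :: "'a \<Rightarrow> real"
  assumes "f \<in> borel_measurable M" "\<And>x. x \<in> space M \<Longrightarrow> \<bar>f x\<bar> \<le> b"
  shows "integrable M f"
  using assms by (intro integrable_const_bound[of f b]) auto

text \<open>Hoeffding's lemma for a function known only through its oscillation; its infimum
  \<open>a\<close> supplies the interval from \<open>a\<close> to \<open>a + c\<close>.\<close>

lemma (in prob_space) expectation_exp_le:
  fixes f :: "'a \<Rightarrow> real" and c :: real
  assumes [measurable]: "f \<in> borel_measurable M"
    and c: "\<And>x y. x \<in> space M \<Longrightarrow> y \<in> space M \<Longrightarrow> \<bar>f x - f y\<bar> \<le> c"
  shows "expectation (\<lambda>x. exp (f x)) \<le> exp (expectation f + c\<^sup>2 / 8)"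
proof -
  obtain x0 where x0: "x0 \<in> space M" using not_empty by auto
  define a where "a = Inf (f ` space M)"
  have bdd: "bdd_below (f ` space M)"
  proof (rule bdd_belowI[of _ "f x0 - c"])
    fix r assume "r \<in> f ` space M"
    then obtain y where "y \<in> space M" "r = f y" by auto
    thus "f x0 - c \<le> r" using c[OF x0, of y] by linarith
  qed
  have "f x \<in> {a..a + c}" if x: "x \<in> space M" for x
  proof -
    have "f x - c \<le> a"
      unfolding a_def using x0 c[OF x] by (intro cInf_greatest) (auto simp: abs_le_iff algebra_simps)
    thus ?thesis
      using x bdd by (auto simp: a_def intro!: cInf_lower)
  qed
  then interpret interval_bounded_random_variable M f a "a + c"
    by unfold_locales auto
  have int: "integrable M (\<lambda>x. exp (f x - expectation f))"
    using \<open>\<And>x. x \<in> space M \<Longrightarrow> f x \<in> {a..a + c}\<close>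
    by (intro integrable_bounded[of _ "exp (a + c - expectation f)"]) auto
  have "ennreal (expectation (\<lambda>x. exp (f x - expectation f))) \<le> ennreal (exp (c\<^sup>2 / 8))"
    using Hoeffdings_lemma_nn_integral[of 1] int
    by (simp add: nn_integral_eq_integral)
  hence "expectation (\<lambda>x. exp (f x - expectation f)) \<le> exp (c\<^sup>2 / 8)"
    by simp
  also have "expectation (\<lambda>x. exp (f x - expectation f)) = expectation (\<lambda>x. exp (f x)) / exp (expectation f)"
    by (simp add: exp_diff)
  finally show ?thesis
    unfolding exp_add by (simp add: divide_le_eq mult.commute)
qed

lemma fun_upd_in_space_PiM:
  assumes "x \<in> space (PiM I (\<lambda>_. M))" "y \<in> space M"
  shows "x(i := y) \<in> space (PiM (insert i I) (\<lambda>_. M))"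
  using assms by (auto simp: space_PiM PiE_iff extensional_def)

text \<open>The moment bound behind McDiarmid's inequality. The function \<open>g\<close> obtained
  by integrating out one coordinate inherits the bounded differences, and for fixed other
  coordinates Hoeffding's lemma bounds the exponential moment by
  \<open>exp (g x + c\<^sup>2 / 8)\<close>.\<close>

lemma expectation_exp_bounded_differences:
  fixes f :: "('i \<Rightarrow> 'a) \<Rightarrow> real" and b c :: real
  assumes M: "prob_space M" and "finite I"
    and "f \<in> borel_measurable (PiM I (\<lambda>_. M))"
    and "\<And>x. x \<in> space (PiM I (\<lambda>_. M)) \<Longrightarrow> \<bar>f x\<bar> \<le> b"
    and "\<And>x i y. x \<in> space (PiM I (\<lambda>_. M)) \<Longrightarrow> i \<in> I \<Longrightarrow> y \<in> space M \<Longrightarrow> \<bar>f (x(i := y)) - f x\<bar> \<le> c"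
  shows "(\<integral>x. exp (f x) \<partial>PiM I (\<lambda>_. M))
    \<le> exp ((\<integral>x. f x \<partial>PiM I (\<lambda>_. M)) + card I * c\<^sup>2 / 8)"
  using assms(2-)
proof (induction I arbitrary: f rule: finite_induct)
  case empty
  show ?case
    by (simp add: PiM_empty lebesgue_integral_count_space_finite)
next
  case (insert i I)
  interpret M: prob_space M by fact
  interpret product_sigma_finite "\<lambda>_. M" ..
  interpret P: prob_space "PiM I (\<lambda>_. M)"
    by (intro prob_space_PiM M)
  interpret Q: prob_space "PiM (insert i I) (\<lambda>_. M)"
    by (intro prob_space_PiM M)
  note [measurable] = insert.prems(1)
  have upd [measurable]: "(\<lambda>(x, y). x(i := y)) \<in> PiM I (\<lambda>_. M) \<Otimes>\<^sub>M M \<rightarrow>\<^sub>M PiM (insert i I) (\<lambda>_. M)"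
    by (rule measurable_add_dim)
  have joint [measurable]: "(\<lambda>(x, y). f (x(i := y))) \<in> borel_measurable (PiM I (\<lambda>_. M) \<Otimes>\<^sub>M M)"
    using measurable_comp[OF upd insert.prems(1)] by (simp add: comp_def split_beta)
  have sect: "(\<lambda>y. f (x(i := y))) \<in> borel_measurable M" if "x \<in> space (PiM I (\<lambda>_. M))" for x
    using measurable_Pair2[OF joint that] by simp
  define g where "g x = (\<integral>y. f (x(i := y)) \<partial>M)" for x
  have sp: "x(i := y) \<in> space (PiM (insert i I) (\<lambda>_. M))"
    if "x \<in> space (PiM I (\<lambda>_. M))" "y \<in> space M" for x y
    using fun_upd_in_space_PiM[OF that] .
  have int: "integrable M (\<lambda>y. f (x(i := y)))" if "x \<in> space (PiM I (\<lambda>_. M))" for x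
    using insert.prems(2) sp that by (intro M.integrable_bounded[of _ b] sect) auto
  have g_meas [measurable]: "g \<in> borel_measurable (PiM I (\<lambda>_. M))"
    unfolding g_def using joint by (intro M.borel_measurable_lebesgue_integral) simp
  have g_bound: "\<bar>g x\<bar> \<le> b" if x: "x \<in> space (PiM I (\<lambda>_. M))" for x
  proof -
    have "\<bar>g x\<bar> \<le> (\<integral>y. \<bar>f (x(i := y))\<bar> \<partial>M)"
      unfolding g_def by (rule integral_abs_bound)
    also have "\<dots> \<le> (\<integral>y. b \<partial>M)"
      using insert.prems(2) sp x int by (intro integral_mono) auto
    finally show ?thesis by (simp add: M.prob_space)
  qed
  have g_diff: "\<bar>g (x(k := z)) - g x\<bar> \<le> c"
    if x: "x \<in> space (PiM I (\<lambda>_. M))" and k: "k \<in> I" and z: "z \<in> space M" for x k z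
  proof -
    have x': "x(k := z) \<in> space (PiM I (\<lambda>_. M))"
      using fun_upd_in_space_PiM[OF x z, of k] k by (simp add: insert_absorb)
    have ki: "k \<noteq> i" using k insert.hyps by auto
    have "g (x(k := z)) - g x = (\<integral>y. f (x(k := z, i := y)) - f (x(i := y)) \<partial>M)"
      unfolding g_def using int x x' by (intro Bochner_Integration.integral_diff[symmetric]) auto
    also have "\<bar>\<dots>\<bar> \<le> (\<integral>y. \<bar>f (x(k := z, i := y)) - f (x(i := y))\<bar> \<partial>M)"
      by (rule integral_abs_bound)
    also have "\<dots> \<le> (\<integral>y. c \<partial>M)"
    proof (intro integral_mono)
      fix y assume y: "y \<in> space M"
      show "\<bar>f (x(k := z, i := y)) - f (x(i := y))\<bar> \<le> c"
        unfolding fun_upd_twist[OF ki] using k z by (intro insert.prems(3) sp x y) auto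
    qed (use int x x' in auto)
    finally show ?thesis by (simp add: M.prob_space)
  qed
  have "(\<integral>x. exp (f x) \<partial>PiM (insert i I) (\<lambda>_. M))
      = (\<integral>x. (\<integral>y. exp (f (x(i := y))) \<partial>M) \<partial>PiM I (\<lambda>_. M))"
  proof (rule product_integral_insert)
    show "integrable (PiM (insert i I) (\<lambda>_. M)) (\<lambda>x. exp (f x))"
      using insert.prems(2) by (intro Q.integrable_bounded[of _ "exp b"]) (auto simp: abs_le_iff)
  qed fact+
  also have "\<dots> \<le> (\<integral>x. exp (g x) * exp (c\<^sup>2 / 8) \<partial>PiM I (\<lambda>_. M))"
  proof (intro integral_mono)
    fix x assume x: "x \<in> space (PiM I (\<lambda>_. M))"
    have "(\<integral>y. exp (f (x(i := y))) \<partial>M) \<le> exp (g x + c\<^sup>2 / 8)"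
      unfolding g_def
    proof (intro M.expectation_exp_le sect x)
      fix y z assume "y \<in> space M" "z \<in> space M"
      thus "\<bar>f (x(i := y)) - f (x(i := z))\<bar> \<le> c"
        using insert.prems(3)[OF sp[OF x, of z], of i y, unfolded fun_upd_upd] by blast
    qed
    thus "(\<integral>y. exp (f (x(i := y))) \<partial>M) \<le> exp (g x) * exp (c\<^sup>2 / 8)"
      by (simp add: exp_add)
  next
    have "\<bar>\<integral>y. exp (f (x(i := y))) \<partial>M\<bar> \<le> exp b" if x: "x \<in> space (PiM I (\<lambda>_. M))" for x
    proof -
      have "\<bar>\<integral>y. exp (f (x(i := y))) \<partial>M\<bar> \<le> (\<integral>y. \<bar>exp (f (x(i := y)))\<bar> \<partial>M)"
        by (rule integral_abs_bound)
      also have "\<dots> \<le> (\<integral>y. exp b \<partial>M)"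
      proof (intro integral_mono)
        show "integrable M (\<lambda>y. \<bar>exp (f (x(i := y)))\<bar>)"
          using insert.prems(2) sp x sect[OF x]
          by (intro M.integrable_bounded[of _ "exp b"]) (auto simp: abs_le_iff)
        show "\<bar>exp (f (x(i := y)))\<bar> \<le> exp b" if "y \<in> space M" for y
          unfolding abs_exp_cancel exp_le_cancel_iff
          by (rule abs_le_D1[OF insert.prems(2)[OF sp[OF x that]]])
      qed simp
      finally show ?thesis by (simp add: M.prob_space)
    qed
    thus "integrable (PiM I (\<lambda>_. M)) (\<lambda>x. \<integral>y. exp (f (x(i := y))) \<partial>M)"
      using joint
      by (intro P.integrable_bounded[of _ "exp b"] M.borel_measurable_lebesgue_integral)
         (auto simp: split_beta)
    show "integrable (PiM I (\<lambda>_. M)) (\<lambda>x. exp (g x) * exp (c\<^sup>2 / 8))"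
      using g_bound by (intro integrable_mult_left P.integrable_bounded[of _ "exp b"]) (auto simp: abs_le_iff)
  qed
  also have "\<dots> = (\<integral>x. exp (g x) \<partial>PiM I (\<lambda>_. M)) * exp (c\<^sup>2 / 8)"
    by simp
  also have "\<dots> \<le> exp ((\<integral>x. g x \<partial>PiM I (\<lambda>_. M)) + card I * c\<^sup>2 / 8) * exp (c\<^sup>2 / 8)"
    by (intro mult_right_mono insert.IH g_bound g_diff g_meas) auto
  also have "(\<integral>x. g x \<partial>PiM I (\<lambda>_. M)) = (\<integral>x. f x \<partial>PiM (insert i I) (\<lambda>_. M))"
    unfolding g_def
    by (intro product_integral_insert[symmetric] insert.hyps Q.integrable_bounded[of _ b] insert.prems)
  finally show ?case
    using insert.hyps by (simp add: algebra_simps add_divide_distrib flip: exp_add)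
qed

lemma (in prob_space) chernoff_bound:
  fixes f :: "'a \<Rightarrow> real"
  assumes [measurable]: "f \<in> borel_measurable M"
    and int: "integrable M (\<lambda>x. exp (f x))"
    and "expectation (\<lambda>x. exp (f x)) \<le> exp a"
  shows "prob {x \<in> space M. b < f x} \<le> exp (a - b)"
proof -
  have "prob {x \<in> space M. b < f x} \<le> prob {x \<in> space M. exp b \<le> exp (f x)}"
    by (intro finite_measure_mono) auto
  also have "\<dots> \<le> expectation (\<lambda>x. exp (f x)) / exp b"
    by (intro integral_Markov_inequality_measure[where A = "{}" and u = "\<lambda>x. exp (f x)"] int) auto
  also have "\<dots> \<le> exp a / exp b"
    by (intro divide_right_mono assms) auto
  finally show ?thesis by (simp add: exp_diff)
qed

lemma mcdiarmid:
  fixes f :: "('i \<Rightarrow> 'a) \<Rightarrow> real" and b c t :: real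
  assumes M: "prob_space M" and I: "finite I" "I \<noteq> {}" and c: "0 < c" and t: "0 < t"
    and meas [measurable]: "f \<in> borel_measurable (PiM I (\<lambda>_. M))"
    and bound: "\<And>x. x \<in> space (PiM I (\<lambda>_. M)) \<Longrightarrow> \<bar>f x\<bar> \<le> b"
    and diff: "\<And>x i y. x \<in> space (PiM I (\<lambda>_. M)) \<Longrightarrow> i \<in> I \<Longrightarrow> y \<in> space M \<Longrightarrow> \<bar>f (x(i := y)) - f x\<bar> \<le> c"
  shows "measure (PiM I (\<lambda>_. M)) {x \<in> space (PiM I (\<lambda>_. M)). (\<integral>x. f x \<partial>PiM I (\<lambda>_. M)) + t < f x}
    \<le> exp (- 2 * t\<^sup>2 / (card I * c\<^sup>2))"
proof -
  interpret P: prob_space "PiM I (\<lambda>_. M)"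
    by (intro prob_space_PiM M)
  define k where "k = real (card I) * c\<^sup>2"
  have k: "0 < k" using I c by (simp add: k_def card_gt_0_iff)
  \<comment> \<open>The minimizer of the exponent \<open>k * s\<^sup>2 / 8 - s * t\<close>.\<close>
  define s where "s = 4 * t / k"
  have s: "0 < s" using t k by (simp add: s_def)
  have sb: "\<bar>s * f x\<bar> \<le> s * b" if "x \<in> space (PiM I (\<lambda>_. M))" for x
    using bound[OF that] s by (simp add: abs_mult)
  have mgf: "P.expectation (\<lambda>x. exp (s * f x)) \<le> exp (P.expectation (\<lambda>x. s * f x) + card I * (s * c)\<^sup>2 / 8)"
  proof (rule expectation_exp_bounded_differences[OF M I(1) _ sb])
    fix x i y assume "x \<in> space (PiM I (\<lambda>_. M))" "i \<in> I" "y \<in> space M"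
    thus "\<bar>s * f (x(i := y)) - s * f x\<bar> \<le> s * c"
      using diff[of x i y] s by (simp add: abs_mult flip: right_diff_distrib)
  qed auto
  have "{x \<in> space (PiM I (\<lambda>_. M)). P.expectation f + t < f x}
      = {x \<in> space (PiM I (\<lambda>_. M)). s * (P.expectation f + t) < s * f x}"
    using s by simp
  also have "P.prob \<dots> \<le> exp (P.expectation (\<lambda>x. s * f x) + card I * (s * c)\<^sup>2 / 8 - s * (P.expectation f + t))"
    using sb by (intro P.chernoff_bound mgf P.integrable_bounded[of _ "exp (s * b)"]) (auto simp: abs_le_iff)
  also have "P.expectation (\<lambda>x. s * f x) + card I * (s * c)\<^sup>2 / 8 - s * (P.expectation f + t) = k * s\<^sup>2 / 8 - s * t"
    by (simp add: k_def power_mult_distrib algebra_simps)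
  also have "\<dots> = - 2 * t\<^sup>2 / k"
    using k by (simp add: s_def field_simps power2_eq_square)
  finally show ?thesis by (simp add: k_def)
qed

section \<open>Symmetrization with a ghost sample\<close>

abbreviation double_space :: "'a measure \<Rightarrow> nat \<Rightarrow> (nat \<times> bool \<Rightarrow> 'a) measure" where
  "double_space M m \<equiv> PiM ({..<m} \<times> UNIV) (\<lambda>_. M)"

definition half :: "nat \<Rightarrow> bool \<Rightarrow> (nat \<times> bool \<Rightarrow> 'a) \<Rightarrow> nat \<Rightarrow> 'a" where
  "half m b \<omega> = (\<lambda>i\<in>{..<m}. \<omega> (i, b))"

text \<open>The inequality of truth values is an exclusive or: the sample (\<open>False\<close>) and
  the ghost sample (\<open>True\<close>) are exchanged exactly at the indices in \<open>J\<close>.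
  As a permutation of i.i.d. coordinates this preserves the law of the double sample.\<close>

definition swap_halves :: "nat \<Rightarrow> nat set \<Rightarrow> (nat \<times> bool \<Rightarrow> 'a) \<Rightarrow> nat \<times> bool \<Rightarrow> 'a" where
  "swap_halves m J \<omega> = (\<lambda>n\<in>{..<m} \<times> UNIV. \<omega> (fst n, snd n \<noteq> (fst n \<in> J)))"

lemma measurable_half [measurable]: "half m b \<in> double_space M m \<rightarrow>\<^sub>M PiM {..<m} (\<lambda>_. M)"
  unfolding half_def by (intro measurable_restrict measurable_component_singleton) auto

lemma measurable_swap_halves [measurable]: "swap_halves m J \<in> double_space M m \<rightarrow>\<^sub>M double_space M m"
  unfolding swap_halves_def by (intro measurable_restrict measurable_component_singleton) auto

lemma distr_swap_halves:
  assumes "prob_space M"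
  shows "distr (double_space M m) (double_space M m) (swap_halves m J) = double_space M m"
  unfolding swap_halves_def
  by (rule distr_PiM_reindex) (auto simp: inj_on_def assms)

lemma distr_half:
  assumes "prob_space M"
  shows "distr (PiM ({..<m} \<times> {b}) (\<lambda>_. M)) (PiM {..<m} (\<lambda>_. M)) (half m b) = PiM {..<m} (\<lambda>_. M)"
  unfolding half_def
  by (rule distr_PiM_reindex) (auto simp: inj_on_def assms)

text \<open>Fubini: the double sample is a pair of independent samples, so the ghost sample can be
  integrated out while the training sample is held fixed.\<close>

lemma integral_double_space:
  fixes f :: "(nat \<Rightarrow> 'a) \<Rightarrow> (nat \<Rightarrow> 'a) \<Rightarrow> real"
  assumes M: "prob_space M"
    and f: "(\<lambda>(x, y). f x y) \<in> borel_measurable (PiM {..<m} (\<lambda>_. M) \<Otimes>\<^sub>M PiM {..<m} (\<lambda>_. M))"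
    and bound: "\<And>x y. x \<in> space (PiM {..<m} (\<lambda>_. M)) \<Longrightarrow> y \<in> space (PiM {..<m} (\<lambda>_. M)) \<Longrightarrow> \<bar>f x y\<bar> \<le> b"
  shows "(\<integral>\<omega>. f (half m False \<omega>) (half m True \<omega>) \<partial>double_space M m)
    = (\<integral>x. (\<integral>y. f x y \<partial>PiM {..<m} (\<lambda>_. M)) \<partial>PiM {..<m} (\<lambda>_. M))"
proof -
  let ?P = "PiM {..<m} (\<lambda>_. M)"
  let ?A = "{..<m} \<times> {False}" and ?B = "{..<m} \<times> {True}"
  interpret M: prob_space M by fact
  interpret product_sigma_finite "\<lambda>_. M" ..
  interpret P: prob_space ?P by (intro prob_space_PiM M)
  interpret W: prob_space "double_space M m" by (intro prob_space_PiM M)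
  have AB: "{..<m} \<times> UNIV = ?A \<union> ?B" by auto
  have meas: "(\<lambda>\<omega>. f (half m False \<omega>) (half m True \<omega>)) \<in> borel_measurable (double_space M m)"
    using measurable_compose[OF measurable_Pair[OF measurable_half measurable_half] f] by simp
  have hspace: "half m b \<omega> \<in> space ?P" if "\<omega> \<in> space (double_space M m)" for b \<omega>
    using measurable_space[OF measurable_half that] .
  have int: "integrable (PiM (?A \<union> ?B) (\<lambda>_. M)) (\<lambda>\<omega>. f (half m False \<omega>) (half m True \<omega>))"
    unfolding AB[symmetric] using bound hspace by (intro W.integrable_bounded[of _ b] meas) auto
  have half_meas: "half m b \<in> PiM ({..<m} \<times> {b}) (\<lambda>_. M) \<rightarrow>\<^sub>M ?P" for b
    unfolding half_def by (intro measurable_restrict measurable_component_singleton) auto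
  have "(\<integral>\<omega>. f (half m False \<omega>) (half m True \<omega>) \<partial>double_space M m)
      = (\<integral>x. (\<integral>y. f (half m False (merge ?A ?B (x, y))) (half m True (merge ?A ?B (x, y)))
            \<partial>PiM ?B (\<lambda>_. M)) \<partial>PiM ?A (\<lambda>_. M))"
    unfolding AB by (rule product_integral_fold[OF _ _ _ int]) auto
  also have "\<dots> = (\<integral>x. (\<integral>y. f (half m False x) (half m True y) \<partial>PiM ?B (\<lambda>_. M)) \<partial>PiM ?A (\<lambda>_. M))"
  proof -
    have "half m False (merge ?A ?B (x, y)) = half m False x"
         "half m True (merge ?A ?B (x, y)) = half m True y" for x y :: "nat \<times> bool \<Rightarrow> 'a"
      by (auto simp: half_def merge_def)
    thus ?thesis by simp
  qed
  also have "\<dots> = (\<integral>x. (\<integral>y. f (half m False x) y \<partial>?P) \<partial>PiM ?A (\<lambda>_. M))"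
  proof (intro Bochner_Integration.integral_cong refl)
    fix x assume x: "x \<in> space (PiM ?A (\<lambda>_. M))"
    have "(\<integral>y. f (half m False x) y \<partial>?P) = (\<integral>y. f (half m False x) y \<partial>distr (PiM ?B (\<lambda>_. M)) ?P (half m True))"
      by (simp add: distr_half M)
    also have "\<dots> = (\<integral>y. f (half m False x) (half m True y) \<partial>PiM ?B (\<lambda>_. M))"
      using measurable_Pair2[OF f measurable_space[OF half_meas x]]
      by (intro integral_distr half_meas) simp
    finally show "(\<integral>y. f (half m False x) (half m True y) \<partial>PiM ?B (\<lambda>_. M))
      = (\<integral>y. f (half m False x) y \<partial>?P)" ..
  qed
  also have "\<dots> = (\<integral>x. (\<integral>y. f x y \<partial>?P) \<partial>distr (PiM ?A (\<lambda>_. M)) ?P (half m False))"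
    using f by (intro integral_distr[symmetric] half_meas P.borel_measurable_lebesgue_integral)
  finally show ?thesis by (simp add: distr_half M)
qed

lemma half_swap_halves:
  assumes "i < m"
  shows "half m b (swap_halves m J \<omega>) i = half m (b \<noteq> (i \<in> J)) \<omega> i"
  using assms by (simp add: half_def swap_halves_def)

lemma integral_component_PiM:
  fixes f :: "'a \<Rightarrow> real"
  assumes "prob_space M" "i \<in> I" and f: "f \<in> borel_measurable M"
  shows "(\<integral>x. f (x i) \<partial>PiM I (\<lambda>_. M)) = (\<integral>x. f x \<partial>M)"
proof -
  have "(\<integral>x. f x \<partial>M) = (\<integral>x. f x \<partial>distr (PiM I (\<lambda>_. M)) M (\<lambda>x. x i))"
    using distr_PiM_component[of I "\<lambda>_. M" i] assms by simp
  also have "\<dots> = (\<integral>x. f (x i) \<partial>PiM I (\<lambda>_. M))"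
    using assms by (intro integral_distr) auto
  finally show ?thesis ..
qed

text \<open>
  The hypothesis on Rademacher averages is only needed for the finite class of losses that arise
  by training on the samples obtained from swapping coordinates of the sample with a ghost sample.
  This class is invariant under swapping, which is all that symmetrization uses; so no supremum
  over an uncountable class and none of its measurability problems occur.
\<close>

lemma generalization_bound:
  fixes loss :: "'t \<Rightarrow> (nat \<Rightarrow> 'a) \<Rightarrow> 'a \<Rightarrow> real" and M :: "'a measure"
    and m :: nat and r R s b :: real
  defines "P \<equiv> PiM {..<m} (\<lambda>_. M)"
  assumes M: "prob_space M" and Ts: "finite Ts" "Ts \<noteq> {}" and m: "0 < m" and s: "0 < s"
    and meas: "\<And>t. t \<in> Ts \<Longrightarrow> (\<lambda>(S, z). loss t S z) \<in> borel_measurable (P \<Otimes>\<^sub>M M)"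
    and range: "\<And>t S z. t \<in> Ts \<Longrightarrow> S \<in> space P \<Longrightarrow> z \<in> space M \<Longrightarrow> loss t S z \<in> {0..r}"
    and rademacher: "\<And>W z z'. finite W \<Longrightarrow> W \<noteq> {} \<Longrightarrow> W \<subseteq> {(t, S). t \<in> Ts \<and> S \<in> space P} \<Longrightarrow>
      (\<And>i. i < m \<Longrightarrow> z i \<in> space M \<and> z' i \<in> space M) \<Longrightarrow>
      (\<Sum>J\<in>Pow {..<m}. Max ((\<lambda>(t, S). \<Sum>i<m. rsign J i * (loss t S (z' i) - loss t S (z i))) ` W))
        \<le> 2 ^ m * (m * R)"
  shows "measure P {S \<in> space P. \<exists>t\<in>Ts. b < (\<integral>z. loss t S z \<partial>M) - (\<Sum>i<m. loss t S (S i)) / m}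
    \<le> exp (s * R + s\<^sup>2 * r\<^sup>2 / (2 * m) - s * b)"
proof -
  interpret M: prob_space M by fact
  interpret P: prob_space P unfolding P_def by (intro prob_space_PiM M)
  interpret W: prob_space "double_space M m" by (intro prob_space_PiM M)
  note [measurable] = measurable_half
  define gap where "gap t S S' = (\<Sum>i<m. loss t S (S' i) - loss t S (S i)) / m" for t S S'
  define G where "G S S' = Max ((\<lambda>t. gap t S S') ` Ts)" for S S'
  have comp [measurable]: "(\<lambda>S. S i) \<in> P \<rightarrow>\<^sub>M M" if "i < m" for i
    using that unfolding P_def by simp
  have loss_meas: "(\<lambda>z. loss t S z) \<in> borel_measurable M" if "t \<in> Ts" "S \<in> space P" for t S
    using measurable_Pair2[OF meas[OF that(1)] that(2)] by simp
  have gap_meas: "(\<lambda>(S, S'). gap t S S') \<in> borel_measurable (P \<Otimes>\<^sub>M P)" if t: "t \<in> Ts" for t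
  proof -
    have "(\<lambda>p. loss t (fst p) (snd p i)) \<in> borel_measurable (P \<Otimes>\<^sub>M P)"
         "(\<lambda>p. loss t (fst p) (fst p i)) \<in> borel_measurable (P \<Otimes>\<^sub>M P)" if i: "i < m" for i
      using measurable_compose[OF measurable_Pair[OF measurable_fst measurable_compose[OF measurable_snd comp[OF i]]] meas[OF t]]
        measurable_compose[OF measurable_Pair[OF measurable_fst measurable_compose[OF measurable_fst comp[OF i]]] meas[OF t]]
      by simp_all
    thus ?thesis
      unfolding gap_def split_beta
      by (intro borel_measurable_divide borel_measurable_sum borel_measurable_diff) auto
  qed
  have G_meas: "(\<lambda>(S, S'). G S S') \<in> borel_measurable (P \<Otimes>\<^sub>M P)"
    unfolding G_def split_beta using gap_meas Ts(1)
    by (intro borel_measurable_Max) (auto simp: split_beta)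
  have loss_diff: "\<bar>loss t S z - loss t S z'\<bar> \<le> r"
    if "t \<in> Ts" "S \<in> space P" "z \<in> space M" "z' \<in> space M" for t S z z'
    using range[OF that(1,2,3)] range[OF that(1,2,4)] by auto
  have S_space: "S i \<in> space M" if "S \<in> space P" "i < m" for S i
    using measurable_space[OF comp[OF that(2)] that(1)] .
  have gap_bound: "\<bar>gap t S S'\<bar> \<le> r" if t: "t \<in> Ts" "S \<in> space P" "S' \<in> space P" for t S S'
  proof -
    have "\<bar>\<Sum>i<m. loss t S (S' i) - loss t S (S i)\<bar> \<le> (\<Sum>i<m. \<bar>loss t S (S' i) - loss t S (S i)\<bar>)"
      by (rule sum_abs)
    also have "\<dots> \<le> (\<Sum>i<m. r)"
      using t by (intro sum_mono loss_diff S_space) auto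
    finally show ?thesis using m by (simp add: gap_def field_simps)
  qed
  have G_bound: "\<bar>G S S'\<bar> \<le> r" if "S \<in> space P" "S' \<in> space P" for S S'
  proof -
    have "G S S' \<in> (\<lambda>t. gap t S S') ` Ts"
      unfolding G_def using Ts by (intro Max_in) auto
    thus ?thesis using gap_bound that by auto
  qed
  have expG_bound: "\<bar>exp (s * G S S')\<bar> \<le> exp (s * r)" if "S \<in> space P" "S' \<in> space P" for S S'
    using G_bound[OF that] s by (simp add: abs_le_iff)
  have expG_meas: "(\<lambda>(S, S'). exp (s * G S S')) \<in> borel_measurable (P \<Otimes>\<^sub>M P)"
    using G_meas by (simp add: split_beta)
  have expG_int: "integrable P (\<lambda>S'. exp (s * G S S'))" if "S \<in> space P" for S
    using measurable_Pair2[OF expG_meas that] expG_bound that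
    by (intro P.integrable_bounded[of _ "exp (s * r)"]) auto
  define A where "A = {S \<in> space P. \<exists>t\<in>Ts. b < (\<integral>z. loss t S z \<partial>M) - (\<Sum>i<m. loss t S (S i)) / m}"
  \<comment> \<open>On the bad event the gap to the population mean is the mean over the ghost
    sample of the gap between the two empirical averages. Jensen's inequality, in the form of the
    tangent to \<open>exp\<close> at the mean, moves the exponential inside.\<close>
  have ghost: "exp (s * b) \<le> (\<integral>S'. exp (s * G S S') \<partial>P)" if "S \<in> A" for S
  proof -
    from that obtain t where S: "S \<in> space P" and t: "t \<in> Ts"
      and b: "b < (\<integral>z. loss t S z \<partial>M) - (\<Sum>i<m. loss t S (S i)) / m"
      by (auto simp: A_def)
    have int: "integrable P (\<lambda>S'. loss t S (S' i))" if "i < m" for i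
      using range t S S_space that
      by (intro P.integrable_bounded[of _ r] measurable_compose[OF comp loss_meas]) (auto simp: abs_le_iff)
    have "(\<integral>z. loss t S z \<partial>M) - (\<Sum>i<m. loss t S (S i)) / m
        = (\<Sum>i<m. (\<integral>z. loss t S z \<partial>M) - loss t S (S i)) / m"
      using m by (simp add: sum_subtractf diff_divide_distrib)
    also have "(\<Sum>i<m. (\<integral>z. loss t S z \<partial>M) - loss t S (S i))
        = (\<Sum>i<m. (\<integral>S'. loss t S (S' i) \<partial>P) - loss t S (S i))"
      using loss_meas[OF t S] unfolding P_def
      by (intro sum.cong refl) (simp add: integral_component_PiM[OF M])
    also have "\<dots> = (\<integral>S'. (\<Sum>i<m. loss t S (S' i) - loss t S (S i)) \<partial>P)"
      using int by (simp add: P.prob_space)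
    also have "\<dots> / m = (\<integral>S'. gap t S S' \<partial>P)"
      by (simp add: gap_def)
    finally have eq: "(\<integral>z. loss t S z \<partial>M) - (\<Sum>i<m. loss t S (S i)) / m = (\<integral>S'. gap t S S' \<partial>P)" .
    have gint: "integrable P (\<lambda>S'. gap t S S')"
      using measurable_Pair2[OF gap_meas[OF t] S] gap_bound[OF t S]
      by (intro P.integrable_bounded[of _ r]) auto
    let ?\<mu> = "\<integral>S'. gap t S S' \<partial>P"
    have "exp (s * b) \<le> exp (s * ?\<mu>)"
      using b s by (simp add: eq)
    also have "\<dots> = (\<integral>S'. exp (s * ?\<mu>) * (1 + (s * gap t S S' - s * ?\<mu>)) \<partial>P)"
      using gint by (simp add: P.prob_space)
    also have "\<dots> \<le> (\<integral>S'. exp (s * G S S') \<partial>P)"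
    proof (intro integral_mono expG_int S)
      fix S' assume "S' \<in> space P"
      have "exp (s * ?\<mu>) * (1 + (s * gap t S S' - s * ?\<mu>)) \<le> exp (s * ?\<mu>) * exp (s * gap t S S' - s * ?\<mu>)"
        by (intro mult_left_mono exp_ge_add_one_self) auto
      also have "\<dots> = exp (s * gap t S S')"
        by (simp flip: exp_add)
      also have "\<dots> \<le> exp (s * G S S')"
        unfolding G_def using s t Ts by simp
      finally show "exp (s * ?\<mu>) * (1 + (s * gap t S S' - s * ?\<mu>)) \<le> exp (s * G S S')" .
    qed (use gint in simp)
    finally show ?thesis .
  qed
  let ?hF = "half m False" and ?hT = "half m True"
  have half_space: "half m c \<omega> \<in> space P" if "\<omega> \<in> space (double_space M m)" for c \<omega>
    using measurable_space[OF measurable_half that] unfolding P_def .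
  have swap_space: "swap_halves m J \<omega> \<in> space (double_space M m)" if "\<omega> \<in> space (double_space M m)" for J and \<omega> :: "nat \<times> bool \<Rightarrow> 'a"
    using measurable_space[OF measurable_swap_halves that] .
  have expGW_meas: "(\<lambda>\<omega>. exp (s * G (?hF \<omega>) (?hT \<omega>))) \<in> borel_measurable (double_space M m)"
    using measurable_compose[OF measurable_Pair[OF measurable_half measurable_half] expG_meas[unfolded P_def]] by simp
  have expGW_int: "integrable (double_space M m) (\<lambda>\<omega>. exp (s * G (?hF (swap_halves m J \<omega>)) (?hT (swap_halves m J \<omega>))))" for J
    using expG_bound half_space swap_space measurable_compose[OF measurable_swap_halves expGW_meas]
    by (intro W.integrable_bounded[of _ "exp (s * r)"]) auto
  have signs: "(\<Sum>J\<in>Pow {..<m}. exp (s * G (?hF (swap_halves m J \<omega>)) (?hT (swap_halves m J \<omega>))))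
      \<le> 2 ^ m * exp (s * R + s\<^sup>2 * r\<^sup>2 / (2 * m))" if \<omega>: "\<omega> \<in> space (double_space M m)" for \<omega>
  proof -
    \<comment> \<open>Training on a swapped sample depends on the signs. Collecting the training
      halves of all swaps gives a class that depends on \<omega> alone, so the signs
      \<open>J\<close> are free to vary over a fixed class.\<close>
    define W where "W = Ts \<times> (\<lambda>J. ?hF (swap_halves m J \<omega>)) ` Pow {..<m}"
    define z where "z b i = half m b \<omega> i" for b i
    have W: "finite W" "W \<noteq> {}" "W \<subseteq> {(t, S). t \<in> Ts \<and> S \<in> space P}"
      using Ts half_space[OF swap_space[OF \<omega>]] by (auto simp: W_def)
    have z: "z b i \<in> space M" if "i < m" for b i
      unfolding z_def using S_space half_space \<omega> that by blast
    define F where "F J = Max ((\<lambda>(t, S). \<Sum>i<m. rsign J i * (loss t S (z True i) - loss t S (z False i))) ` W)" for J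
    have F_ge: "(\<Sum>i<m. rsign J i * (loss t S (z True i) - loss t S (z False i))) \<le> F J" if "(t, S) \<in> W" for t S J
      unfolding F_def using W that by (intro Max_ge) force+
    have GF: "G (?hF (swap_halves m J \<omega>)) (?hT (swap_halves m J \<omega>)) \<le> F J / m" if J: "J \<in> Pow {..<m}" for J
      unfolding G_def
    proof (rule Max_image_le[OF Ts])
      fix t assume t: "t \<in> Ts"
      let ?S = "?hF (swap_halves m J \<omega>)"
      have "(\<Sum>i<m. loss t ?S (?hT (swap_halves m J \<omega>) i) - loss t ?S (?S i))
         = (\<Sum>i<m. rsign J i * (loss t ?S (z True i) - loss t ?S (z False i)))"
        by (intro sum.cong refl) (auto simp: rsign_def z_def half_swap_halves)
      also have "\<dots> \<le> F J"
        using t J by (intro F_ge) (auto simp: W_def)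
      finally show "gap t ?S (?hT (swap_halves m J \<omega>)) \<le> F J / m"
        unfolding gap_def by (simp add: divide_right_mono)
    qed
    \<comment> \<open>Flipping one sign changes every sum in the maximum by at most
      \<open>2 * r\<close>, which is the bounded difference needed for the exponential moment over
      the signs.\<close>
    have F_diff: "F J \<le> F J' + 2 * r"
      if i: "i < m" and JJ': "\<And>k. k \<noteq> i \<Longrightarrow> k \<in> J \<longleftrightarrow> k \<in> J'" for i J J'
      unfolding F_def[of J]
    proof (rule Max_image_le[OF W(1,2)])
      fix w assume w: "w \<in> W"
      obtain t S where [simp]: "w = (t, S)" by (cases w)
      have tS: "t \<in> Ts" "S \<in> space P" using w W(3) by auto
      define e where "e i = loss t S (z True i) - loss t S (z False i)" for i
      have e: "\<bar>e i\<bar> \<le> r" unfolding e_def using loss_diff tS z i by simp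
      have "(\<Sum>k<m. rsign J k * e k) = (\<Sum>k<m. rsign J' k * e k) + (rsign J i - rsign J' i) * e i"
      proof -
        have "(\<Sum>k<m. rsign J k * e k) - (\<Sum>k<m. rsign J' k * e k) = (\<Sum>k<m. (rsign J k - rsign J' k) * e k)"
          by (simp add: sum_subtractf left_diff_distrib)
        also have "\<dots> = (\<Sum>k<m. if k = i then (rsign J i - rsign J' i) * e i else 0)"
          using JJ' by (intro sum.cong refl) (auto simp: rsign_def)
        finally show ?thesis using i by simp
      qed
      also have "(rsign J i - rsign J' i) * e i \<le> 2 * r"
        using e by (auto simp: rsign_def abs_le_iff)
      also have "(\<Sum>k<m. rsign J' k * e k) \<le> F J'"
        unfolding e_def by (rule F_ge) (use w in simp)
      finally show "(case w of (t, S) \<Rightarrow> \<Sum>i<m. rsign J i * (loss t S (z True i) - loss t S (z False i))) \<le> F J' + 2 * r"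
        by (simp add: e_def)
    qed
    have "(\<Sum>J\<in>Pow {..<m}. exp (s * G (?hF (swap_halves m J \<omega>)) (?hT (swap_halves m J \<omega>))))
        \<le> (\<Sum>J\<in>Pow {..<m}. exp (s / m * F J))"
      using GF s by (intro sum_mono) (simp add: mult_left_mono times_divide_eq_right[symmetric] del: times_divide_eq_right)
    also have "\<dots> \<le> 2 ^ card {..<m} * exp ((\<Sum>J\<in>Pow {..<m}. s / m * F J) / 2 ^ card {..<m}
          + card {..<m} * (s / m * (2 * r))\<^sup>2 / 8)"
    proof (rule sum_Pow_exp_le)
      fix i J assume iJ: "i \<in> {..<m}" "J \<subseteq> {..<m}" "i \<notin> J"
      have "\<bar>F (insert i J) - F J\<bar> \<le> 2 * r"
        using F_diff[of i "insert i J" J] F_diff[of i J "insert i J"] iJ by auto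
      hence "s / m * \<bar>F (insert i J) - F J\<bar> \<le> s / m * (2 * r)"
        using s by (intro mult_left_mono) auto
      moreover have "\<bar>s / m\<bar> = s / m" using s by simp
      ultimately show "\<bar>s / m * F (insert i J) - s / m * F J\<bar> \<le> s / m * (2 * r)"
        unfolding right_diff_distrib[symmetric] abs_mult by (simp only:)
    qed simp
    also have "\<dots> \<le> 2 ^ m * exp (s * R + s\<^sup>2 * r\<^sup>2 / (2 * m))"
    proof -
      have "(\<Sum>J\<in>Pow {..<m}. F J) \<le> 2 ^ m * (m * R)"
        unfolding F_def using W z by (intro rademacher) auto
      hence "s / m * (\<Sum>J\<in>Pow {..<m}. F J) \<le> s / m * (2 ^ m * (m * R))"
        using s by (intro mult_left_mono) auto
      hence "(\<Sum>J\<in>Pow {..<m}. s / m * F J) / 2 ^ m \<le> s * R"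
        unfolding sum_distrib_left[symmetric] using m by (simp add: divide_le_eq mult_ac)
      moreover have "real m * (s / m * (2 * r))\<^sup>2 / 8 = s\<^sup>2 * r\<^sup>2 / (2 * m)"
        using m by (simp add: power2_eq_square)
      ultimately show ?thesis by (simp only: card_lessThan exp_le_cancel_iff mult_le_cancel_left_pos
            zero_less_power zero_less_numeral add_mono)
    qed
    finally show ?thesis .
  qed
  have "2 ^ m * (\<integral>S. (\<integral>S'. exp (s * G S S') \<partial>P) \<partial>P)
      = (\<Sum>J\<in>Pow {..<m}. \<integral>\<omega>. exp (s * G (?hF \<omega>) (?hT \<omega>)) \<partial>double_space M m)"
    using integral_double_space[OF M expG_meas[unfolded P_def] expG_bound[unfolded P_def]]
    by (simp add: P_def card_Pow)
  \<comment> \<open>All \<open>2 ^ m\<close> integrals are equal because each swap preserves the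
    law. Exchanging sum and integral then leaves a bound on the sign average for each fixed
    \<omega>.\<close>
  also have "\<dots> = (\<Sum>J\<in>Pow {..<m}. \<integral>\<omega>. exp (s * G (?hF (swap_halves m J \<omega>)) (?hT (swap_halves m J \<omega>))) \<partial>double_space M m)"
  proof (intro sum.cong refl)
    fix J
    have "(\<integral>\<omega>. exp (s * G (?hF \<omega>) (?hT \<omega>)) \<partial>double_space M m)
      = (\<integral>\<omega>. exp (s * G (?hF \<omega>) (?hT \<omega>)) \<partial>distr (double_space M m) (double_space M m) (swap_halves m J))"
      by (simp only: distr_swap_halves[OF M])
    also have "\<dots> = (\<integral>\<omega>. exp (s * G (?hF (swap_halves m J \<omega>)) (?hT (swap_halves m J \<omega>))) \<partial>double_space M m)"
      by (intro integral_distr measurable_swap_halves expGW_meas)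
    finally show "(\<integral>\<omega>. exp (s * G (?hF \<omega>) (?hT \<omega>)) \<partial>double_space M m)
      = (\<integral>\<omega>. exp (s * G (?hF (swap_halves m J \<omega>)) (?hT (swap_halves m J \<omega>))) \<partial>double_space M m)" .
  qed
  also have "\<dots> = (\<integral>\<omega>. (\<Sum>J\<in>Pow {..<m}. exp (s * G (?hF (swap_halves m J \<omega>)) (?hT (swap_halves m J \<omega>)))) \<partial>double_space M m)"
    by (intro Bochner_Integration.integral_sum[symmetric] expGW_int)
  also have "\<dots> \<le> (\<integral>\<omega>. 2 ^ m * exp (s * R + s\<^sup>2 * r\<^sup>2 / (2 * m)) \<partial>double_space M m)"
    by (intro integral_mono signs Bochner_Integration.integrable_sum expGW_int) auto
  also have "\<dots> = 2 ^ m * exp (s * R + s\<^sup>2 * r\<^sup>2 / (2 * m))"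
    by (simp add: W.prob_space)
  finally have mgf: "(\<integral>S. (\<integral>S'. exp (s * G S S') \<partial>P) \<partial>P) \<le> exp (s * R + s\<^sup>2 * r\<^sup>2 / (2 * m))"
    by simp
  have inner_int: "integrable P (\<lambda>S. \<integral>S'. exp (s * G S S') \<partial>P)"
  proof (rule P.integrable_bounded[of _ "exp (s * r)"])
    show "(\<lambda>S. \<integral>S'. exp (s * G S S') \<partial>P) \<in> borel_measurable P"
      by (intro P.borel_measurable_lebesgue_integral expG_meas)
    fix S assume S: "S \<in> space P"
    have "(\<integral>S'. exp (s * G S S') \<partial>P) \<le> (\<integral>S'. exp (s * r) \<partial>P)"
      using expG_bound[OF S] by (intro integral_mono expG_int S) auto
    moreover have "0 \<le> (\<integral>S'. exp (s * G S S') \<partial>P)"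
      by (intro Bochner_Integration.integral_nonneg) auto
    ultimately show "\<bar>\<integral>S'. exp (s * G S S') \<partial>P\<bar> \<le> exp (s * r)"
      by (simp add: P.prob_space)
  qed
  have "P.prob A \<le> P.prob {S \<in> space P. exp (s * b) \<le> (\<integral>S'. exp (s * G S S') \<partial>P)}"
    using ghost borel_measurable_integrable[OF inner_int]
    by (intro P.finite_measure_mono) (auto simp: A_def)
  also have "\<dots> \<le> (\<integral>S. (\<integral>S'. exp (s * G S S') \<partial>P) \<partial>P) / exp (s * b)"
    by (intro integral_Markov_inequality_measure[where A = "{}"] inner_int) (auto intro!: Bochner_Integration.integral_nonneg)
  also have "\<dots> \<le> exp (s * R + s\<^sup>2 * r\<^sup>2 / (2 * m)) / exp (s * b)"
    by (intro divide_right_mono mgf) auto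
  finally show ?thesis
    by (simp add: A_def exp_diff)
qed

section \<open>Reproducing kernel Hilbert spaces\<close>

definition lincomb :: "'i set \<Rightarrow> ('i \<Rightarrow> real) \<Rightarrow> ('i \<Rightarrow> 'a \<Rightarrow> real) \<Rightarrow> 'a \<Rightarrow> real" where
  "lincomb I a p = (\<lambda>z. \<Sum>i\<in>I. a i * p i z)"

text \<open>Distinct signs are uncorrelated: the terms for \<open>J\<close> and
  \<open>insert i J\<close> cancel.\<close>

lemma sum_rsign_mult:
  assumes "finite I" "i \<in> I" "j \<in> I" "i \<noteq> j"
  shows "(\<Sum>J\<in>Pow I. rsign J i * rsign J j) = 0"
proof -
  have "(\<Sum>J\<in>Pow (insert i (I - {i})). rsign J i * rsign J j) = 0"
    using assms by (subst sum_Pow_insert) (auto simp: rsign_def intro!: sum.neutral)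
  thus ?thesis using assms by (simp add: insert_absorb)
qed

context rkhs
begin

lemma diff_mem: "f \<in> H \<Longrightarrow> g \<in> H \<Longrightarrow> (\<lambda>z. f z - g z) \<in> H"
  using add_mem[of f "\<lambda>z. - 1 * g z"] scale_mem[of g "-1"] by simp

lemma lincomb_mem:
  assumes "finite I" "\<And>i. i \<in> I \<Longrightarrow> p i \<in> H"
  shows "lincomb I a p \<in> H"
  using assms
  by (induction I rule: finite_induct) (auto simp: lincomb_def zero_mem intro!: add_mem scale_mem)

lemma ip_zero: "f \<in> H \<Longrightarrow> ip (\<lambda>_. 0) f = 0"
  using ip_scale[of f f 0] by simp

lemma ip_diff:
  assumes "f \<in> H" "g \<in> H" "k \<in> H"
  shows "ip (\<lambda>z. f z - g z) k = ip f k - ip g k"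
  using ip_add[of f "\<lambda>z. - 1 * g z" k] ip_scale[of g k "-1"] scale_mem[of g "-1"] assms by simp

lemma ip_add_right: "f \<in> H \<Longrightarrow> g \<in> H \<Longrightarrow> k \<in> H \<Longrightarrow> ip k (\<lambda>z. f z + g z) = ip k f + ip k g"
  using ip_add[of f g k] by (simp add: ip_sym[of k] add_mem)

lemma ip_diff_right: "f \<in> H \<Longrightarrow> g \<in> H \<Longrightarrow> k \<in> H \<Longrightarrow> ip k (\<lambda>z. f z - g z) = ip k f - ip k g"
  using ip_diff[of f g k] by (simp add: ip_sym[of k] diff_mem)

lemma ip_scale_right: "f \<in> H \<Longrightarrow> g \<in> H \<Longrightarrow> ip g (\<lambda>z. c * f z) = c * ip g f"
  using ip_scale[of f g c] by (simp add: ip_sym[of g] scale_mem)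

lemma ip_lincomb:
  assumes "finite I" "\<And>i. i \<in> I \<Longrightarrow> p i \<in> H" "k \<in> H"
  shows "ip (lincomb I a p) k = (\<Sum>i\<in>I. a i * ip (p i) k)"
  using assms
proof (induction I rule: finite_induct)
  case (insert i I)
  have "lincomb (insert i I) a p = (\<lambda>z. a i * p i z + lincomb I a p z)"
    using insert.hyps by (simp add: lincomb_def)
  moreover have "lincomb I a p \<in> H"
    using insert by (intro lincomb_mem) auto
  ultimately show ?case
    using insert by (simp add: ip_add ip_scale scale_mem)
qed (simp add: lincomb_def ip_zero)

lemma ip_lincomb_right:
  assumes "finite I" "\<And>i. i \<in> I \<Longrightarrow> p i \<in> H" "k \<in> H"
  shows "ip k (lincomb I a p) = (\<Sum>i\<in>I. a i * ip k (p i))"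
  using ip_lincomb[OF assms] assms by (simp add: ip_sym[of k] lincomb_mem)

lemma ip_lincomb_lincomb:
  assumes "finite I" "\<And>i. i \<in> I \<Longrightarrow> p i \<in> H"
  shows "ip (lincomb I a p) (lincomb I a p) = (\<Sum>i\<in>I. \<Sum>j\<in>I. a i * a j * ip (p i) (p j))"
proof -
  have "ip (lincomb I a p) (lincomb I a p) = (\<Sum>i\<in>I. a i * ip (p i) (lincomb I a p))"
    using assms by (intro ip_lincomb lincomb_mem) auto
  also have "\<dots> = (\<Sum>i\<in>I. \<Sum>j\<in>I. a i * a j * ip (p i) (p j))"
    using assms by (intro sum.cong refl) (simp add: ip_lincomb_right sum_distrib_left mult.assoc)
  finally show ?thesis .
qed

lemma hnorm_nonneg: "f \<in> H \<Longrightarrow> 0 \<le> hnorm ip f"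
  by (simp add: hnorm_def ip_nonneg)

lemma hnorm_power2: "f \<in> H \<Longrightarrow> (hnorm ip f)\<^sup>2 = ip f f"
  by (simp add: hnorm_def ip_nonneg)

lemma cauchy_schwarz:
  assumes f: "f \<in> H" and g: "g \<in> H"
  shows "\<bar>ip f g\<bar> \<le> hnorm ip f * hnorm ip g"
proof (cases "ip g g = 0")
  case True
  hence "g = (\<lambda>_. 0)" using g by (rule ip_definite[rotated])
  thus ?thesis using f g ip_zero[of f] ip_zero[OF zero_mem] ip_sym[OF f g] by (simp add: hnorm_def)
next
  case False
  hence pos: "0 < ip g g" using ip_nonneg[OF g] by simp
  define c where "c = ip f g / ip g g"
  have mem: "(\<lambda>z. f z - c * g z) \<in> H" by (intro diff_mem scale_mem f g)
  have "0 \<le> ip (\<lambda>z. f z - c * g z) (\<lambda>z. f z - c * g z)" by (rule ip_nonneg[OF mem])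
  also have "\<dots> = ip f f - 2 * c * ip f g + c * c * ip g g"
    using f g mem scale_mem[OF g, of c] ip_sym[OF f g]
    by (simp add: ip_diff ip_diff_right ip_scale ip_scale_right algebra_simps)
  also have "\<dots> = ip f f - (ip f g)\<^sup>2 / ip g g"
    using pos by (simp add: c_def power2_eq_square)
  finally have "(ip f g)\<^sup>2 \<le> ip f f * ip g g"
    using pos by (simp add: field_simps)
  hence "sqrt ((ip f g)\<^sup>2) \<le> sqrt (ip f f * ip g g)"
    by (rule real_sqrt_le_mono)
  thus ?thesis by (simp add: hnorm_def real_sqrt_mult)
qed

lemma ip_le_1:
  assumes "f \<in> H" "g \<in> H" "hnorm ip f \<le> 1" "hnorm ip g \<le> 1"
  shows "\<bar>ip f g\<bar> \<le> 1"
  using cauchy_schwarz[OF assms(1,2)] mult_le_one[of "hnorm ip f" "hnorm ip g"] assms hnorm_nonneg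
  by fastforce

lemma hnorm_add_le:
  assumes f: "f \<in> H" and g: "g \<in> H"
  shows "hnorm ip (\<lambda>z. f z + g z) \<le> hnorm ip f + hnorm ip g"
proof (rule power2_le_imp_le)
  have "(hnorm ip (\<lambda>z. f z + g z))\<^sup>2 = ip f f + 2 * ip f g + ip g g"
    using f g add_mem[OF f g] ip_sym[OF f g]
    by (simp add: hnorm_power2 ip_add ip_add_right)
  also have "\<dots> \<le> (hnorm ip f)\<^sup>2 + 2 * (hnorm ip f * hnorm ip g) + (hnorm ip g)\<^sup>2"
    using cauchy_schwarz[OF f g] f g by (simp add: hnorm_power2 abs_le_iff)
  also have "\<dots> = (hnorm ip f + hnorm ip g)\<^sup>2"
    by (simp add: power2_sum)
  finally show "(hnorm ip (\<lambda>z. f z + g z))\<^sup>2 \<le> (hnorm ip f + hnorm ip g)\<^sup>2" .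
qed (use hnorm_nonneg f g in simp)

lemma hnorm_scale: "f \<in> H \<Longrightarrow> hnorm ip (\<lambda>z. c * f z) = \<bar>c\<bar> * hnorm ip f"
  by (simp add: hnorm_def ip_scale ip_scale_right scale_mem real_sqrt_mult)

lemma hnorm_diff_le:
  assumes f: "f \<in> H" and g: "g \<in> H"
  shows "\<bar>hnorm ip f - hnorm ip g\<bar> \<le> hnorm ip (\<lambda>z. f z - g z)"
proof -
  have "hnorm ip f \<le> hnorm ip (\<lambda>z. f z - g z) + hnorm ip g"
    using hnorm_add_le[OF diff_mem[OF f g] g] by simp
  moreover have "hnorm ip g \<le> hnorm ip (\<lambda>z. g z - f z) + hnorm ip f"
    using hnorm_add_le[OF diff_mem[OF g f] f] by simp
  moreover have "hnorm ip (\<lambda>z. g z - f z) = hnorm ip (\<lambda>z. f z - g z)"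
    using hnorm_scale[OF diff_mem[OF f g], of "-1"] by simp
  ultimately show ?thesis by linarith
qed

text \<open>Convexity of the squared norm, applied to an average of the vectors
  \<open>a i * p i\<close> of norm at most \<open>\<bar>a i\<bar>\<close>. It bounds the squared
  norm of the update direction by the empirical squared error.\<close>

lemma ip_lincomb_le:
  fixes p :: "nat \<Rightarrow> 'a \<Rightarrow> real"
  assumes p: "\<And>i. i < m \<Longrightarrow> p i \<in> H \<and> hnorm ip (p i) \<le> 1" and m: "0 < m"
  shows "ip (lincomb {..<m} (\<lambda>i. a i / m) p) (lincomb {..<m} (\<lambda>i. a i / m) p) \<le> (\<Sum>i<m. (a i)\<^sup>2) / m"
proof -
  have "ip (lincomb {..<m} (\<lambda>i. a i / m) p) (lincomb {..<m} (\<lambda>i. a i / m) p)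
      = (\<Sum>i<m. \<Sum>j<m. (a i / m) * (a j / m) * ip (p i) (p j))"
    using p by (intro ip_lincomb_lincomb) auto
  also have "\<dots> \<le> (\<Sum>i<m. \<Sum>j<m. \<bar>a i / m\<bar> * \<bar>a j / m\<bar>)"
  proof (intro sum_mono)
    fix i j assume "i \<in> {..<m}" "j \<in> {..<m}"
    hence "\<bar>ip (p i) (p j)\<bar> \<le> 1" using p by (intro ip_le_1) auto
    hence "\<bar>a i / m * (a j / m)\<bar> * \<bar>ip (p i) (p j)\<bar> \<le> \<bar>a i / m * (a j / m)\<bar> * 1"
      by (intro mult_left_mono) auto
    thus "(a i / m) * (a j / m) * ip (p i) (p j) \<le> \<bar>a i / m\<bar> * \<bar>a j / m\<bar>"
      using abs_ge_self[of "(a i / m) * (a j / m) * ip (p i) (p j)"] by (simp add: abs_mult)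
  qed
  also have "\<dots> = (\<Sum>i<m. \<bar>a i / m\<bar>)\<^sup>2"
    by (simp add: power2_eq_square sum_product)
  also have "\<dots> \<le> (\<Sum>i<m. \<bar>a i / m\<bar>\<^sup>2) * card {..<m}"
    by (rule sum_squared_le_sum_of_squares)
  also have "\<dots> = (\<Sum>i<m. (a i)\<^sup>2) / m"
    using m by (simp add: power_divide sum_divide_distrib[symmetric] power2_eq_square)
  finally show ?thesis .
qed

section \<open>Rademacher averages over a ball of the Hilbert space\<close>

text \<open>By Cauchy-Schwarz the maximum is at most \<open>B\<close> times the norm of the signed
  sum of the \<open>p i\<close>. Uncorrelated signs make the mean square of that norm equal to the
  sum of the squared norms, hence at most \<open>m\<close>, and the mean is at most the root of the
  mean square.\<close>

lemma rademacher_ball: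
  fixes p :: "nat \<Rightarrow> 'a \<Rightarrow> real" and B :: real
  assumes W: "finite W" "W \<noteq> {}" and d: "\<And>w. w \<in> W \<Longrightarrow> d w \<in> H \<and> hnorm ip (d w) \<le> B" and B: "0 \<le> B"
    and p: "\<And>i. i < m \<Longrightarrow> p i \<in> H \<and> hnorm ip (p i) \<le> 1"
  shows "(\<Sum>J\<in>Pow {..<m}. Max ((\<lambda>w. \<Sum>i<m. rsign J i * ip (d w) (p i)) ` W)) \<le> 2 ^ m * (B * sqrt m)"
proof -
  define N where "N J = hnorm ip (lincomb {..<m} (rsign J) p)" for J
  have mem: "lincomb {..<m} (rsign J) p \<in> H" for J using p by (intro lincomb_mem) auto
  have "(\<Sum>J\<in>Pow {..<m}. (N J)\<^sup>2)
      = (\<Sum>J\<in>Pow {..<m}. \<Sum>i<m. \<Sum>j<m. rsign J i * rsign J j * ip (p i) (p j))"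
    unfolding N_def hnorm_power2[OF mem] using p by (intro sum.cong refl ip_lincomb_lincomb) auto
  also have "\<dots> = (\<Sum>i<m. \<Sum>J\<in>Pow {..<m}. \<Sum>j<m. rsign J i * rsign J j * ip (p i) (p j))"
    by (rule sum.swap)
  also have "\<dots> = (\<Sum>i<m. \<Sum>j<m. \<Sum>J\<in>Pow {..<m}. rsign J i * rsign J j * ip (p i) (p j))"
    by (rule sum.cong[OF refl], rule sum.swap)
  also have "\<dots> = (\<Sum>i<m. \<Sum>j<m. if j = i then 2 ^ m * ip (p i) (p i) else 0)"
  proof (intro sum.cong refl)
    fix i j assume ij: "i \<in> {..<m}" "j \<in> {..<m}"
    have "(\<Sum>J\<in>Pow {..<m}. rsign J i * rsign J j) = (if j = i then 2 ^ m else 0)"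
    proof (cases "j = i")
      case True
      have "rsign J i * rsign J i = 1" for J by (simp add: rsign_def)
      thus ?thesis using True by (simp add: card_Pow)
    qed (use ij in \<open>simp add: sum_rsign_mult\<close>)
    thus "(\<Sum>J\<in>Pow {..<m}. rsign J i * rsign J j * ip (p i) (p j))
      = (if j = i then 2 ^ m * ip (p i) (p i) else 0)"
      unfolding sum_distrib_right[symmetric] by simp
  qed
  also have "\<dots> = (\<Sum>i<m. 2 ^ m * ip (p i) (p i))"
    by simp
  also have "\<dots> \<le> (\<Sum>i<m. 2 ^ m * 1)"
  proof (intro sum_mono mult_left_mono)
    fix i assume "i \<in> {..<m}"
    thus "ip (p i) (p i) \<le> 1" using p ip_le_1[of "p i" "p i"] by simp
  qed simp
  finally have sq: "(\<Sum>J\<in>Pow {..<m}. (N J)\<^sup>2) \<le> real m * 2 ^ m" by simp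
  have "(\<Sum>J\<in>Pow {..<m}. N J)\<^sup>2 \<le> (\<Sum>J\<in>Pow {..<m}. (N J)\<^sup>2) * card (Pow {..<m})"
    by (rule sum_squared_le_sum_of_squares)
  also have "\<dots> \<le> real m * 2 ^ m * card (Pow {..<m})"
    by (intro mult_right_mono sq) simp
  also have "\<dots> = (2 ^ m * sqrt m)\<^sup>2"
    by (simp add: card_Pow power_mult_distrib power2_eq_square)
  finally have N: "(\<Sum>J\<in>Pow {..<m}. N J) \<le> 2 ^ m * sqrt m"
    by (rule power2_le_imp_le) simp
  have "(\<Sum>J\<in>Pow {..<m}. Max ((\<lambda>w. \<Sum>i<m. rsign J i * ip (d w) (p i)) ` W)) \<le> (\<Sum>J\<in>Pow {..<m}. B * N J)"
  proof (intro sum_mono Max_image_le W)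
    fix J w assume w: "w \<in> W"
    have "(\<Sum>i<m. rsign J i * ip (d w) (p i)) = ip (d w) (lincomb {..<m} (rsign J) p)"
      using p d w by (intro ip_lincomb_right[symmetric]) auto
    also have "\<dots> \<le> hnorm ip (d w) * N J"
      using cauchy_schwarz[of "d w", OF _ mem[of J]] d w unfolding N_def by (auto simp: abs_le_iff)
    also have "\<dots> \<le> B * N J"
      using d w hnorm_nonneg[OF mem] unfolding N_def by (intro mult_right_mono) auto
    finally show "(\<Sum>i<m. rsign J i * ip (d w) (p i)) \<le> B * N J" .
  qed
  also have "\<dots> \<le> B * (2 ^ m * sqrt m)"
    unfolding sum_distrib_left[symmetric] by (intro mult_left_mono N B)
  finally show ?thesis by (simp add: mult_ac)
qed

text \<open>Since the square of a difference in the unit interval is 2-Lipschitz and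
  \<open>u\<close> is \<open>L\<close>-Lipschitz, the loss is \<open>2 * L\<close>-Lipschitz in
  \<open>ip (d w) q\<close>, and contraction reduces it to a linear class. The constant 4 is 2 for
  the sample plus 2 for the ghost sample.\<close>

lemma rademacher_squared_loss:
  fixes p p' :: "nat \<Rightarrow> 'a \<Rightarrow> real" and B L :: real
  assumes W: "finite W" "W \<noteq> {}" and d: "\<And>w. w \<in> W \<Longrightarrow> d w \<in> H \<and> hnorm ip (d w) \<le> B" and B: "0 \<le> B"
    and p: "\<And>i. i < m \<Longrightarrow> p i \<in> H \<and> hnorm ip (p i) \<le> 1"
    and p': "\<And>i. i < m \<Longrightarrow> p' i \<in> H \<and> hnorm ip (p' i) \<le> 1"
    and u: "\<And>s. u s \<in> {0..1::real}" "L-lipschitz_on UNIV u" and L: "0 < L"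
    and loss: "\<And>w q. w \<in> W \<Longrightarrow> q \<in> H \<Longrightarrow> loss w q = (u (ip v q + ip (d w) q) - u (ip v q))\<^sup>2"
  shows "(\<Sum>J\<in>Pow {..<m}. Max ((\<lambda>w. \<Sum>i<m. rsign J i * (loss w (p' i) - loss w (p i))) ` W))
    \<le> 2 ^ m * (4 * L * B * sqrt m)"
proof -
  \<comment> \<open>The Lipschitz constant is moved into the vectors, because the contraction lemma
    compares increments with constant 1.\<close>
  define d' where "d' w = (\<lambda>z. 2 * L * d w z)" for w
  have d': "d' w \<in> H \<and> hnorm ip (d' w) \<le> 2 * L * B" if "w \<in> W" for w
    unfolding d'_def using d[OF that] L scale_mem[of "d w"] by (simp add: hnorm_scale)
  have lip: "\<bar>loss w q - loss w' q\<bar> \<le> \<bar>ip (d' w) q - ip (d' w') q\<bar>"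
    if "w \<in> W" "w' \<in> W" "q \<in> H" for w w' q
  proof -
    define c a b where "c = u (ip v q)" "a = u (ip v q + ip (d w) q)" "b = u (ip v q + ip (d w') q)"
    have r: "c \<in> {0..1}" "a \<in> {0..1}" "b \<in> {0..1}" unfolding c_a_b_def by (rule u(1))+
    have "(a - c)\<^sup>2 - (b - c)\<^sup>2 = (a + b - 2 * c) * (a - b)"
      by (simp add: power2_eq_square algebra_simps)
    hence "\<bar>(a - c)\<^sup>2 - (b - c)\<^sup>2\<bar> = \<bar>a + b - 2 * c\<bar> * \<bar>a - b\<bar>"
      by (simp only: abs_mult)
    also have "\<dots> \<le> 2 * \<bar>a - b\<bar>"
      using r by (intro mult_right_mono) (auto simp: abs_le_iff)
    also have "\<bar>a - b\<bar> \<le> L * \<bar>ip (d w) q - ip (d w') q\<bar>"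
      using lipschitz_onD[OF u(2), of "ip v q + ip (d w) q" "ip v q + ip (d w') q"]
      unfolding c_a_b_def by (simp add: dist_real_def)
    finally have "\<bar>loss w q - loss w' q\<bar> \<le> 2 * L * \<bar>ip (d w) q - ip (d w') q\<bar>"
      using that by (simp add: loss c_a_b_def)
    also have "\<dots> = \<bar>2 * L * (ip (d w) q - ip (d w') q)\<bar>"
      using L by (simp add: abs_mult)
    also have "\<dots> = \<bar>ip (d' w) q - ip (d' w') q\<bar>"
      using that d by (simp add: d'_def ip_scale right_diff_distrib)
    finally show ?thesis .
  qed
  \<comment> \<open>Contraction sees only the absolute increments of \<open>f\<close>, so one
    statement serves both the loss and its negative.\<close>
  have half: "(\<Sum>J\<in>Pow {..<m}. Max ((\<lambda>w. \<Sum>i<m. rsign J i * f i w) ` W)) \<le> 2 ^ m * (2 * L * B * sqrt m)"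
    if q: "\<And>i. i < m \<Longrightarrow> q i \<in> H \<and> hnorm ip (q i) \<le> 1"
      and f: "\<And>i w w'. i < m \<Longrightarrow> w \<in> W \<Longrightarrow> w' \<in> W \<Longrightarrow> \<bar>f i w - f i w'\<bar> = \<bar>loss w (q i) - loss w' (q i)\<bar>"
    for q f
  proof -
    have "(\<Sum>J\<in>Pow {..<m}. Max ((\<lambda>w. 0 + (\<Sum>i<m. rsign J i * f i w)) ` W))
        \<le> (\<Sum>J\<in>Pow {..<m}. Max ((\<lambda>w. 0 + (\<Sum>i<m. rsign J i * ip (d' w) (q i))) ` W))"
      using f lip q by (intro rademacher_contraction W) auto
    also have "\<dots> \<le> 2 ^ m * (2 * L * B * sqrt m)"
      using rademacher_ball[OF W d' _ q] B L by simp
    finally show ?thesis by simp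
  qed
  have "(\<Sum>J\<in>Pow {..<m}. Max ((\<lambda>w. \<Sum>i<m. rsign J i * (loss w (p' i) - loss w (p i))) ` W))
      \<le> (\<Sum>J\<in>Pow {..<m}. Max ((\<lambda>w. \<Sum>i<m. rsign J i * loss w (p' i)) ` W)
            + Max ((\<lambda>w. \<Sum>i<m. rsign J i * - loss w (p i)) ` W))"
  proof (intro sum_mono Max_image_le W)
    fix J w assume "w \<in> W"
    have "(\<Sum>i<m. rsign J i * (loss w (p' i) - loss w (p i)))
        = (\<Sum>i<m. rsign J i * loss w (p' i)) + (\<Sum>i<m. rsign J i * - loss w (p i))"
      unfolding sum.distrib[symmetric] by (intro sum.cong refl) (simp add: algebra_simps)
    also have "\<dots> \<le> Max ((\<lambda>w. \<Sum>i<m. rsign J i * loss w (p' i)) ` W)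
            + Max ((\<lambda>w. \<Sum>i<m. rsign J i * - loss w (p i)) ` W)"
      using W \<open>w \<in> W\<close> by (intro add_mono Max_ge) auto
    finally show "(\<Sum>i<m. rsign J i * (loss w (p' i) - loss w (p i)))
      \<le> Max ((\<lambda>w. \<Sum>i<m. rsign J i * loss w (p' i)) ` W)
            + Max ((\<lambda>w. \<Sum>i<m. rsign J i * - loss w (p i)) ` W)" .
  qed
  also have "\<dots> \<le> 2 ^ m * (2 * L * B * sqrt m) + 2 ^ m * (2 * L * B * sqrt m)"
    unfolding sum.distrib by (intro add_mono half[of p'] half[of p] p p') auto
  finally show ?thesis by (simp add: mult_ac)
qed

section \<open>One step of descent towards \<open>v\<close>\<close>

text \<open>The squared distance is expanded along the step \<open>G / L\<close>, where
  \<open>G\<close> splits into the part \<open>G1\<close> of the prediction error and the noise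
  \<open>N\<close>. Monotonicity and the Lipschitz property of \<open>u\<close> give
  \<open>ip d G1 \<le> - e / L + \<rho>\<close>, so the linear term gains
  \<open>2 * e / L\<^sup>2\<close>, which pays for the quadratic term.\<close>

lemma descent_step:
  fixes p :: "nat \<Rightarrow> 'a \<Rightarrow> real" and L \<eta> :: real and w :: "'a \<Rightarrow> real" and y \<zeta> g h :: "nat \<Rightarrow> real" and m :: nat
  defines "w' \<equiv> (\<lambda>z. w z + (1 / L) * lincomb {..<m} (\<lambda>i. (y i - h i) / m) p z)"
  assumes v: "v \<in> H" and w: "w \<in> H" and m: "0 < m"
    and p: "\<And>i. i < m \<Longrightarrow> p i \<in> H \<and> hnorm ip (p i) \<le> 1"
    and L: "0 < L" and u: "\<And>s. u s \<in> {0..1::real}" "mono u" "L-lipschitz_on UNIV u"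
    and target: "\<And>i. g i = u (ip v (p i) + \<zeta> i)"
    and hyp: "\<And>i. h i = u (ip w (p i))"
    and noise: "hnorm ip (lincomb {..<m} (\<lambda>i. (y i - g i) / m) p) \<le> \<eta>"
  shows "(hnorm ip (\<lambda>z. w' z - v z))\<^sup>2 \<le> (hnorm ip (\<lambda>z. w z - v z))\<^sup>2
    - ((\<Sum>i<m. (g i - h i)\<^sup>2) / m / 2 - 3 * \<eta>\<^sup>2 - 2 * L * ((\<Sum>i<m. \<bar>\<zeta> i\<bar>) / m)
        - 2 * L * \<eta> * hnorm ip (\<lambda>z. w z - v z)) / L\<^sup>2"
proof -
  define d where "d = (\<lambda>z. w z - v z)"
  define G where "G = lincomb {..<m} (\<lambda>i. (y i - h i) / m) p"
  define G1 where "G1 = lincomb {..<m} (\<lambda>i. (g i - h i) / m) p"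
  define N where "N = lincomb {..<m} (\<lambda>i. (y i - g i) / m) p"
  define e where "e = (\<Sum>i<m. (g i - h i)\<^sup>2) / m"
  define \<rho> where "\<rho> = (\<Sum>i<m. \<bar>\<zeta> i\<bar>) / m"
  have pH: "p i \<in> H" if "i \<in> {..<m}" for i using p that by simp
  have mem: "d \<in> H" "G \<in> H" "G1 \<in> H" "N \<in> H"
    unfolding d_def G_def G1_def N_def by (intro diff_mem lincomb_mem v w pH finite_lessThan; assumption)+
  have \<eta>: "0 \<le> \<eta>" using noise hnorm_nonneg[OF mem(4)] unfolding N_def by linarith
  have G: "G = (\<lambda>z. G1 z + N z)"
    unfolding G_def G1_def N_def lincomb_def sum.distrib[symmetric]
    by (intro ext sum.cong refl) (simp add: algebra_simps diff_divide_distrib)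
  have GG: "ip G G \<le> 3 / 2 * e + 3 * \<eta>\<^sup>2"
  proof -
    \<comment> \<open>The weight 2 puts only \<open>3 / 2 * e\<close> into the bound on
      \<open>ip G G\<close>. With the gain of \<open>2 * e\<close> from the linear term, a decrease
      of \<open>e / 2\<close> remains.\<close>
    have "0 \<le> ip (\<lambda>z. G1 z - 2 * N z) (\<lambda>z. G1 z - 2 * N z)"
      by (intro ip_nonneg diff_mem scale_mem mem)
    also have "\<dots> = ip G1 G1 - 4 * ip G1 N + 4 * ip N N"
      using mem scale_mem[OF mem(4), of 2] diff_mem[OF mem(3) scale_mem[OF mem(4), of 2]] ip_sym[OF mem(3,4)]
      by (simp add: ip_diff ip_diff_right ip_scale ip_scale_right)
    finally have cross: "4 * ip G1 N \<le> ip G1 G1 + 4 * ip N N" by simp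
    have "ip G G = ip G1 G1 + 2 * ip G1 N + ip N N"
      unfolding G using mem add_mem[OF mem(3,4)] ip_sym[OF mem(3,4)] by (simp add: ip_add ip_add_right)
    also have "\<dots> \<le> 3 / 2 * ip G1 G1 + 3 * ip N N" using cross by simp
    also have "\<dots> \<le> 3 / 2 * e + 3 * \<eta>\<^sup>2"
    proof (intro add_mono mult_left_mono)
      show "ip G1 G1 \<le> e" unfolding G1_def e_def using p by (intro ip_lincomb_le m) auto
      have "ip N N = (hnorm ip N)\<^sup>2" using mem by (simp add: hnorm_power2)
      also have "\<dots> \<le> \<eta>\<^sup>2" using noise hnorm_nonneg[OF mem(4)] unfolding N_def by (intro power_mono) auto
      finally show "ip N N \<le> \<eta>\<^sup>2" .
    qed auto
    finally show ?thesis .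
  qed
  have pointwise: "(g i - h i) * ip d (p i) \<le> - ((g i - h i)\<^sup>2 / L) + \<bar>\<zeta> i\<bar>" if "i < m" for i
  proof -
    define a b where "a = ip v (p i) + \<zeta> i" "b = ip w (p i)"
    have dp: "ip d (p i) = b - a + \<zeta> i"
      unfolding d_def a_b_def using p that v w by (simp add: ip_diff)
    have gh: "g i = u a" "h i = u b" by (simp_all add: target hyp a_b_def)
    have "\<bar>u a - u b\<bar> \<le> L * \<bar>a - b\<bar>"
      using lipschitz_onD[OF u(3), of a b] by (simp add: dist_real_def)
    hence "\<bar>u a - u b\<bar> * \<bar>u a - u b\<bar> \<le> L * \<bar>a - b\<bar> * \<bar>u a - u b\<bar>"
      by (intro mult_right_mono) auto
    \<comment> \<open>Monotonicity gives the two differences the same sign; the Lipschitz bound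
      thereby becomes a lower bound on a signed product.\<close>
    also have "\<bar>a - b\<bar> * \<bar>u a - u b\<bar> = (a - b) * (u a - u b)"
    proof (cases "a \<le> b")
      case True
      hence "\<bar>a - b\<bar> = b - a" "\<bar>u a - u b\<bar> = u b - u a" using monoD[OF u(2), of a b] by auto
      thus ?thesis by (simp add: algebra_simps)
    next
      case False
      hence "\<bar>a - b\<bar> = a - b" "\<bar>u a - u b\<bar> = u a - u b" using monoD[OF u(2), of b a] by auto
      thus ?thesis by simp
    qed
    hence "L * \<bar>a - b\<bar> * \<bar>u a - u b\<bar> = L * ((a - b) * (u a - u b))"
      by (simp add: mult.assoc)
    finally have "(u a - u b)\<^sup>2 / L \<le> (a - b) * (u a - u b)"
      using L by (simp add: power2_eq_square divide_le_eq mult_ac)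
    moreover have "(u a - u b) * \<zeta> i \<le> 1 * \<bar>\<zeta> i\<bar>"
    proof -
      have "\<bar>u a - u b\<bar> \<le> 1" using u(1)[of a] u(1)[of b] by (auto simp: abs_le_iff)
      hence "\<bar>u a - u b\<bar> * \<bar>\<zeta> i\<bar> \<le> 1 * \<bar>\<zeta> i\<bar>" by (intro mult_right_mono) auto
      thus ?thesis using abs_ge_self[of "(u a - u b) * \<zeta> i"] by (simp add: abs_mult)
    qed
    moreover have "(g i - h i) * ip d (p i) = - ((a - b) * (u a - u b)) + (u a - u b) * \<zeta> i"
      unfolding dp gh by (simp add: algebra_simps)
    ultimately show ?thesis unfolding gh by linarith
  qed
  have dG1: "ip d G1 \<le> - (e / L) + \<rho>"
  proof -
    have "ip d G1 = (\<Sum>i<m. (g i - h i) * ip d (p i)) / m"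
      unfolding G1_def sum_divide_distrib
      by (subst ip_lincomb_right[OF finite_lessThan pH mem(1)]) (assumption, simp)
    also have "\<dots> \<le> (\<Sum>i<m. - ((g i - h i)\<^sup>2 / L) + \<bar>\<zeta> i\<bar>) / m"
      by (intro divide_right_mono sum_mono pointwise) auto
    also have "\<dots> = - (e / L) + \<rho>"
      unfolding e_def \<rho>_def by (simp add: sum_subtractf diff_divide_distrib sum_divide_distrib mult.commute)
    finally show ?thesis .
  qed
  have dN: "ip d N \<le> \<eta> * hnorm ip d"
  proof -
    have "ip d N \<le> hnorm ip d * hnorm ip N"
      using cauchy_schwarz[OF mem(1,4)] by simp
    also have "\<dots> \<le> hnorm ip d * \<eta>"
      using noise hnorm_nonneg[OF mem(1)] unfolding N_def by (intro mult_left_mono) auto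
    finally show ?thesis by (simp add: mult.commute)
  qed
  have dG: "ip d G = ip d G1 + ip d N"
    unfolding G using mem by (simp add: ip_add_right)
  have eq: "(\<lambda>z. w' z - v z) = (\<lambda>z. d z + (1 / L) * G z)"
    unfolding w'_def d_def G_def by auto
  have "(hnorm ip (\<lambda>z. w' z - v z))\<^sup>2 = ip d d + 2 / L * ip d G + ip G G / L\<^sup>2"
  proof -
    define G' where "G' = (\<lambda>z. (1 / L) * G z)"
    have G': "G' \<in> H" unfolding G'_def by (rule scale_mem[OF mem(2)])
    have "ip G' k = 1 / L * ip G k" "ip k G' = 1 / L * ip k G" if "k \<in> H" for k
      unfolding G'_def using ip_scale[OF mem(2) that] ip_scale_right[OF mem(2) that] by blast+
    note ipG' = this
    have "(hnorm ip (\<lambda>z. d z + G' z))\<^sup>2 = ip d d + ip d G' + (ip G' d + ip G' G')"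
      using mem G' add_mem[OF mem(1) G'] by (simp add: hnorm_power2 ip_add ip_add_right)
    also have "\<dots> = ip d d + 2 / L * ip d G + ip G G / L\<^sup>2"
      using mem G' ip_sym[OF mem(1,2)] by (simp add: ipG' power2_eq_square)
    finally show ?thesis unfolding eq G'_def .
  qed
  also have "\<dots> \<le> ip d d + 2 / L * (- (e / L) + \<rho> + \<eta> * hnorm ip d) + (3 / 2 * e + 3 * \<eta>\<^sup>2) / L\<^sup>2"
    using dG1 dN L unfolding dG by (intro add_mono mult_left_mono divide_right_mono GG order_refl) auto
  also have "\<dots> = (hnorm ip d)\<^sup>2 - (e / 2 - 3 * \<eta>\<^sup>2 - 2 * L * \<rho> - 2 * L * \<eta> * hnorm ip d) / L\<^sup>2"
  proof -
    have "2 / L * X = 2 * L * X / L\<^sup>2" for X using L by (simp add: power2_eq_square)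
    thus ?thesis
      using mem(1) by (simp add: hnorm_power2 diff_divide_distrib add_divide_distrib)
  qed
  finally show ?thesis unfolding e_def \<rho>_def d_def .
qed

end

section \<open>Descent of the iterates and the conditional mean\<close>

text \<open>If no such iterate exists, each one inside the ball has a large error, so the next
  squared distance to \<open>v\<close> is smaller by more than \<kappa> / \<open>L\<^sup>2\<close>.
  The iterates hence never leave the ball, and after \<open>T\<close> steps the squared distance
  would be negative.\<close>

lemma (in rkhs) descent_reaches_small_error:
  fixes p :: "nat \<Rightarrow> 'a \<Rightarrow> real" and L \<eta> \<kappa> B :: real and w :: "nat \<Rightarrow> 'a \<Rightarrow> real"
    and y \<zeta> g :: "nat \<Rightarrow> real" and h :: "nat \<Rightarrow> nat \<Rightarrow> real" and m T :: nat
  assumes v: "v \<in> H" and w: "\<And>t. w t \<in> H" and m: "0 < m"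
    and p: "\<And>i. i < m \<Longrightarrow> p i \<in> H \<and> hnorm ip (p i) \<le> 1"
    and L: "0 < L" and u: "\<And>s. u s \<in> {0..1::real}" "mono u" "L-lipschitz_on UNIV u"
    and target: "\<And>i. g i = u (ip v (p i) + \<zeta> i)"
    and hyp: "\<And>t i. h t i = u (ip (w t) (p i))"
    and noise: "hnorm ip (lincomb {..<m} (\<lambda>i. (y i - g i) / m) p) \<le> \<eta>"
    and start: "hnorm ip (\<lambda>z. w 1 z - v z) \<le> B"
    and step: "\<And>t. 1 \<le> t \<Longrightarrow> w (Suc t) = (\<lambda>z. w t z + (1 / L) * lincomb {..<m} (\<lambda>i. (y i - h t i) / m) p z)"
    and \<kappa>: "0 < \<kappa>" and T: "B\<^sup>2 * L\<^sup>2 \<le> T * \<kappa>" "1 \<le> T"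
  shows "\<exists>t\<in>{1..T}. hnorm ip (\<lambda>z. w t z - v z) \<le> B \<and>
    (\<Sum>i<m. (g i - h t i)\<^sup>2) / m \<le> 2 * (3 * \<eta>\<^sup>2 + 2 * L * ((\<Sum>i<m. \<bar>\<zeta> i\<bar>) / m) + 2 * L * \<eta> * B + \<kappa>)"
proof (rule ccontr)
  define \<rho> where "\<rho> = (\<Sum>i<m. \<bar>\<zeta> i\<bar>) / m"
  define e where "e t = (\<Sum>i<m. (g i - h t i)\<^sup>2) / m" for t
  define c where "c = \<kappa> / L\<^sup>2"
  define dist where "dist t = hnorm ip (\<lambda>z. w t z - v z)" for t
  have dist0: "0 \<le> dist t" for t unfolding dist_def by (intro hnorm_nonneg diff_mem v w)
  have B: "0 \<le> B" using start dist0[of 1] unfolding dist_def by linarith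
  have \<eta>: "0 \<le> \<eta>"
    using p by (intro order_trans[OF hnorm_nonneg noise] lincomb_mem) auto
  assume "\<not> (\<exists>t\<in>{1..T}. hnorm ip (\<lambda>z. w t z - v z) \<le> B \<and>
    (\<Sum>i<m. (g i - h t i)\<^sup>2) / m \<le> 2 * (3 * \<eta>\<^sup>2 + 2 * L * ((\<Sum>i<m. \<bar>\<zeta> i\<bar>) / m) + 2 * L * \<eta> * B + \<kappa>))"
  hence neg: "\<not> (\<exists>t\<in>{1..T}. dist t \<le> B \<and> e t \<le> 2 * (3 * \<eta>\<^sup>2 + 2 * L * \<rho> + 2 * L * \<eta> * B + \<kappa>))"
    unfolding e_def dist_def \<rho>_def .
  have large: "e t > 2 * (3 * \<eta>\<^sup>2 + 2 * L * \<rho> + 2 * L * \<eta> * B + \<kappa>)" if "t \<in> {1..T}" "dist t \<le> B" for t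
    using that neg not_le by blast
  have decrease: "(dist (Suc t))\<^sup>2 < (dist t)\<^sup>2 - \<kappa> / L\<^sup>2" if t: "t \<in> {1..T}" "dist t \<le> B" for t
  proof -
    have "(dist (Suc t))\<^sup>2 \<le> (dist t)\<^sup>2 - (e t / 2 - 3 * \<eta>\<^sup>2 - 2 * L * \<rho> - 2 * L * \<eta> * dist t) / L\<^sup>2"
      using descent_step[OF v w m p L u target hyp noise, of t] step[of t] t
      unfolding dist_def e_def \<rho>_def by simp
    moreover have "2 * L * \<eta> * dist t \<le> 2 * L * \<eta> * B"
      using t L \<eta> by (intro mult_left_mono) auto
    hence "\<kappa> / L\<^sup>2 < (e t / 2 - 3 * \<eta>\<^sup>2 - 2 * L * \<rho> - 2 * L * \<eta> * dist t) / L\<^sup>2"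
    proof (intro divide_strict_right_mono)
      show "\<kappa> < e t / 2 - 3 * \<eta>\<^sup>2 - 2 * L * \<rho> - 2 * L * \<eta> * dist t"
        using large[OF t] \<open>2 * L * \<eta> * dist t \<le> 2 * L * \<eta> * B\<close> by argo
    qed (use L in simp)
    ultimately show ?thesis by linarith
  qed
  have inv: "(dist (Suc t))\<^sup>2 \<le> B\<^sup>2 - t * c" if "t \<le> T" for t
    using that
  proof (induction t)
    case 0
    thus ?case using start dist0[of 1] unfolding dist_def by (auto intro!: power_mono)
  next
    case (Suc t)
    hence IH: "(dist (Suc t))\<^sup>2 \<le> B\<^sup>2 - t * c" by simp
    also have "\<dots> \<le> B\<^sup>2" using \<kappa> by (simp add: c_def)
    finally have "dist (Suc t) \<le> B" using B by (rule power2_le_imp_le)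
    hence "(dist (Suc (Suc t)))\<^sup>2 < (dist (Suc t))\<^sup>2 - c"
      unfolding c_def using Suc.prems by (intro decrease) auto
    thus ?case using IH by (simp add: c_def[symmetric] distrib_right)
  qed
  have Tc: "B\<^sup>2 \<le> T * c"
    using T(1) L by (simp add: c_def pos_le_divide_eq)
  \<comment> \<open>The invariant at \<open>T\<close> alone would allow distance 0 when
    \<open>B\<^sup>2 * L\<^sup>2 = T * \<kappa>\<close>. The last step is taken separately to keep
    its strict inequality.\<close>
  obtain T' where T': "T = Suc T'" using T(2) by (cases T) auto
  have "(dist (Suc T'))\<^sup>2 \<le> B\<^sup>2 - T' * c" using inv[of T'] T' by simp
  moreover have "T' * c \<ge> 0" using \<kappa> by (simp add: c_def)
  ultimately have "(dist (Suc T'))\<^sup>2 \<le> B\<^sup>2" by linarith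
  hence "dist (Suc T') \<le> B" using B by (rule power2_le_imp_le)
  hence "(dist (Suc T))\<^sup>2 < (dist T)\<^sup>2 - c"
    unfolding c_def by (intro decrease) (simp_all add: T')
  moreover have "(dist T)\<^sup>2 \<le> B\<^sup>2 - T' * c"
    using inv[of T'] by (simp add: T')
  moreover have "T * c = T' * c + c"
    by (simp only: T' of_nat_Suc distrib_right mult_1_left add.commute)
  moreover have "0 \<le> (dist (Suc T))\<^sup>2" by simp
  ultimately show False using Tc by linarith
qed

text \<open>Serves the Bernstein-type moment bound for the selection. For negative \<open>x\<close>
  it is the reciprocal of the quadratic Taylor lower bound at \<open>- x\<close>.\<close>

lemma exp_le_quadratic:
  fixes x :: real
  assumes "\<bar>x\<bar> \<le> 1"
  shows "exp x \<le> 1 + x + x\<^sup>2"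
proof (cases "0 \<le> x")
  case True
  thus ?thesis using assms by (intro exp_bound) auto
next
  case False
  define y where "y = - x"
  have y: "0 \<le> y" using False by (simp add: y_def)
  have "1 \<le> 1 + y\<^sup>2 / 2 + y ^ 3 / 2 + y ^ 4 / 2" using y by simp
  also have "\<dots> = (1 - y + y\<^sup>2) * (1 + y + y\<^sup>2 / 2)"
    by (simp add: field_simps power2_eq_square power3_eq_cube power4_eq_xxxx)
  also have "\<dots> \<le> (1 - y + y\<^sup>2) * exp y"
  proof (intro mult_left_mono exp_lower_Taylor_quadratic y)
    have "0 \<le> (1 / 2 - y)\<^sup>2 + 3 / 4" by simp
    also have "\<dots> = 1 - y + y\<^sup>2" by (simp add: power2_eq_square algebra_simps)
    finally show "0 \<le> 1 - y + y\<^sup>2" .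
  qed
  finally have "exp (- y) \<le> 1 - y + y\<^sup>2"
    by (simp add: exp_minus field_simps)
  thus ?thesis by (simp add: y_def)
qed

section \<open>The conditional mean and the excess error\<close>

context alphatron_setting
begin

abbreviation "MX \<equiv> restrict_space (euclid n) X"

abbreviation target :: "(nat \<Rightarrow> real) \<Rightarrow> real" where
  "target x \<equiv> u (ip v (\<psi> x) + \<xi> x)"

abbreviation noiseless :: "(nat \<Rightarrow> real) \<Rightarrow> real" where
  "noiseless x \<equiv> u (ip v (\<psi> x))"

lemma space_MX: "space MX = X"
  using X_subset by (auto simp: space_restrict_space)

lemma space_D: "space D = X \<times> {0..1}"
  using sets_eq_imp_space_eq[OF sets_D]
  by (simp add: space_pair_measure space_MX)

lemma fst_measurable [measurable]: "fst \<in> D \<rightarrow>\<^sub>M MX"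
  unfolding measurable_cong_sets[OF sets_D refl] by (rule measurable_fst)

lemma snd_measurable [measurable]: "snd \<in> borel_measurable D"
  unfolding measurable_cong_sets[OF sets_D refl]
  using measurable_snd[of MX "restrict_space borel {0..1::real}"]
  by (simp only: measurable_restrict_space2_iff)

lemma u_measurable [measurable]: "u \<in> borel_measurable borel"
  by (rule borel_measurable_mono[OF u_mono])

declare xi_measurable [measurable]

lemma feature_measurable' [measurable]: "(\<lambda>x. ip v (\<psi> x)) \<in> borel_measurable MX"
  by (rule feature_measurable[OF v_mem])

lemma u_bounds [simp]: "0 \<le> u s" "u s \<le> 1"
  using u_range[of s] by auto

lemma u_lip: "\<bar>u a - u b\<bar> \<le> L * \<bar>a - b\<bar>"
  using lipschitz_onD[OF u_lipschitz, of a b] by (simp add: dist_real_def)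

lemma X_memD: "x \<in> X \<Longrightarrow> \<psi> x \<in> H \<and> hnorm ip (\<psi> x) \<le> 1"
  using feature_mem feature_norm by simp

lemma subalgebra_fst: "subalgebra D (vimage_algebra (space D) fst MX)"
  unfolding subalgebra_def
proof (intro conjI)
  show "sets (vimage_algebra (space D) fst MX) \<subseteq> sets D"
    by (intro sets_image_in_sets) (auto)
qed simp

text \<open>The characteristic property of the conditional expectation, tested against a bounded
  function of \<open>x\<close>. It removes the cross terms both in the second moment of the noise
  and in the mean of the regret.\<close>

lemma integral_residual:
  assumes f: "f \<in> borel_measurable MX" and bound: "\<And>x. x \<in> X \<Longrightarrow> \<bar>f x\<bar> \<le> b"
  shows "(\<integral>z. f (fst z) * (snd z - target (fst z)) \<partial>D) = 0"
proof -
  interpret A: finite_measure_subalgebra D "vimage_algebra (space D) fst MX"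
    by unfold_locales (rule subalgebra_fst)
  note [measurable] = f
  have D: "fst z \<in> X" "snd z \<in> {0..1}" if "z \<in> space D" for z using that by (auto simp: space_D)
  have b: "\<bar>f (fst z) * c\<bar> \<le> b" if "z \<in> space D" "c \<in> {0..1}" for z c
  proof -
    have "\<bar>f (fst z)\<bar> * \<bar>c\<bar> \<le> b * 1"
      using bound[OF D(1)[OF that(1)]] that(2) by (intro mult_mono) auto
    thus ?thesis by (simp add: abs_mult)
  qed
  have int: "integrable D (\<lambda>z. f (fst z) * snd z)" "integrable D (\<lambda>z. f (fst z) * target (fst z))"
    using b D by (intro integrable_bounded[of _ b]; auto)+
  have "(\<integral>z. f (fst z) * snd z \<partial>D)
      = (\<integral>z. f (fst z) * real_cond_exp D (vimage_algebra (space D) fst MX) snd z \<partial>D)"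
  proof (rule A.real_cond_exp_intg(2)[symmetric])
    show "(\<lambda>z. f (fst z)) \<in> borel_measurable (vimage_algebra (space D) fst MX)"
      by (rule measurable_compose[OF measurable_vimage_algebra1 f]) (auto simp: space_D space_MX)
  qed (use int in auto)
  also have "\<dots> = (\<integral>z. f (fst z) * target (fst z) \<partial>D)"
    using cond_mean_eq unfolding cond_mean_def by (intro integral_cong_AE) auto
  finally show ?thesis
    using int by (simp add: right_diff_distrib)
qed

lemma excess_err_eq:
  assumes [measurable]: "h \<in> borel_measurable MX"
  shows "excess_err MX D h = (\<integral>z. (h (fst z) - target (fst z))\<^sup>2 \<partial>D)"
proof -
  have "cond_mean MX D \<in> borel_measurable D"
    unfolding cond_mean_def by (rule borel_measurable_cond_exp2)
  thus ?thesis
    unfolding excess_err_def using cond_mean_eq by (intro integral_cong_AE) auto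
qed

lemma integral_abs_xi_le: "(\<integral>z. \<bar>\<xi> (fst z)\<bar> \<partial>D) \<le> sqrt \<epsilon>"
proof -
  have bound: "\<bar>\<xi> (fst z)\<bar> \<le> M" if "z \<in> space D" for z
    using xi_bound[of "fst z"] that X_subset by (auto simp: space_D abs_le_iff)
  have int: "integrable D (\<lambda>z. \<bar>\<xi> (fst z)\<bar>)" "integrable D (\<lambda>z. (\<xi> (fst z))\<^sup>2)"
    using bound power_mono[OF bound, of _ 2]
    by (intro integrable_bounded[of _ M] integrable_bounded[of _ "M\<^sup>2"]; simp)+
  define \<mu> where "\<mu> = (\<integral>z. \<bar>\<xi> (fst z)\<bar> \<partial>D)"
  have "0 \<le> (\<integral>z. (\<bar>\<xi> (fst z)\<bar> - \<mu>)\<^sup>2 \<partial>D)" by simp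
  also have "\<dots> = (\<integral>z. (\<xi> (fst z))\<^sup>2 - 2 * \<mu> * \<bar>\<xi> (fst z)\<bar> + \<mu>\<^sup>2 \<partial>D)"
    by (intro Bochner_Integration.integral_cong) (simp_all add: power2_diff)
  also have "\<dots> = (\<integral>z. (\<xi> (fst z))\<^sup>2 \<partial>D) - \<mu>\<^sup>2"
    using int by (simp add: prob_space \<mu>_def power2_eq_square)
  finally have "\<mu>\<^sup>2 \<le> \<epsilon>" using xi_second_moment by simp
  thus ?thesis unfolding \<mu>_def by (rule real_le_rsqrt)
qed

text \<open>A number in the unit interval is at least its square, so the bound is linear in
  \<bar>\<xi>\<bar>. This is the origin of \<open>L * sqrt \<epsilon>\<close> in the rate.\<close>

lemma target_noiseless_le:
  assumes "x \<in> X"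
  shows "(noiseless x - target x)\<^sup>2 \<le> L * \<bar>\<xi> x\<bar>"
proof -
  have "\<bar>noiseless x - target x\<bar> \<le> 1"
    using u_bounds[of "ip v (\<psi> x)"] u_bounds[of "ip v (\<psi> x) + \<xi> x"] by (simp add: abs_le_iff del: u_bounds)
  hence "\<bar>noiseless x - target x\<bar> * \<bar>noiseless x - target x\<bar> \<le> 1 * \<bar>noiseless x - target x\<bar>"
    by (intro mult_right_mono) auto
  also have "1 * \<bar>noiseless x - target x\<bar> \<le> L * \<bar>\<xi> x\<bar>"
    using u_lip[of "ip v (\<psi> x)" "ip v (\<psi> x) + \<xi> x"] by simp
  finally show ?thesis by (simp add: power2_eq_square)
qed

lemma excess_err_le_noiseless:
  assumes h [measurable]: "h \<in> borel_measurable MX" and range: "\<And>x. x \<in> X \<Longrightarrow> h x \<in> {0..1}"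
  shows "excess_err MX D h \<le> 2 * (\<integral>z. (h (fst z) - noiseless (fst z))\<^sup>2 \<partial>D) + 2 * L * sqrt \<epsilon>"
proof -
  have D: "fst z \<in> X" if "z \<in> space D" for z using that by (auto simp: space_D)
  have sq: "(a - b)\<^sup>2 \<le> 1" if "a \<in> {0..1}" "b \<in> {0..1}" for a b :: real
    using that power_le_one[of "\<bar>a - b\<bar>" 2] by (auto simp: abs_le_iff)
  have \<xi>b: "\<bar>\<xi> (fst z)\<bar> \<le> M" if "z \<in> space D" for z
    using xi_bound[of "fst z"] D[OF that] X_subset by (auto simp: abs_le_iff)
  have int: "integrable D (\<lambda>z. (h (fst z) - target (fst z))\<^sup>2)"
       "integrable D (\<lambda>z. (h (fst z) - noiseless (fst z))\<^sup>2)"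
    using range D by (intro integrable_bounded[of _ 1]; simp add: sq)+
  have int\<xi>: "integrable D (\<lambda>z. \<bar>\<xi> (fst z)\<bar>)"
    using \<xi>b by (intro integrable_bounded[of _ M]) auto
  have "excess_err MX D h = (\<integral>z. (h (fst z) - target (fst z))\<^sup>2 \<partial>D)"
    by (rule excess_err_eq) fact
  also have "\<dots> \<le> (\<integral>z. 2 * (h (fst z) - noiseless (fst z))\<^sup>2 + 2 * L * \<bar>\<xi> (fst z)\<bar> \<partial>D)"
  proof (intro integral_mono int Bochner_Integration.integrable_add integrable_mult_right int\<xi>)
    fix z assume "z \<in> space D"
    define a b where "a = h (fst z) - noiseless (fst z)" "b = noiseless (fst z) - target (fst z)"
    have "0 \<le> (a - b)\<^sup>2" by simp
    hence "(a + b)\<^sup>2 \<le> 2 * a\<^sup>2 + 2 * b\<^sup>2" by (simp add: power2_sum power2_diff)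
    also have "b\<^sup>2 \<le> L * \<bar>\<xi> (fst z)\<bar>"
      unfolding a_b_def by (rule target_noiseless_le[OF D]) fact
    finally show "(h (fst z) - target (fst z))\<^sup>2 \<le> 2 * (h (fst z) - noiseless (fst z))\<^sup>2 + 2 * L * \<bar>\<xi> (fst z)\<bar>"
      by (simp add: a_b_def)
  qed
  also have "\<dots> = 2 * (\<integral>z. (h (fst z) - noiseless (fst z))\<^sup>2 \<partial>D) + 2 * L * (\<integral>z. \<bar>\<xi> (fst z)\<bar> \<partial>D)"
    using int int\<xi> by simp
  also have "\<dots> \<le> 2 * (\<integral>z. (h (fst z) - noiseless (fst z))\<^sup>2 \<partial>D) + 2 * L * sqrt \<epsilon>"
    using integral_abs_xi_le L_pos by simp
  finally show ?thesis .
qed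

end

section \<open>Alphatron iterates and their generalization\<close>

context alphatron_setting
begin

abbreviation "PS m \<equiv> PiM {..<m} (\<lambda>_. D)"

abbreviation "hyp m S t \<equiv> alphatron_hyp u K (1 / L) m S t"

text \<open>The weight vector in \<open>H\<close> that the coefficients represent. The algorithm
  never forms it; in terms of it, an iteration is the additive update analysed in
  \<open>descent_step\<close>.\<close>

definition iterate :: "nat \<Rightarrow> (nat \<Rightarrow> (nat \<Rightarrow> real) \<times> real) \<Rightarrow> nat \<Rightarrow> (nat \<Rightarrow> real) \<Rightarrow> real" where
  "iterate m S t = lincomb {..<m} (alpha u K (1 / L) m S t) (\<lambda>i. \<psi> (fst (S i)))"

lemma prob_space_PS: "prob_space (PS m)"
  by (intro prob_space_PiM prob_space_axioms)

lemma sample_measurable: "i < m \<Longrightarrow> (\<lambda>S. S i) \<in> PS m \<rightarrow>\<^sub>M D"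
  by simp

lemma sample_fst_measurable: "i < m \<Longrightarrow> (\<lambda>S. fst (S i)) \<in> PS m \<rightarrow>\<^sub>M MX"
  by (rule measurable_compose[OF sample_measurable fst_measurable])

lemma sample_snd_measurable: "i < m \<Longrightarrow> (\<lambda>S. snd (S i)) \<in> borel_measurable (PS m)"
  by (rule measurable_compose[OF sample_measurable snd_measurable])

lemma sample_space: "S \<in> space (PS m) \<Longrightarrow> i < m \<Longrightarrow> fst (S i) \<in> X \<and> snd (S i) \<in> {0..1}"
  using measurable_space[OF sample_measurable, of i m S] by (auto simp: space_D)

lemma sample_feature:
  "S \<in> space (PS m) \<Longrightarrow> i < m \<Longrightarrow> \<psi> (fst (S i)) \<in> H \<and> hnorm ip (\<psi> (fst (S i))) \<le> 1"
  using sample_space X_memD by blast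

lemma kernel_pair_measurable:
  assumes "f \<in> N \<rightarrow>\<^sub>M MX" "g \<in> N \<rightarrow>\<^sub>M MX"
  shows "(\<lambda>s. K (f s) (g s)) \<in> borel_measurable N"
  using measurable_compose[OF measurable_Pair[OF assms] kernel_measurable] by simp

lemma kernel_hyp_measurable:
  assumes a: "\<And>i. i < m \<Longrightarrow> (\<lambda>S. a S i) \<in> borel_measurable (PS m)"
    and f: "f \<in> N \<rightarrow>\<^sub>M PS m" and g: "g \<in> N \<rightarrow>\<^sub>M MX"
  shows "(\<lambda>s. kernel_hyp u K m (f s) (a (f s)) (g s)) \<in> borel_measurable N"
  unfolding kernel_hyp_def
proof (intro measurable_compose[OF _ u_measurable] borel_measurable_sum borel_measurable_times)
  fix i assume "i \<in> {..<m}"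
  hence i: "i < m" by simp
  show "(\<lambda>s. a (f s) i) \<in> borel_measurable N"
    using measurable_compose[OF f a[OF i]] .
  show "(\<lambda>s. K (g s) (fst (f s i))) \<in> borel_measurable N"
    by (intro kernel_pair_measurable g measurable_compose[OF f sample_fst_measurable[OF i]])
qed

lemma alpha_measurable: "i < m \<Longrightarrow> (\<lambda>S. alpha u K lr m S t i) \<in> borel_measurable (PS m)"
proof (induction t arbitrary: i rule: induct_nat_012)
  case (ge2 t)
  have "(\<lambda>S. kernel_hyp u K m S (alpha u K lr m S (Suc t)) (fst (S i))) \<in> borel_measurable (PS m)"
    by (rule kernel_hyp_measurable[of m "\<lambda>S. alpha u K lr m S (Suc t)" "\<lambda>S. S"])
       (use ge2 sample_fst_measurable in auto)
  thus ?case
    using ge2 sample_snd_measurable[OF ge2.prems] by simp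
qed auto

lemma hyp_measurable:
  assumes "f \<in> N \<rightarrow>\<^sub>M PS m" "g \<in> N \<rightarrow>\<^sub>M MX"
  shows "(\<lambda>s. hyp m (f s) t (g s)) \<in> borel_measurable N"
  unfolding alphatron_hyp_def by (intro kernel_hyp_measurable alpha_measurable assms)

lemma hyp_measurable1: "S \<in> space (PS m) \<Longrightarrow> hyp m S t \<in> borel_measurable MX"
  using hyp_measurable[of "\<lambda>_. S" MX m "\<lambda>x. x" t] by simp

lemma hyp_range: "hyp m S t x \<in> {0..1}"
  by (simp add: alphatron_hyp_def kernel_hyp_def)

lemma iterate_mem: "S \<in> space (PS m) \<Longrightarrow> iterate m S t \<in> H"
  unfolding iterate_def using sample_feature by (intro lincomb_mem) auto

lemma hyp_eq:
  assumes "S \<in> space (PS m)" "x \<in> X"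
  shows "hyp m S t x = u (ip (iterate m S t) (\<psi> x))"
proof -
  have "ip (iterate m S t) (\<psi> x) = (\<Sum>i<m. alpha u K (1 / L) m S t i * ip (\<psi> (fst (S i))) (\<psi> x))"
    unfolding iterate_def using sample_feature assms X_memD by (intro ip_lincomb) auto
  also have "\<dots> = (\<Sum>i<m. alpha u K (1 / L) m S t i * K x (fst (S i)))"
    using sample_space[OF assms(1)] assms X_memD
    by (intro sum.cong refl) (simp add: kernel_eq ip_sym)
  finally show ?thesis by (simp add: alphatron_hyp_def kernel_hyp_def)
qed

lemma iterate_1: "iterate m S 1 = (\<lambda>_. 0)"
  by (simp add: iterate_def lincomb_def)

lemma iterate_Suc:
  assumes "1 \<le> t"
  shows "iterate m S (Suc t) = (\<lambda>z. iterate m S t z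
    + (1 / L) * lincomb {..<m} (\<lambda>i. (snd (S i) - hyp m S t (fst (S i))) / m) (\<lambda>i. \<psi> (fst (S i))) z)"
proof -
  obtain s where "t = Suc s" using assms by (cases t) auto
  thus ?thesis
    unfolding iterate_def lincomb_def alphatron_hyp_def sum_distrib_left sum.distrib[symmetric]
    by (intro ext sum.cong refl) (simp add: distrib_right)
qed

lemma start_dist: "hnorm ip (\<lambda>z. iterate m S 1 z - v z) \<le> B"
  using hnorm_scale[OF v_mem, of "-1"] v_norm by (simp add: iterate_1[unfolded One_nat_def])

text \<open>The squared distance of the iterate to \<open>v\<close>, expanded by bilinearity. In
  this form it is a finite expression in functions measurable in the sample.\<close>

definition sq_dist :: "nat \<Rightarrow> (nat \<Rightarrow> (nat \<Rightarrow> real) \<times> real) \<Rightarrow> nat \<Rightarrow> real" where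
  "sq_dist m S t = (\<Sum>i<m. \<Sum>j<m. alpha u K (1 / L) m S t i * alpha u K (1 / L) m S t j * K (fst (S i)) (fst (S j)))
    - 2 * (\<Sum>i<m. alpha u K (1 / L) m S t i * ip v (\<psi> (fst (S i)))) + ip v v"

lemma sq_dist_measurable: "(\<lambda>S. sq_dist m S t) \<in> borel_measurable (PS m)"
proof -
  have [measurable]: "(\<lambda>S. ip v (\<psi> (fst (S i)))) \<in> borel_measurable (PS m)"
    "(\<lambda>S. alpha u K (1 / L) m S t i) \<in> borel_measurable (PS m)" if "i \<in> {..<m}" for i
    using that measurable_compose[OF sample_fst_measurable feature_measurable'] alpha_measurable by auto
  have [measurable]: "(\<lambda>S. K (fst (S i)) (fst (S j))) \<in> borel_measurable (PS m)"
    if "i \<in> {..<m}" "j \<in> {..<m}" for i j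
    using that by (intro kernel_pair_measurable sample_fst_measurable) auto
  show ?thesis unfolding sq_dist_def by measurable
qed

lemma sq_dist_eq:
  assumes S: "S \<in> space (PS m)"
  shows "(hnorm ip (\<lambda>z. iterate m S t z - v z))\<^sup>2 = sq_dist m S t"
proof -
  let ?a = "alpha u K (1 / L) m S t" and ?p = "\<lambda>i. \<psi> (fst (S i))" and ?w = "iterate m S t"
  note w = iterate_mem[OF S, of t]
  have p: "?p i \<in> H" if "i \<in> {..<m}" for i using sample_feature[OF S] that by simp
  have "(hnorm ip (\<lambda>z. ?w z - v z))\<^sup>2 = ip ?w ?w - 2 * ip v ?w + ip v v"
    using w v_mem diff_mem[OF w v_mem] ip_sym[OF w v_mem]
    by (simp add: hnorm_power2 ip_diff ip_diff_right)
  also have "ip ?w ?w = (\<Sum>i<m. \<Sum>j<m. ?a i * ?a j * ip (?p i) (?p j))"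
    unfolding iterate_def using p by (intro ip_lincomb_lincomb) auto
  also have "\<dots> = (\<Sum>i<m. \<Sum>j<m. ?a i * ?a j * K (fst (S i)) (fst (S j)))"
    using sample_space[OF S] by (intro sum.cong refl) (simp add: kernel_eq)
  also have "ip v ?w = (\<Sum>i<m. ?a i * ip v (?p i))"
    unfolding iterate_def using p v_mem by (intro ip_lincomb_right) auto
  finally show ?thesis by (simp add: sq_dist_def)
qed

lemma near_iff:
  assumes "S \<in> space (PS m)"
  shows "sq_dist m S t \<le> B\<^sup>2 \<longleftrightarrow> hnorm ip (\<lambda>z. iterate m S t z - v z) \<le> B"
  unfolding sq_dist_eq[OF assms, symmetric]
  using B_pos hnorm_nonneg[OF diff_mem[OF iterate_mem[OF assms] v_mem]]
  by (auto intro: power_mono power2_le_imp_le)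

text \<open>
  The loss is taken relative to the noiseless target and cut off for iterates that have left the
  ball around \<open>v\<close>.  Its range is then \<open>B * L\<close>, which is what keeps the generalization
  error proportional to \<open>B * L\<close> even if this is small.
\<close>

definition cut_loss :: "nat \<Rightarrow> nat \<Rightarrow> (nat \<Rightarrow> (nat \<Rightarrow> real) \<times> real) \<Rightarrow> (nat \<Rightarrow> real) \<times> real \<Rightarrow> real" where
  "cut_loss m t S z = (if sq_dist m S t \<le> B\<^sup>2 then (hyp m S t (fst z) - noiseless (fst z))\<^sup>2 else 0)"

lemma cut_loss_measurable: "(\<lambda>(S, z). cut_loss m t S z) \<in> borel_measurable (PS m \<Otimes>\<^sub>M D)"
proof -
  have [measurable]: "(\<lambda>p. hyp m (fst p) t (fst (snd p))) \<in> borel_measurable (PS m \<Otimes>\<^sub>M D)"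
    by (intro hyp_measurable) auto
  have [measurable]: "(\<lambda>p. sq_dist m (fst p) t) \<in> borel_measurable (PS m \<Otimes>\<^sub>M D)"
    by (rule measurable_compose[OF measurable_fst sq_dist_measurable])
  have [measurable]: "(\<lambda>p. noiseless (fst (snd p))) \<in> borel_measurable (PS m \<Otimes>\<^sub>M D)"
    by measurable
  show ?thesis unfolding cut_loss_def split_beta by measurable
qed

text \<open>The cutoff seen in \<open>H\<close>: the zero vector yields loss 0. Every cut loss thus
  comes from a vector in the ball of radius \<open>B\<close>, as the Rademacher bound
  requires.\<close>

definition cut_diff :: "nat \<Rightarrow> nat \<Rightarrow> (nat \<Rightarrow> (nat \<Rightarrow> real) \<times> real) \<Rightarrow> (nat \<Rightarrow> real) \<Rightarrow> real" where
  "cut_diff m t S = (if sq_dist m S t \<le> B\<^sup>2 then (\<lambda>z. iterate m S t z - v z) else (\<lambda>_. 0))"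

lemma cut_diff: "S \<in> space (PS m) \<Longrightarrow> cut_diff m t S \<in> H \<and> hnorm ip (cut_diff m t S) \<le> B"
  using near_iff[of S m t] diff_mem[OF iterate_mem v_mem] zero_mem B_pos ip_zero[OF zero_mem]
  by (auto simp: cut_diff_def hnorm_def)

lemma cut_loss_eq:
  assumes S: "S \<in> space (PS m)" and x: "fst z \<in> X"
  shows "cut_loss m t S z = (u (ip v (\<psi> (fst z)) + ip (cut_diff m t S) (\<psi> (fst z))) - noiseless (fst z))\<^sup>2"
  using iterate_mem[OF S] v_mem X_memD[OF x]
  by (auto simp: cut_loss_def cut_diff_def hyp_eq[OF S x] ip_diff ip_zero)

lemma cut_loss_range:
  assumes S: "S \<in> space (PS m)" and z: "z \<in> space D"
  shows "cut_loss m t S z \<in> {0..L * B}"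
proof -
  have x: "fst z \<in> X" using z by (auto simp: space_D)
  define a where "a = \<bar>u (ip v (\<psi> (fst z)) + ip (cut_diff m t S) (\<psi> (fst z))) - noiseless (fst z)\<bar>"
  have "a \<le> 1"
    unfolding a_def abs_le_iff using u_range by (auto simp: algebra_simps add_increasing intro: order_trans[OF u_bounds(2)])
  hence "a * a \<le> 1 * a" by (intro mult_right_mono) (auto simp: a_def)
  also have "1 * a \<le> L * \<bar>ip (cut_diff m t S) (\<psi> (fst z))\<bar>"
    unfolding a_def using u_lip[of "ip v (\<psi> (fst z)) + ip (cut_diff m t S) (\<psi> (fst z))" "ip v (\<psi> (fst z))"] by simp
  also have "\<bar>ip (cut_diff m t S) (\<psi> (fst z))\<bar> \<le> hnorm ip (cut_diff m t S) * hnorm ip (\<psi> (fst z))"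
    using cut_diff[OF S] X_memD[OF x] by (intro cauchy_schwarz) auto
  also have "\<dots> \<le> B * 1"
    using cut_diff[OF S] X_memD[OF x] hnorm_nonneg B_pos by (intro mult_mono) auto
  finally have "a * a \<le> L * B" using L_pos by simp
  thus ?thesis
    unfolding cut_loss_eq[OF S x] a_def by (simp add: power2_eq_square)
qed

lemma cut_loss_generalizes:
  assumes m: "0 < m" and T: "1 \<le> T" and s: "0 < l"
  shows "measure (PS m) {S \<in> space (PS m). \<exists>t\<in>{1..T}.
      (4 * L * B + 2 * L * B * sqrt l) / sqrt m < (\<integral>z. cut_loss m t S z \<partial>D) - (\<Sum>i<m. cut_loss m t S (S i)) / m}
    \<le> exp (- l)"
proof -
  \<comment> \<open>For loss range \<open>L * B\<close> the quadratic term of the exponent becomes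
    \<open>l / 2\<close>, and the excess of \<open>b\<close> over \<open>R\<close> contributes
    \<open>- 2 * l\<close>, which together is below \<open>- l\<close>.\<close>
  define s where "s = sqrt m * sqrt l / (L * B)"
  define R where "R = 4 * L * B / sqrt m"
  define b where "b = (4 * L * B + 2 * L * B * sqrt l) / sqrt m"
  have LB: "0 < L * B" using L_pos B_pos by simp
  have s0: "0 < s" unfolding s_def using m s LB by simp
  have "measure (PS m) {S \<in> space (PS m). \<exists>t\<in>{1..T}.
      b < (\<integral>z. cut_loss m t S z \<partial>D) - (\<Sum>i<m. cut_loss m t S (S i)) / m}
    \<le> exp (s * R + s\<^sup>2 * (L * B)\<^sup>2 / (2 * m) - s * b)"
  proof (rule generalization_bound[where loss = "cut_loss m" and m = m])
    fix W and z z' :: "nat \<Rightarrow> (nat \<Rightarrow> real) \<times> real"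
    assume W: "finite W" "W \<noteq> {}" "W \<subseteq> {(t, S). t \<in> {1..T} \<and> S \<in> space (PS m)}"
      and z: "\<And>i. i < m \<Longrightarrow> z i \<in> space D \<and> z' i \<in> space D"
    have zX: "fst (z i) \<in> X" "fst (z' i) \<in> X" if "i < m" for i
      using z[OF that] by (auto simp: space_D)
    define loss where "loss w q = (u (ip v q + ip (cut_diff m (fst w) (snd w)) q) - u (ip v q))\<^sup>2"
      for w :: "nat \<times> (nat \<Rightarrow> (nat \<Rightarrow> real) \<times> real)" and q
    have "(\<Sum>J\<in>Pow {..<m}. Max ((\<lambda>(t, S). \<Sum>i<m. rsign J i * (cut_loss m t S (z' i) - cut_loss m t S (z i))) ` W))
      = (\<Sum>J\<in>Pow {..<m}. Max ((\<lambda>w. \<Sum>i<m. rsign J i * (loss w (\<psi> (fst (z' i))) - loss w (\<psi> (fst (z i))))) ` W))"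
    proof (rule sum.cong[OF refl], rule arg_cong[where f = Max], rule image_cong[OF refl])
      fix J w assume "w \<in> W"
      then obtain t S where w: "w = (t, S)" "S \<in> space (PS m)" using W(3) by auto
      show "(case w of (t, S) \<Rightarrow> \<Sum>i<m. rsign J i * (cut_loss m t S (z' i) - cut_loss m t S (z i)))
        = (\<Sum>i<m. rsign J i * (loss w (\<psi> (fst (z' i))) - loss w (\<psi> (fst (z i)))))"
        using w zX by (simp add: cut_loss_eq loss_def)
    qed
    also have "\<dots> \<le> 2 ^ m * (4 * L * B * sqrt m)"
    proof (rule rademacher_squared_loss[where u = u and v = v and loss = loss and d = "\<lambda>w. cut_diff m (fst w) (snd w)"
          and p = "\<lambda>i. \<psi> (fst (z i))" and p' = "\<lambda>i. \<psi> (fst (z' i))"])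
      show "cut_diff m (fst w) (snd w) \<in> H \<and> hnorm ip (cut_diff m (fst w) (snd w)) \<le> B" if "w \<in> W" for w
        using W(3) that by (intro cut_diff) auto
      show "loss w q = (u (ip v q + ip (cut_diff m (fst w) (snd w)) q) - u (ip v q))\<^sup>2" for w q
        by (simp add: loss_def)
      show "0 \<le> B" using B_pos by simp
    qed (fact W L_pos u_lipschitz u_range X_memD[OF zX(1)] X_memD[OF zX(2)])+
    also have "4 * L * B * sqrt m = m * R"
    proof -
      have "m * R = 4 * L * B * (m / sqrt m)" by (simp add: R_def)
      thus ?thesis by (simp add: real_div_sqrt)
    qed
    finally show "(\<Sum>J\<in>Pow {..<m}. Max ((\<lambda>(t, S). \<Sum>i<m. rsign J i * (cut_loss m t S (z' i) - cut_loss m t S (z i))) ` W))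
      \<le> 2 ^ m * (m * R)" .
  next
    show "{1..T} \<noteq> {}" using T by simp
  qed (use cut_loss_measurable cut_loss_range in \<open>simp_all only: m s0 prob_space_axioms finite_atLeastAtMost\<close>)
  also have "s * R + s\<^sup>2 * (L * B)\<^sup>2 / (2 * m) - s * b = l / 2 - 2 * l"
  proof -
    have "s * b = s * R + s * (2 * L * B * sqrt l / sqrt m)"
      by (simp add: b_def R_def add_divide_distrib distrib_left)
    moreover have "s * (2 * L * B * sqrt l / sqrt m) = 2 * l"
      unfolding s_def using m s L_pos B_pos by simp
    moreover have "s\<^sup>2 * (L * B)\<^sup>2 / (2 * m) = l / 2"
      unfolding s_def using m s L_pos B_pos by (simp add: power_divide power_mult_distrib)
    ultimately show ?thesis by simp
  qed
  also have "exp (l / 2 - 2 * l) \<le> exp (- l)" using s by simp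
  finally show ?thesis unfolding b_def .
qed

end

section \<open>Concentration of the noise\<close>

context alphatron_setting
begin

abbreviation residual :: "(nat \<Rightarrow> real) \<times> real \<Rightarrow> real" where
  "residual z \<equiv> snd z - target (fst z)"

definition noise_vec :: "nat \<Rightarrow> (nat \<Rightarrow> (nat \<Rightarrow> real) \<times> real) \<Rightarrow> (nat \<Rightarrow> real) \<Rightarrow> real" where
  "noise_vec m S = lincomb {..<m} (\<lambda>i. residual (S i) / m) (\<lambda>i. \<psi> (fst (S i)))"

lemma residual_measurable [measurable]: "residual \<in> borel_measurable D"
  by measurable

lemma residual_bound: "z \<in> space D \<Longrightarrow> \<bar>residual z\<bar> \<le> 1"
  using u_range by (auto simp: space_D abs_le_iff algebra_simps add_increasing intro: order_trans[OF u_bounds(2)] order_trans[of _ 1])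

text \<open>Residuals of different samples are orthogonal: given the other samples, the cross terms
  are a function of the new point times its residual, which integrates to 0. Only the diagonal terms
  remain, each at most 1.\<close>

lemma integral_noise_sq:
  fixes I :: "nat set"
  assumes "finite I"
  shows "(\<integral>S. (\<Sum>i\<in>I. \<Sum>j\<in>I. residual (S i) * residual (S j) * K (fst (S i)) (fst (S j))) \<partial>PiM I (\<lambda>_. D)) \<le> card I"
  using assms
proof (induction I rule: finite_induct)
  case (insert k I)
  interpret product_sigma_finite "\<lambda>_. D" ..
  interpret P: prob_space "PiM I (\<lambda>_. D)" by (intro prob_space_PiM prob_space_axioms)
  interpret Q: prob_space "PiM (insert k I) (\<lambda>_. D)" by (intro prob_space_PiM prob_space_axioms)
  define q where "q J S = (\<Sum>i\<in>J. \<Sum>j\<in>J. residual (S i) * residual (S j) * K (fst (S i)) (fst (S j)))"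
    for J :: "nat set" and S
  have comp: "(\<lambda>S. S i) \<in> PiM J (\<lambda>_. D) \<rightarrow>\<^sub>M D" if "i \<in> J" for i and J :: "nat set"
    using that by simp
  have q_meas: "q J \<in> borel_measurable (PiM J (\<lambda>_. D))" for J :: "nat set"
    unfolding q_def
    by (intro borel_measurable_sum borel_measurable_times kernel_pair_measurable
          measurable_compose[OF comp residual_measurable] measurable_compose[OF comp fst_measurable])
  have mem: "S i \<in> space D" if "S \<in> space (PiM J (\<lambda>_. D))" "i \<in> J" for S i and J :: "nat set"
    using measurable_space[OF comp[OF that(2)] that(1)] .
  have K_bound: "\<bar>K (fst z) (fst z')\<bar> \<le> 1" if "z \<in> space D" "z' \<in> space D" for z z'
    using that X_memD by (auto simp: space_D kernel_eq intro!: ip_le_1)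
  have term_bound: "\<bar>residual z * residual z' * K (fst z) (fst z')\<bar> \<le> 1" if "z \<in> space D" "z' \<in> space D" for z z'
    unfolding abs_mult using K_bound[OF that] residual_bound[OF that(1)] residual_bound[OF that(2)]
    by (intro mult_le_one) auto
  have q_bound: "\<bar>q J S\<bar> \<le> real (card J) * card J" if S: "S \<in> space (PiM J (\<lambda>_. D))" for S and J :: "nat set"
  proof -
    have "\<bar>q J S\<bar> \<le> (\<Sum>i\<in>J. \<bar>\<Sum>j\<in>J. residual (S i) * residual (S j) * K (fst (S i)) (fst (S j))\<bar>)"
      unfolding q_def by (rule sum_abs)
    also have "\<dots> \<le> (\<Sum>i\<in>J. \<Sum>j\<in>J. \<bar>residual (S i) * residual (S j) * K (fst (S i)) (fst (S j))\<bar>)"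
      by (intro sum_mono sum_abs)
    also have "\<dots> \<le> (\<Sum>i\<in>J. \<Sum>j\<in>J. 1)"
      using mem[OF S] by (intro sum_mono term_bound) auto
    finally show ?thesis by simp
  qed
  have q_int: "integrable (PiM I (\<lambda>_. D)) (q I)"
    by (intro P.integrable_bounded[OF q_meas q_bound])
  have "(\<integral>S. q (insert k I) S \<partial>PiM (insert k I) (\<lambda>_. D))
      = (\<integral>S. (\<integral>z. q (insert k I) (S(k := z)) \<partial>D) \<partial>PiM I (\<lambda>_. D))"
    by (intro product_integral_insert insert.hyps Q.integrable_bounded[OF q_meas q_bound])
  also have "\<dots> \<le> (\<integral>S. q I S + 1 \<partial>PiM I (\<lambda>_. D))"
  proof (rule integral_mono)
    have inner: "(\<integral>z. q (insert k I) (S(k := z)) \<partial>D) = q I S + (\<integral>z. residual z * residual z * K (fst z) (fst z) \<partial>D)"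
      if S: "S \<in> space (PiM I (\<lambda>_. D))" for S
    proof -
      \<comment> \<open>The coefficient of the new residual in the quadratic form; the factor 2
        combines the new row and the new column by symmetry of the kernel.\<close>
      define f where "f x = 2 * (\<Sum>j\<in>I. residual (S j) * K x (fst (S j)))" for x
      have Sj: "S j \<in> space D" if "j \<in> I" for j using mem[OF S that] .
      have f_meas: "f \<in> borel_measurable MX"
        unfolding f_def using measurable_space[OF fst_measurable Sj]
        by (intro borel_measurable_times borel_measurable_sum borel_measurable_const kernel_pair_measurable) auto
      have f_bound: "\<bar>f x\<bar> \<le> 2 * (\<Sum>j\<in>I. 1)" if x: "x \<in> X" for x
      proof -
        have "\<bar>residual (S j) * K x (fst (S j))\<bar> \<le> 1" if j: "j \<in> I" for j
          unfolding abs_mult using K_bound[of "(x, 0)" "S j"] residual_bound[OF Sj[OF j]] Sj[OF j] x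
          by (intro mult_le_one) (auto simp: space_D)
        hence "\<bar>\<Sum>j\<in>I. residual (S j) * K x (fst (S j))\<bar> \<le> (\<Sum>j\<in>I. 1)"
          by (intro order_trans[OF sum_abs] sum_mono)
        thus ?thesis unfolding f_def by (simp add: abs_mult)
      qed
      have split: "q (insert k I) (S(k := z)) = q I S + f (fst z) * residual z + residual z * residual z * K (fst z) (fst z)"
        if z: "z \<in> space D" for z
      proof -
        have upd: "(S(k := z)) j = S j" if "j \<in> I" for j using that insert.hyps by auto
        have sym: "K (fst (S j)) (fst z) = K (fst z) (fst (S j))" if "j \<in> I" for j
          using Sj[OF that] z by (auto simp: space_D kernel_eq X_memD ip_sym)
        define c where "c = (\<Sum>j\<in>I. residual z * residual (S j) * K (fst z) (fst (S j)))"
        have "q (insert k I) (S(k := z))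
            = (\<Sum>i\<in>insert k I. \<Sum>j\<in>insert k I. residual ((S(k := z)) i) * residual ((S(k := z)) j)
                * K (fst ((S(k := z)) i)) (fst ((S(k := z)) j)))"
          by (simp only: q_def)
        also have "\<dots> = (residual z * residual z * K (fst z) (fst z) + c)
            + (\<Sum>i\<in>I. residual (S i) * residual z * K (fst (S i)) (fst z)
                + (\<Sum>j\<in>I. residual (S i) * residual (S j) * K (fst (S i)) (fst (S j))))"
          unfolding c_def using insert.hyps upd by (simp del: fun_upd_apply add: fun_upd_same)
        also have "(\<Sum>i\<in>I. residual (S i) * residual z * K (fst (S i)) (fst z)
                + (\<Sum>j\<in>I. residual (S i) * residual (S j) * K (fst (S i)) (fst (S j))))
            = c + q I S"
          unfolding sum.distrib q_def c_def using sym by (simp add: mult_ac)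
        finally have "q (insert k I) (S(k := z)) = q I S + 2 * c + residual z * residual z * K (fst z) (fst z)"
          by (simp only: add_ac mult_2)
        moreover have "2 * c = f (fst z) * residual z"
          unfolding c_def f_def by (simp add: sum_distrib_left sum_distrib_right mult_ac)
        ultimately show ?thesis by (simp only:)
      qed
      have f_res_bound: "\<bar>f (fst z) * residual z\<bar> \<le> 2 * (\<Sum>j\<in>I. 1)" if z: "z \<in> space D" for z
      proof -
        have "\<bar>f (fst z)\<bar> * \<bar>residual z\<bar> \<le> 2 * (\<Sum>j\<in>I. 1) * 1"
          using f_bound[of "fst z"] residual_bound[OF z] z by (intro mult_mono) (auto simp: space_D)
        thus ?thesis by (simp add: abs_mult)
      qed
      have int: "integrable D (\<lambda>z. f (fst z) * residual z)"
        "integrable D (\<lambda>z. residual z * residual z * K (fst z) (fst z))"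
      proof -
        show "integrable D (\<lambda>z. f (fst z) * residual z)"
          by (intro integrable_bounded[OF _ f_res_bound] borel_measurable_times residual_measurable
                measurable_compose[OF fst_measurable f_meas])
        show "integrable D (\<lambda>z. residual z * residual z * K (fst z) (fst z))"
          by (intro integrable_bounded[OF _ term_bound] borel_measurable_times residual_measurable
                kernel_pair_measurable fst_measurable)
      qed
      have "(\<integral>z. q (insert k I) (S(k := z)) \<partial>D)
          = (\<integral>z. q I S + f (fst z) * residual z + residual z * residual z * K (fst z) (fst z) \<partial>D)"
        by (intro Bochner_Integration.integral_cong refl split)
      also have "\<dots> = q I S + (\<integral>z. f (fst z) * residual z \<partial>D) + (\<integral>z. residual z * residual z * K (fst z) (fst z) \<partial>D)"
        using int by (simp add: prob_space)
      finally show ?thesis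
        using integral_residual[OF f_meas f_bound] by simp
    qed
    have diag: "\<bar>\<integral>z. residual z * residual z * K (fst z) (fst z) \<partial>D\<bar> \<le> 1"
    proof -
      have "\<bar>\<integral>z. residual z * residual z * K (fst z) (fst z) \<partial>D\<bar>
          \<le> (\<integral>z. \<bar>residual z * residual z * K (fst z) (fst z)\<bar> \<partial>D)"
        by (rule integral_abs_bound)
      also have "\<dots> \<le> (\<integral>z. 1 \<partial>D)"
      proof (intro integral_mono integrable_abs)
        show "integrable D (\<lambda>z. residual z * residual z * K (fst z) (fst z))"
          by (intro integrable_bounded[OF _ term_bound] borel_measurable_times residual_measurable
                kernel_pair_measurable fst_measurable)
      qed (use term_bound in auto)
      finally show ?thesis by (simp add: prob_space)
    qed
    show "(\<integral>z. q (insert k I) (S(k := z)) \<partial>D) \<le> q I S + 1" if "S \<in> space (PiM I (\<lambda>_. D))" for S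
      using inner[OF that] diag by linarith
    show "integrable (PiM I (\<lambda>_. D)) (\<lambda>S. q I S + 1)"
      using q_int by simp
    have "integrable (PiM I (\<lambda>_. D)) (\<lambda>S. q I S + (\<integral>z. residual z * residual z * K (fst z) (fst z) \<partial>D))"
      using q_int by simp
    thus "integrable (PiM I (\<lambda>_. D)) (\<lambda>S. \<integral>z. q (insert k I) (S(k := z)) \<partial>D)"
      by (rule Bochner_Integration.integrable_cong[OF refl inner, THEN iffD2, rotated])
  qed
  also have "\<dots> = (\<integral>S. q I S \<partial>PiM I (\<lambda>_. D)) + 1"
    using q_int by (simp add: P.prob_space)
  also have "(\<integral>S. q I S \<partial>PiM I (\<lambda>_. D)) \<le> card I"
    using insert.IH unfolding q_def .
  finally show ?case
    using insert.hyps unfolding q_def by simp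
qed simp

lemma noise_vec_mem: "S \<in> space (PS m) \<Longrightarrow> noise_vec m S \<in> H"
  unfolding noise_vec_def using sample_feature by (intro lincomb_mem) auto

lemma noise_vec_norm_eq:
  assumes S: "S \<in> space (PS m)"
  shows "hnorm ip (noise_vec m S)
    = sqrt (\<Sum>i<m. \<Sum>j<m. residual (S i) * residual (S j) * K (fst (S i)) (fst (S j))) / m"
proof -
  have "ip (noise_vec m S) (noise_vec m S)
      = (\<Sum>i<m. \<Sum>j<m. (residual (S i) / m) * (residual (S j) / m) * ip (\<psi> (fst (S i))) (\<psi> (fst (S j))))"
    unfolding noise_vec_def using sample_feature[OF S] by (intro ip_lincomb_lincomb) auto
  also have "\<dots> = (\<Sum>i<m. \<Sum>j<m. residual (S i) * residual (S j) * K (fst (S i)) (fst (S j))) / m\<^sup>2"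
    unfolding sum_divide_distrib using sample_space[OF S]
    by (intro sum.cong refl) (simp add: kernel_eq power2_eq_square)
  finally show ?thesis by (simp add: hnorm_def real_sqrt_divide)
qed

text \<open>The second moment bounds the mean of the norm by \<open>1 / sqrt m\<close>. Replacing
  one sample moves the noise vector by at most \<open>2 / m\<close>, so McDiarmid's inequality
  controls the deviation.\<close>

lemma noise_bound:
  fixes m :: nat and l :: real
  assumes m: "0 < m" and l: "0 < l"
  shows "measure (PS m) {S \<in> space (PS m). 1 / sqrt m + sqrt (2 * l / m)
    < sqrt (\<Sum>i<m. \<Sum>j<m. residual (S i) * residual (S j) * K (fst (S i)) (fst (S j))) / m} \<le> exp (- l)"
proof -
  interpret P: prob_space "PS m" by (rule prob_space_PS)
  define q where "q S = (\<Sum>i<m. \<Sum>j<m. residual (S i) * residual (S j) * K (fst (S i)) (fst (S j)))"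
    for S :: "nat \<Rightarrow> (nat \<Rightarrow> real) \<times> real"
  define f where "f S = sqrt (q S) / m" for S
  have f_eq: "f S = hnorm ip (noise_vec m S)" if "S \<in> space (PS m)" for S
    using noise_vec_norm_eq[OF that] by (simp add: f_def q_def)
  have q_meas [measurable]: "q \<in> borel_measurable (PS m)"
    unfolding q_def
    by (intro borel_measurable_sum borel_measurable_times kernel_pair_measurable
          measurable_compose[OF sample_measurable residual_measurable] sample_fst_measurable) auto
  have f_meas [measurable]: "f \<in> borel_measurable (PS m)"
    unfolding f_def by measurable
  have sq: "(f S)\<^sup>2 = q S / m\<^sup>2" "0 \<le> f S" "(f S)\<^sup>2 \<le> 1" if S: "S \<in> space (PS m)" for S
  proof -
    show "0 \<le> f S" using f_eq[OF S] hnorm_nonneg[OF noise_vec_mem[OF S]] by simp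
    have "0 \<le> q S / m\<^sup>2"
      using \<open>0 \<le> f S\<close> m unfolding f_def by (simp add: zero_le_divide_iff)
    thus "(f S)\<^sup>2 = q S / m\<^sup>2"
      using m by (simp add: f_def power_divide zero_le_divide_iff)
    have "(f S)\<^sup>2 \<le> (\<Sum>i<m. (residual (S i))\<^sup>2) / m"
      unfolding f_eq[OF S] hnorm_power2[OF noise_vec_mem[OF S]] unfolding noise_vec_def
      using sample_feature[OF S] by (intro ip_lincomb_le m) auto
    also have "\<dots> \<le> (\<Sum>i<m. 1) / m"
    proof (intro divide_right_mono sum_mono)
      fix i assume "i \<in> {..<m}"
      hence "\<bar>residual (S i)\<bar> \<le> 1"
        using residual_bound[OF measurable_space[OF sample_measurable S]] by simp
      thus "(residual (S i))\<^sup>2 \<le> 1" by (simp add: abs_square_le_1)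
    qed simp
    finally show "(f S)\<^sup>2 \<le> 1" using m by simp
  qed
  have f_bound: "\<bar>f S\<bar> \<le> 1" if "S \<in> space (PS m)" for S
    using sq(3)[OF that] by (simp only: abs_square_le_1)
  have f_diff: "\<bar>f (S(i := z)) - f S\<bar> \<le> 2 / m"
    if S: "S \<in> space (PS m)" and i: "i \<in> {..<m}" and z: "z \<in> space D" for S i z
  proof -
    have S': "S(i := z) \<in> space (PS m)"
      using fun_upd_in_space_PiM[OF S z, of i] i by (simp add: insert_absorb)
    have Si: "S i \<in> space D" using measurable_space[OF sample_measurable S] i by simp
    define g where "g = (\<lambda>x. residual z / m * \<psi> (fst z) x + (- residual (S i) / m) * \<psi> (fst (S i)) x)"
    have \<psi>H: "\<psi> (fst z) \<in> H" "\<psi> (fst (S i)) \<in> H" using X_memD z Si by (auto simp: space_D)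
    have "\<bar>f (S(i := z)) - f S\<bar> \<le> hnorm ip (\<lambda>x. noise_vec m (S(i := z)) x - noise_vec m S x)"
      unfolding f_eq[OF S] f_eq[OF S'] by (intro hnorm_diff_le noise_vec_mem S S')
    also have "(\<lambda>x. noise_vec m (S(i := z)) x - noise_vec m S x) = g"
    proof
      fix x
      have "noise_vec m (S(i := z)) x - noise_vec m S x
          = (\<Sum>j<m. residual ((S(i := z)) j) / m * \<psi> (fst ((S(i := z)) j)) x - residual (S j) / m * \<psi> (fst (S j)) x)"
        by (simp only: noise_vec_def lincomb_def sum_subtractf)
      also have "\<dots> = (\<Sum>j<m. if j = i then g x else 0)"
        by (intro sum.cong refl) (auto simp: g_def left_diff_distrib diff_divide_distrib)
      also have "\<dots> = g x" using i by simp
      finally show "noise_vec m (S(i := z)) x - noise_vec m S x = g x" .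
    qed
    also have "hnorm ip g \<le> hnorm ip (\<lambda>x. residual z / m * \<psi> (fst z) x) + hnorm ip (\<lambda>x. (- residual (S i) / m) * \<psi> (fst (S i)) x)"
      unfolding g_def by (rule hnorm_add_le[OF scale_mem[OF \<psi>H(1)] scale_mem[OF \<psi>H(2)]])
    also have "\<dots> = \<bar>residual z\<bar> / m * hnorm ip (\<psi> (fst z)) + \<bar>residual (S i)\<bar> / m * hnorm ip (\<psi> (fst (S i)))"
      unfolding hnorm_scale[OF \<psi>H(1)] hnorm_scale[OF \<psi>H(2)]
      by (simp add: abs_divide abs_minus_commute)
    also have "\<dots> \<le> 1 / m * 1 + 1 / m * 1"
      using residual_bound[OF z] residual_bound[OF Si] X_memD z Si hnorm_nonneg
      by (intro add_mono mult_mono divide_right_mono) (auto simp: space_D)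
    finally show ?thesis
      by (simp only: mult_1_right add_divide_distrib[symmetric] one_add_one)
  qed
  have Ef: "P.expectation f \<le> 1 / sqrt m"
  proof -
    have fint: "integrable (PS m) f" by (intro P.integrable_bounded[OF f_meas f_bound])
    have f2int: "integrable (PS m) (\<lambda>S. (f S)\<^sup>2)"
    proof (rule P.integrable_bounded[of _ 1])
      fix S assume "S \<in> space (PS m)"
      from sq(3)[OF this] show "\<bar>(f S)\<^sup>2\<bar> \<le> 1" by (simp only: abs_power2)
    qed measurable
    \<comment> \<open>Replaces Cauchy-Schwarz: the arithmetic-geometric mean inequality, balanced
      for a second moment of \<open>1 / m\<close>.\<close>
    have "P.expectation f \<le> P.expectation (\<lambda>S. (sqrt m * (f S)\<^sup>2 + 1 / sqrt m) / 2)"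
    proof (intro integral_mono fint)
      fix S assume "S \<in> space (PS m)"
      define r where "r = sqrt (real m)"
      have r: "0 < r" using m by (simp add: r_def)
      have "0 \<le> r * (f S - 1 / r)\<^sup>2" using r by simp
      also have "\<dots> = r * (f S)\<^sup>2 + 1 / r - 2 * f S"
        using r by (simp add: power2_eq_square field_simps)
      finally show "f S \<le> (sqrt m * (f S)\<^sup>2 + 1 / sqrt m) / 2" unfolding r_def by simp
    qed (use f2int in simp)
    also have "\<dots> = (sqrt m * P.expectation (\<lambda>S. (f S)\<^sup>2) + 1 / sqrt m) / 2"
      using f2int by (simp add: P.prob_space)
    also have "P.expectation (\<lambda>S. (f S)\<^sup>2) = P.expectation q / m\<^sup>2"
    proof -
      have "P.expectation (\<lambda>S. (f S)\<^sup>2) = P.expectation (\<lambda>S. q S / m\<^sup>2)"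
        by (rule Bochner_Integration.integral_cong[OF refl sq(1)])
      thus ?thesis by simp
    qed
    also have "\<dots> \<le> 1 / m"
      using integral_noise_sq[of "{..<m}"] m unfolding q_def by (simp add: field_simps power2_eq_square)
    also have "(sqrt m * (1 / m) + 1 / sqrt m) / 2 = 1 / sqrt m"
      using m by (simp add: real_div_sqrt field_simps)
    finally show ?thesis using m by (simp add: mult_left_mono divide_right_mono)
  qed
  have "measure (PS m) {S \<in> space (PS m). P.expectation f + sqrt (2 * l / m) < f S}
      \<le> exp (- 2 * (sqrt (2 * l / m))\<^sup>2 / (card {..<m} * (2 / m)\<^sup>2))"
    using m l by (intro mcdiarmid[OF prob_space_axioms _ _ _ _ f_meas f_bound f_diff]) auto
  also have "- 2 * (sqrt (2 * l / m))\<^sup>2 / (card {..<m} * (2 / m)\<^sup>2) = - l"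
    using m l by (simp add: power2_eq_square field_simps)
  finally have "measure (PS m) {S \<in> space (PS m). P.expectation f + sqrt (2 * l / m) < f S} \<le> exp (- l)" .
  moreover have "measure (PS m) {S \<in> space (PS m). 1 / sqrt m + sqrt (2 * l / m) < f S}
      \<le> measure (PS m) {S \<in> space (PS m). P.expectation f + sqrt (2 * l / m) < f S}"
    using Ef by (intro P.finite_measure_mono) auto
  ultimately show ?thesis unfolding f_def q_def by linarith
qed

lemma xi_abs_le: "z \<in> space D \<Longrightarrow> \<bar>\<xi> (fst z)\<bar> \<le> M"
  using xi_bound[of "fst z"] X_subset by (auto simp: space_D abs_le_iff)

text \<open>McDiarmid's inequality with differences \<open>M / m\<close>; the mean is at most
  \<open>sqrt \<epsilon>\<close> by the second moment assumption.\<close>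

lemma xi_average_bound:
  fixes m :: nat and l :: real
  assumes m: "0 < m" and l: "0 < l"
  shows "measure (PS m) {S \<in> space (PS m). sqrt \<epsilon> + M * sqrt (l / m) < (\<Sum>i<m. \<bar>\<xi> (fst (S i))\<bar>) / m} \<le> exp (- l)"
proof -
  interpret P: prob_space "PS m" by (rule prob_space_PS)
  define f where "f S = (\<Sum>i<m. \<bar>\<xi> (fst (S i))\<bar>) / m" for S :: "nat \<Rightarrow> (nat \<Rightarrow> real) \<times> real"
  have comp_meas: "(\<lambda>S. \<bar>\<xi> (fst (S i))\<bar>) \<in> borel_measurable (PS m)" if "i < m" for i
    by (intro borel_measurable_abs measurable_compose[OF sample_fst_measurable[OF that] xi_measurable])
  have f_meas: "f \<in> borel_measurable (PS m)"
    unfolding f_def using comp_meas by (intro borel_measurable_divide borel_measurable_sum) auto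
  have S_space: "S i \<in> space D" if "S \<in> space (PS m)" "i < m" for S i
    using measurable_space[OF sample_measurable[OF that(2)] that(1)] .
  have f_bound: "\<bar>f S\<bar> \<le> M" if S: "S \<in> space (PS m)" for S
  proof -
    have "(\<Sum>i<m. \<bar>\<xi> (fst (S i))\<bar>) \<le> (\<Sum>i<m. M)"
      using S_space[OF S] by (intro sum_mono xi_abs_le) auto
    thus ?thesis using m by (simp add: f_def sum_nonneg field_simps)
  qed
  have f_diff: "\<bar>f (S(i := z)) - f S\<bar> \<le> M / m"
    if S: "S \<in> space (PS m)" and i: "i \<in> {..<m}" and z: "z \<in> space D" for S i z
  proof -
    have "f (S(i := z)) - f S = (\<Sum>j<m. \<bar>\<xi> (fst ((S(i := z)) j))\<bar> - \<bar>\<xi> (fst (S j))\<bar>) / m"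
      unfolding f_def by (simp only: sum_subtractf diff_divide_distrib)
    also have "(\<Sum>j<m. \<bar>\<xi> (fst ((S(i := z)) j))\<bar> - \<bar>\<xi> (fst (S j))\<bar>)
        = (\<Sum>j<m. if j = i then \<bar>\<xi> (fst z)\<bar> - \<bar>\<xi> (fst (S i))\<bar> else 0)"
      by (intro sum.cong refl) auto
    also have "\<dots> = \<bar>\<xi> (fst z)\<bar> - \<bar>\<xi> (fst (S i))\<bar>" using i by simp
    finally have eq: "f (S(i := z)) - f S = (\<bar>\<xi> (fst z)\<bar> - \<bar>\<xi> (fst (S i))\<bar>) / m" .
    have "\<bar>\<bar>\<xi> (fst z)\<bar> - \<bar>\<xi> (fst (S i))\<bar>\<bar> \<le> M"
      using xi_abs_le[OF z] xi_abs_le[OF S_space[OF S, of i]] i by auto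
    thus ?thesis unfolding eq by (simp add: divide_right_mono)
  qed
  have Ef: "P.expectation f \<le> sqrt \<epsilon>"
  proof -
    have "P.expectation f = (\<Sum>i<m. P.expectation (\<lambda>S. \<bar>\<xi> (fst (S i))\<bar>)) / m"
    proof -
      have "integrable (PS m) (\<lambda>S. \<bar>\<xi> (fst (S i))\<bar>)" if "i < m" for i
        using xi_abs_le[OF S_space[OF _ that]]
        by (intro P.integrable_bounded[OF comp_meas[OF that], of M]) simp
      thus ?thesis unfolding f_def by simp
    qed
    also have "(\<Sum>i<m. P.expectation (\<lambda>S. \<bar>\<xi> (fst (S i))\<bar>)) = (\<Sum>i<m. \<integral>z. \<bar>\<xi> (fst z)\<bar> \<partial>D)"
      by (intro sum.cong refl) (auto intro!: integral_component_PiM[OF prob_space_axioms])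
    also have "\<dots> / m = (\<integral>z. \<bar>\<xi> (fst z)\<bar> \<partial>D)" using m by simp
    finally show ?thesis using integral_abs_xi_le by simp
  qed
  have "measure (PS m) {S \<in> space (PS m). P.expectation f + M * sqrt (l / m) < f S}
      \<le> exp (- 2 * (M * sqrt (l / m))\<^sup>2 / (card {..<m} * (M / m)\<^sup>2))"
    using m l M_pos by (intro mcdiarmid[OF prob_space_axioms _ _ _ _ f_meas f_bound f_diff]) auto
  also have "- 2 * (M * sqrt (l / m))\<^sup>2 / (card {..<m} * (M / m)\<^sup>2) = - 2 * l"
    using m l M_pos by (simp add: power_mult_distrib power_divide) (simp add: power2_eq_square)
  also have "exp (- 2 * l) \<le> exp (- l)" using l by simp
  finally have "measure (PS m) {S \<in> space (PS m). P.expectation f + M * sqrt (l / m) < f S} \<le> exp (- l)" .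
  moreover have "measure (PS m) {S \<in> space (PS m). sqrt \<epsilon> + M * sqrt (l / m) < f S}
      \<le> measure (PS m) {S \<in> space (PS m). P.expectation f + M * sqrt (l / m) < f S}"
    using Ef f_meas by (intro P.finite_measure_mono) auto
  ultimately show ?thesis unfolding f_def by linarith
qed

end

section \<open>Selection on held-out data\<close>

lemma abs_diff_unit_interval: "a \<in> {0..1} \<Longrightarrow> b \<in> {0..1} \<Longrightarrow> \<bar>a - b\<bar> \<le> (1::real)"
  by auto

lemma sq_diff_unit_interval: "a \<in> {0..1} \<Longrightarrow> b \<in> {0..1} \<Longrightarrow> (a - b)\<^sup>2 \<in> {0..1::real}"
  using abs_diff_unit_interval[of a b] by (simp add: abs_square_le_1)

context alphatron_setting
begin

definition sq_err :: "((nat \<Rightarrow> real) \<Rightarrow> real) \<Rightarrow> real" where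
  "sq_err h = (\<integral>z. (h (fst z) - target (fst z))\<^sup>2 \<partial>D)"

definition regret :: "((nat \<Rightarrow> real) \<Rightarrow> real) \<Rightarrow> (nat \<Rightarrow> real) \<times> real \<Rightarrow> real" where
  "regret h z = (h (fst z) - snd z)\<^sup>2 - (target (fst z) - snd z)\<^sup>2"

text \<open>
  The variance of the regret is at most four times its mean, so its exponential moments yield a
  relative deviation bound with the rate \<open>1 / N\<close> rather than \<open>1 / sqrt N\<close>.
\<close>

lemma regret_mgf:
  assumes h [measurable]: "h \<in> borel_measurable MX" and range: "\<And>x. x \<in> X \<Longrightarrow> h x \<in> {0..1}"
    and \<sigma>: "\<bar>\<sigma>\<bar> \<le> 1"
  shows "(\<integral>z. exp (\<sigma> * regret h z) \<partial>D) \<le> exp ((\<sigma> + 4 * \<sigma>\<^sup>2) * sq_err h)"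
proof -
  define e where "e z = h (fst z) - target (fst z)" for z :: "(nat \<Rightarrow> real) \<times> real"
  have bounds: "h (fst z) \<in> {0..1}" "snd z \<in> {0..1}" "target (fst z) \<in> {0..1}" if "z \<in> space D" for z
    using range[of "fst z"] that u_range by (auto simp: space_D)
  have e_meas [measurable]: "e \<in> borel_measurable D" unfolding e_def by measurable
  have d_meas [measurable]: "regret h \<in> borel_measurable D" unfolding regret_def by measurable
  have e_bound: "\<bar>e z\<bar> \<le> 1" if "z \<in> space D" for z
    unfolding e_def by (intro abs_diff_unit_interval bounds that)
  have e2: "(e z)\<^sup>2 \<le> 1" if "z \<in> space D" for z
    using e_bound[OF that] by (simp only: abs_square_le_1)
  \<comment> \<open>The first form gives the mean, as the cross term integrates to 0. The
    factorization below it gives the bound on the square.\<close>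
  have d_eq: "regret h z = (e z)\<^sup>2 - 2 * (e z * residual z)" for z
    by (simp add: regret_def e_def power2_eq_square algebra_simps)
  have d_fact: "regret h z = e z * (h (fst z) + target (fst z) - 2 * snd z)" for z
    by (simp add: regret_def e_def power2_eq_square algebra_simps)
  have d_bound: "\<bar>regret h z\<bar> \<le> 1" if "z \<in> space D" for z
  proof -
    have "(h (fst z) - snd z)\<^sup>2 \<in> {0..1}" "(target (fst z) - snd z)\<^sup>2 \<in> {0..1}"
      by (intro sq_diff_unit_interval bounds that)+
    thus ?thesis unfolding regret_def by (rule abs_diff_unit_interval)
  qed
  have d_sq: "(regret h z)\<^sup>2 \<le> 4 * (e z)\<^sup>2" if "z \<in> space D" for z
  proof -
    have "\<bar>h (fst z) + target (fst z) - 2 * snd z\<bar> \<le> 2"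
      using bounds[OF that] u_bounds[of "ip v (\<psi> (fst z)) + \<xi> (fst z)"]
      by (auto simp: abs_le_iff simp del: u_bounds)
    hence "\<bar>h (fst z) + target (fst z) - 2 * snd z\<bar>\<^sup>2 \<le> 2\<^sup>2" by (intro power_mono) auto
    hence "(e z)\<^sup>2 * (h (fst z) + target (fst z) - 2 * snd z)\<^sup>2 \<le> (e z)\<^sup>2 * 4"
      by (intro mult_left_mono) auto
    thus ?thesis unfolding d_fact power_mult_distrib by simp
  qed
  have eint: "integrable D (\<lambda>z. (e z)\<^sup>2)"
    using e2 by (intro integrable_bounded[of _ 1]) auto
  have erint: "integrable D (\<lambda>z. e z * residual z)"
  proof (intro integrable_bounded[of _ 1])
    fix z assume z: "z \<in> space D"
    show "\<bar>e z * residual z\<bar> \<le> 1"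
      unfolding abs_mult using e_bound[OF z] residual_bound[OF z] by (intro mult_le_one) auto
  qed measurable
  have er0: "(\<integral>z. e z * residual z \<partial>D) = 0"
  proof -
    have "(\<lambda>x. h x - target x) \<in> borel_measurable MX" by measurable
    moreover have "\<bar>h x - target x\<bar> \<le> 1" if "x \<in> X" for x
      by (intro abs_diff_unit_interval range that u_range)
    ultimately show ?thesis unfolding e_def by (rule integral_residual)
  qed
  have "(\<integral>z. exp (\<sigma> * regret h z) \<partial>D) \<le> (\<integral>z. 1 + (\<sigma> + 4 * \<sigma>\<^sup>2) * (e z)\<^sup>2 - 2 * \<sigma> * (e z * residual z) \<partial>D)"
  proof (intro integral_mono)
    fix z assume z: "z \<in> space D"
    have "\<bar>\<sigma> * regret h z\<bar> \<le> 1"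
      unfolding abs_mult using \<sigma> d_bound[OF z] by (intro mult_le_one) auto
    hence "exp (\<sigma> * regret h z) \<le> 1 + \<sigma> * regret h z + \<sigma>\<^sup>2 * (regret h z)\<^sup>2"
      using exp_le_quadratic[of "\<sigma> * regret h z"] by (simp only: power_mult_distrib)
    also have "\<dots> \<le> 1 + \<sigma> * regret h z + \<sigma>\<^sup>2 * (4 * (e z)\<^sup>2)"
      using d_sq[OF z] by (intro add_left_mono mult_left_mono) auto
    also have "\<dots> = 1 + (\<sigma> + 4 * \<sigma>\<^sup>2) * (e z)\<^sup>2 - 2 * \<sigma> * (e z * residual z)"
      unfolding d_eq by (simp add: algebra_simps)
    finally show "exp (\<sigma> * regret h z) \<le> 1 + (\<sigma> + 4 * \<sigma>\<^sup>2) * (e z)\<^sup>2 - 2 * \<sigma> * (e z * residual z)" .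
  next
    show "integrable D (\<lambda>z. exp (\<sigma> * regret h z))"
    proof (intro integrable_bounded[of _ "exp 1"])
      fix z assume z: "z \<in> space D"
      have "\<bar>\<sigma> * regret h z\<bar> \<le> 1"
        unfolding abs_mult using \<sigma> d_bound[OF z] by (intro mult_le_one) auto
      thus "\<bar>exp (\<sigma> * regret h z)\<bar> \<le> exp 1" by simp
    qed measurable
  qed (use eint erint in simp)
  also have "\<dots> = 1 + (\<sigma> + 4 * \<sigma>\<^sup>2) * sq_err h"
    using eint erint er0 by (simp add: prob_space sq_err_def e_def[symmetric])
  also have "\<dots> \<le> exp ((\<sigma> + 4 * \<sigma>\<^sup>2) * sq_err h)"
    by (rule exp_ge_add_one_self)
  finally show ?thesis .
qed

lemma regret_measurable:
  assumes [measurable]: "h \<in> borel_measurable MX"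
  shows "regret h \<in> borel_measurable D"
  unfolding regret_def by measurable

text \<open>Both tails at once: positive \<sigma> bounds the empirical regret from above, negative
  \<sigma> from below.\<close>

lemma regret_tail:
  fixes N :: nat and \<theta> \<sigma> :: real
  assumes h: "h \<in> borel_measurable MX" and range: "\<And>x. x \<in> X \<Longrightarrow> h x \<in> {0..1}"
    and \<sigma>: "\<bar>\<sigma>\<bar> \<le> 1"
  shows "measure (PS N) {A \<in> space (PS N). N * ((\<sigma> + 4 * \<sigma>\<^sup>2) * sq_err h) + \<theta> < \<sigma> * (\<Sum>j<N. regret h (A j))} \<le> exp (- \<theta>)"
proof -
  interpret P: prob_space "PS N" by (rule prob_space_PS)
  interpret product_sigma_finite "\<lambda>_. D" ..
  note meas = regret_measurable[OF h]
  have int: "integrable D (\<lambda>z. exp (\<sigma> * regret h z))"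
  proof (intro integrable_bounded[of _ "exp 1"])
    fix z assume z: "z \<in> space D"
    have "(h (fst z) - snd z)\<^sup>2 \<in> {0..1}" "(target (fst z) - snd z)\<^sup>2 \<in> {0..1}"
      using z by (intro sq_diff_unit_interval range u_range; auto simp: space_D)+
    hence "\<bar>regret h z\<bar> \<le> 1" unfolding regret_def by (rule abs_diff_unit_interval)
    hence "\<bar>\<sigma> * regret h z\<bar> \<le> 1" unfolding abs_mult using \<sigma> by (intro mult_le_one) auto
    thus "\<bar>exp (\<sigma> * regret h z)\<bar> \<le> exp 1" by simp
  qed (use meas in measurable)
  have exp_eq: "exp (\<sigma> * (\<Sum>j<N. regret h (A j))) = (\<Prod>j<N. exp (\<sigma> * regret h (A j)))" for A
    by (simp add: sum_distrib_left exp_sum)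
  have "P.prob {A \<in> space (PS N). N * ((\<sigma> + 4 * \<sigma>\<^sup>2) * sq_err h) + \<theta> < \<sigma> * (\<Sum>j<N. regret h (A j))}
      \<le> exp (N * ((\<sigma> + 4 * \<sigma>\<^sup>2) * sq_err h) - (N * ((\<sigma> + 4 * \<sigma>\<^sup>2) * sq_err h) + \<theta>))"
  proof (rule P.chernoff_bound)
    show "(\<lambda>A. \<sigma> * (\<Sum>j<N. regret h (A j))) \<in> borel_measurable (PS N)"
      by (intro borel_measurable_times borel_measurable_sum borel_measurable_const
            measurable_compose[OF sample_measurable meas]) auto
    show "integrable (PS N) (\<lambda>A. exp (\<sigma> * (\<Sum>j<N. regret h (A j))))"
      unfolding exp_eq by (intro product_integrable_prod int) auto
    have "P.expectation (\<lambda>A. exp (\<sigma> * (\<Sum>j<N. regret h (A j)))) = (\<Prod>j<N. \<integral>z. exp (\<sigma> * regret h z) \<partial>D)"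
      unfolding exp_eq by (intro product_integral_prod int) auto
    also have "\<dots> \<le> (\<Prod>j<N. exp ((\<sigma> + 4 * \<sigma>\<^sup>2) * sq_err h))"
      by (intro prod_mono conjI regret_mgf h range \<sigma> Bochner_Integration.integral_nonneg) auto
    also have "\<dots> = exp (N * ((\<sigma> + 4 * \<sigma>\<^sup>2) * sq_err h))"
      by (simp add: exp_of_nat_mult)
    finally show "P.expectation (\<lambda>A. exp (\<sigma> * (\<Sum>j<N. regret h (A j)))) \<le> exp (N * ((\<sigma> + 4 * \<sigma>\<^sup>2) * sq_err h))" .
  qed
  thus ?thesis by simp
qed

text \<open>The loss of the target itself is common to all candidates, so the minimizer of the
  held-out error also minimizes the empirical regret. Lower tails are needed for all
  \<open>T\<close> candidates, but the upper tail only for \<open>t0\<close>, which is fixed before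
  the held-out sample is drawn; hence \<open>T + 1\<close>.\<close>

lemma selection_bound:
  fixes N T :: nat and \<theta> :: real and hs :: "nat \<Rightarrow> (nat \<Rightarrow> real) \<Rightarrow> real"
  assumes h: "\<And>t. hs t \<in> borel_measurable MX" and range: "\<And>t x. hs t x \<in> {0..1}"
    and N: "0 < N" and t0: "t0 \<in> {1..T}"
  shows "measure (PS N) {A \<in> space (PS N). \<exists>r. is_arg_min (\<lambda>t. \<Sum>j<N. (hs t (fst (A j)) - snd (A j))\<^sup>2) (\<lambda>t. t \<in> {1..T}) r
      \<and> 3 * sq_err (hs t0) + 32 * \<theta> / N < sq_err (hs r)} \<le> (T + 1) * exp (- \<theta>)"
proof -
  interpret P: prob_space "PS N" by (rule prob_space_PS)
  define bad where "bad \<sigma> t = {A \<in> space (PS N). N * ((\<sigma> + 4 * \<sigma>\<^sup>2) * sq_err (hs t)) + \<theta>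
      < \<sigma> * (\<Sum>j<N. regret (hs t) (A j))}" for \<sigma> t
  have bad_sets: "bad \<sigma> t \<in> sets (PS N)" for \<sigma> t
  proof -
    have [measurable]: "(\<lambda>A. \<Sum>j<N. regret (hs t) (A j)) \<in> borel_measurable (PS N)"
      by (intro borel_measurable_sum measurable_compose[OF sample_measurable regret_measurable] h) auto
    show ?thesis unfolding bad_def by measurable
  qed
  have bad_prob: "P.prob (bad \<sigma> t) \<le> exp (- \<theta>)" if "\<bar>\<sigma>\<bar> \<le> 1" for \<sigma> t
    unfolding bad_def by (intro regret_tail h range that)
  define low where "low = (\<Union>t\<in>{1..T}. bad (- 1 / 8) t)"
  have low_sets: "low \<in> sets (PS N)" unfolding low_def by (intro sets.finite_UN bad_sets) auto
  have "{A \<in> space (PS N). \<exists>r. is_arg_min (\<lambda>t. \<Sum>j<N. (hs t (fst (A j)) - snd (A j))\<^sup>2) (\<lambda>t. t \<in> {1..T}) r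
      \<and> 3 * sq_err (hs t0) + 32 * \<theta> / N < sq_err (hs r)} \<subseteq> low \<union> bad (1 / 8) t0"
  proof (rule subsetI, rule ccontr)
    fix A assume "A \<in> {A \<in> space (PS N). \<exists>r. is_arg_min (\<lambda>t. \<Sum>j<N. (hs t (fst (A j)) - snd (A j))\<^sup>2) (\<lambda>t. t \<in> {1..T}) r
      \<and> 3 * sq_err (hs t0) + 32 * \<theta> / N < sq_err (hs r)}"
    then obtain r where A: "A \<in> space (PS N)"
      and r: "is_arg_min (\<lambda>t. \<Sum>j<N. (hs t (fst (A j)) - snd (A j))\<^sup>2) (\<lambda>t. t \<in> {1..T}) r"
      and gt: "3 * sq_err (hs t0) + 32 * \<theta> / N < sq_err (hs r)" by auto
    assume not_bad: "A \<notin> low \<union> bad (1 / 8) t0"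
    have rT: "r \<in> {1..T}" and min: "\<not> (\<Sum>j<N. (hs t0 (fst (A j)) - snd (A j))\<^sup>2) < (\<Sum>j<N. (hs r (fst (A j)) - snd (A j))\<^sup>2)"
      using r t0 by (auto simp: is_arg_min_def)
    have le: "(\<Sum>j<N. regret (hs r) (A j)) \<le> (\<Sum>j<N. regret (hs t0) (A j))"
      using min unfolding regret_def by (simp add: sum_subtractf)
    have "A \<notin> bad (- 1 / 8) r" "A \<notin> bad (1 / 8) t0"
      using not_bad rT by (auto simp: low_def)
    \<comment> \<open>At \<sigma> = -1/8 and 1/8 the factor
      \<open>\<sigma> + 4 * \<sigma>\<^sup>2\<close> is -1/16 and 3/16. The ratio gives the constant
      3, and clearing 1/16 turns the two copies of \<theta> into 32.\<close>
    hence "- 1 / 8 * (\<Sum>j<N. regret (hs r) (A j)) \<le> N * ((- 1 / 8 + 4 * (- 1 / 8)\<^sup>2) * sq_err (hs r)) + \<theta>"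
          "1 / 8 * (\<Sum>j<N. regret (hs t0) (A j)) \<le> N * ((1 / 8 + 4 * (1 / 8)\<^sup>2) * sq_err (hs t0)) + \<theta>"
      using A by (auto simp: bad_def not_less)
    hence "N * sq_err (hs r) \<le> 3 * (N * sq_err (hs t0)) + 32 * \<theta>"
      using le by (simp add: power2_eq_square algebra_simps)
    hence "sq_err (hs r) \<le> 3 * sq_err (hs t0) + 32 * \<theta> / N"
      using N by (simp add: field_simps)
    thus False using gt by simp
  qed
  hence "P.prob {A \<in> space (PS N). \<exists>r. is_arg_min (\<lambda>t. \<Sum>j<N. (hs t (fst (A j)) - snd (A j))\<^sup>2) (\<lambda>t. t \<in> {1..T}) r
      \<and> 3 * sq_err (hs t0) + 32 * \<theta> / N < sq_err (hs r)} \<le> P.prob (low \<union> bad (1 / 8) t0)"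
    by (intro P.finite_measure_mono sets.Un low_sets bad_sets)
  also have "\<dots> \<le> P.prob low + P.prob (bad (1 / 8) t0)"
    by (intro measure_Un_le low_sets bad_sets)
  also have "P.prob low \<le> (\<Sum>t\<in>{1..T}. P.prob (bad (- 1 / 8) t))"
    unfolding low_def using bad_sets by (intro P.finite_measure_subadditive_finite) auto
  also have "\<dots> \<le> (\<Sum>t\<in>{1..T}. exp (- \<theta>))"
    by (intro sum_mono bad_prob) auto
  also have "P.prob (bad (1 / 8) t0) \<le> exp (- \<theta>)"
    by (intro bad_prob) auto
  finally show ?thesis by (simp add: algebra_simps)
qed

end

section \<open>Probability of success\<close>

text \<open>A union bound by Fubini: \<open>F\<close> collects the bad training samples, and for
  each other one the held-out sample fails with probability at most \<open>b\<close>. This lets the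
  selection argument treat the hypotheses as fixed.\<close>

lemma pair_prob_ge:
  assumes P: "prob_space P" and Q: "prob_space Q" and E: "E \<in> sets (P \<Otimes>\<^sub>M Q)"
    and F: "F \<in> sets P" and a: "measure P F \<le> a" and b: "0 \<le> b"
    and section_bound: "\<And>x. x \<in> space P \<Longrightarrow> x \<notin> F \<Longrightarrow> measure Q {y \<in> space Q. (x, y) \<notin> E} \<le> b"
  shows "1 - (a + b) \<le> measure (P \<Otimes>\<^sub>M Q) E"
proof -
  interpret P: prob_space P by fact
  interpret Q: prob_space Q by fact
  interpret PQ: pair_prob_space P Q ..
  have a0: "0 \<le> a" using a measure_nonneg[of P F] by linarith
  define G where "G = space (P \<Otimes>\<^sub>M Q) - E"
  have G: "G \<in> sets (P \<Otimes>\<^sub>M Q)" unfolding G_def using E by auto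
  have "emeasure (P \<Otimes>\<^sub>M Q) G = (\<integral>\<^sup>+ x. emeasure Q (Pair x -` G) \<partial>P)"
    by (rule Q.emeasure_pair_measure_alt[OF G])
  also have "\<dots> \<le> (\<integral>\<^sup>+ x. indicator F x + ennreal b \<partial>P)"
  proof (rule nn_integral_mono)
    fix x assume x: "x \<in> space P"
    show "emeasure Q (Pair x -` G) \<le> indicator F x + ennreal b"
    proof (cases "x \<in> F")
      case True
      have "emeasure Q (Pair x -` G) \<le> 1" by (rule Q.emeasure_le_1)
      also have "1 \<le> indicator F x + ennreal b" using True by simp
      finally show ?thesis .
    next
      case False
      have "Pair x -` G = {y \<in> space Q. (x, y) \<notin> E}"
        using x by (auto simp: G_def space_pair_measure)
      thus ?thesis
        using section_bound[OF x False] False by (simp add: Q.emeasure_eq_measure ennreal_leI)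
    qed
  qed
  also have "\<dots> = emeasure P F + ennreal b"
    using F by (simp add: nn_integral_add P.emeasure_space_1)
  also have "\<dots> \<le> ennreal a + ennreal b"
    using a by (intro add_right_mono) (simp add: P.emeasure_eq_measure ennreal_leI)
  also have "\<dots> = ennreal (a + b)"
    using a0 b by simp
  finally have "PQ.prob G \<le> a + b"
    unfolding PQ.emeasure_eq_measure by (subst (asm) ennreal_le_iff) (use a0 b in auto)
  thus ?thesis
    unfolding G_def using PQ.prob_compl[OF E] by simp
qed

context alphatron_setting
begin

section \<open>The success event and its probability\<close>

lemma excess_err_hyp:
  "S \<in> space (PS m) \<Longrightarrow> excess_err MX D (hyp m S t) = sq_err (hyp m S t)"
  unfolding sq_err_def by (intro excess_err_eq hyp_measurable1)

lemma sq_err_hyp_measurable: "(\<lambda>S. sq_err (hyp m S t)) \<in> borel_measurable (PS m)"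
  unfolding sq_err_def
proof (rule borel_measurable_lebesgue_integral)
  have [measurable]: "(\<lambda>p. hyp m (fst p) t (fst (snd p))) \<in> borel_measurable (PS m \<Otimes>\<^sub>M D)"
    by (intro hyp_measurable) auto
  have [measurable]: "(\<lambda>p. target (fst (snd p))) \<in> borel_measurable (PS m \<Otimes>\<^sub>M D)"
    by measurable
  show "(\<lambda>(S, z). (hyp m S t (fst z) - target (fst z))\<^sup>2) \<in> borel_measurable (PS m \<Otimes>\<^sub>M D)"
    unfolding split_beta by measurable
qed

abbreviation heldout_err where
  "heldout_err m N S A t \<equiv> (\<Sum>j<N. (hyp m S t (fst (A j)) - snd (A j))\<^sup>2)"

definition success :: "nat \<Rightarrow> nat \<Rightarrow> nat \<Rightarrow> real \<Rightarrow> ((nat \<Rightarrow> (nat \<Rightarrow> real) \<times> real) \<times> (nat \<Rightarrow> (nat \<Rightarrow> real) \<times> real)) set" where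
  "success T m N b = {(S, A) \<in> space (PS m \<Otimes>\<^sub>M PS N).
    \<forall>h. alphatron_output u K (1 / L) T m N S A h \<longrightarrow> excess_err MX D h \<le> b}"

text \<open>The quantifier over all functions \<open>h\<close> becomes one over finitely many
  iteration numbers, which makes the event measurable.\<close>

lemma success_eq:
  "success T m N b = {p \<in> space (PS m \<Otimes>\<^sub>M PS N). \<forall>r\<in>{1..T}.
    (\<forall>t\<in>{1..T}. \<not> heldout_err m N (fst p) (snd p) t < heldout_err m N (fst p) (snd p) r)
    \<longrightarrow> sq_err (hyp m (fst p) r) \<le> b}"
proof -
  have output_iff: "alphatron_output u K (1 / L) T m N S A h \<longleftrightarrow> (\<exists>r\<in>{1..T}.
      (\<forall>t\<in>{1..T}. \<not> heldout_err m N S A t < heldout_err m N S A r) \<and> h = hyp m S r)" for S A h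
    unfolding alphatron_output_def is_arg_min_def by blast
  have "(\<forall>h. alphatron_output u K (1 / L) T m N S A h \<longrightarrow> excess_err MX D h \<le> b) \<longleftrightarrow> (\<forall>r\<in>{1..T}.
      (\<forall>t\<in>{1..T}. \<not> heldout_err m N S A t < heldout_err m N S A r) \<longrightarrow> sq_err (hyp m S r) \<le> b)"
    if "S \<in> space (PS m)" for S A
    unfolding output_iff excess_err_hyp[OF that, symmetric] by blast
  note eq = this
  show ?thesis
    unfolding success_def
  proof (rule Collect_cong)
    fix p :: "(nat \<Rightarrow> (nat \<Rightarrow> real) \<times> real) \<times> (nat \<Rightarrow> (nat \<Rightarrow> real) \<times> real)"
    obtain S A where [simp]: "p = (S, A)" by (cases p)
    show "(case p of (S, A) \<Rightarrow> (S, A) \<in> space (PS m \<Otimes>\<^sub>M PS N) \<and>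
        (\<forall>h. alphatron_output u K (1 / L) T m N S A h \<longrightarrow> excess_err MX D h \<le> b)) \<longleftrightarrow>
      p \<in> space (PS m \<Otimes>\<^sub>M PS N) \<and> (\<forall>r\<in>{1..T}.
        (\<forall>t\<in>{1..T}. \<not> heldout_err m N (fst p) (snd p) t < heldout_err m N (fst p) (snd p) r)
        \<longrightarrow> sq_err (hyp m (fst p) r) \<le> b)"
      using eq[of S A] by (auto simp only: space_pair_measure mem_Times_iff split_conv fst_conv snd_conv \<open>p = (S, A)\<close>)
  qed
qed

lemma success_sets: "success T m N b \<in> sets (PS m \<Otimes>\<^sub>M PS N)"
proof -
  have [measurable]: "(\<lambda>p. heldout_err m N (fst p) (snd p) t) \<in> borel_measurable (PS m \<Otimes>\<^sub>M PS N)" for t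
  proof (intro borel_measurable_sum borel_measurable_power borel_measurable_diff)
    fix j assume "j \<in> {..<N}"
    hence j: "j < N" by simp
    show "(\<lambda>p. hyp m (fst p) t (fst (snd p j))) \<in> borel_measurable (PS m \<Otimes>\<^sub>M PS N)"
      by (intro hyp_measurable measurable_fst measurable_compose[OF measurable_snd sample_fst_measurable[OF j]])
    show "(\<lambda>p. snd (snd p j)) \<in> borel_measurable (PS m \<Otimes>\<^sub>M PS N)"
      by (rule measurable_compose[OF measurable_snd sample_snd_measurable[OF j]])
  qed
  have [measurable]: "(\<lambda>p. sq_err (hyp m (fst p) t)) \<in> borel_measurable (PS m \<Otimes>\<^sub>M PS N)" for t
    by (rule measurable_compose[OF measurable_fst sq_err_hyp_measurable])
  show ?thesis unfolding success_eq by measurable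
qed

text \<open>The deterministic core, for a sample with small noise, small average of
  \<bar>\<xi>\<bar> and small generalization gaps. The constants accumulate factors of 2: one from
  descent, one for passing to the noiseless target on the sample, and one for passing back to the
  true target in the population.\<close>

lemma good_sample:
  fixes m T :: nat and l \<eta> \<kappa> :: real
  assumes m: "0 < m" and S: "S \<in> space (PS m)"
    and \<kappa>: "0 < \<kappa>" and T: "B\<^sup>2 * L\<^sup>2 \<le> T * \<kappa>" "1 \<le> T"
    and noise: "hnorm ip (noise_vec m S) \<le> \<eta>"
    and \<rho>: "(\<Sum>i<m. \<bar>\<xi> (fst (S i))\<bar>) / m \<le> \<rho>"
    and gap: "\<And>t. t \<in> {1..T} \<Longrightarrow> (\<integral>z. cut_loss m t S z \<partial>D) - (\<Sum>i<m. cut_loss m t S (S i)) / m \<le> \<gamma>"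
  shows "\<exists>t\<in>{1..T}. sq_err (hyp m S t)
    \<le> 24 * \<eta>\<^sup>2 + 20 * L * \<rho> + 16 * L * \<eta> * B + 8 * \<kappa> + 2 * \<gamma> + 2 * L * sqrt \<epsilon>"
proof -
  note sp = sample_space[OF S]
  define r where "r = (\<Sum>i<m. \<bar>\<xi> (fst (S i))\<bar>) / m"
  have r: "r \<le> \<rho>" using \<rho> by (simp add: r_def)
  define g where "g i = u (ip v (\<psi> (fst (S i))) + \<xi> (fst (S i)))" for i
  define h where "h t i = u (ip (iterate m S t) (\<psi> (fst (S i))))" for t i
  have h_eq: "h t i = hyp m S t (fst (S i))" if "i < m" for t i
    unfolding h_def using hyp_eq[OF S] sp that by simp
  have "\<exists>t\<in>{1..T}. hnorm ip (\<lambda>z. iterate m S t z - v z) \<le> B \<and>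
    (\<Sum>i<m. (g i - h t i)\<^sup>2) / m \<le> 2 * (3 * \<eta>\<^sup>2 + 2 * L * ((\<Sum>i<m. \<bar>\<xi> (fst (S i))\<bar>) / m) + 2 * L * \<eta> * B + \<kappa>)"
  proof (rule descent_reaches_small_error[where u = u and y = "\<lambda>i. snd (S i)" and p = "\<lambda>i. \<psi> (fst (S i))"
        and g = g and h = h and \<zeta> = "\<lambda>i. \<xi> (fst (S i))" and w = "iterate m S"])
    show "hnorm ip (lincomb {..<m} (\<lambda>i. (snd (S i) - g i) / m) (\<lambda>i. \<psi> (fst (S i)))) \<le> \<eta>"
      using noise unfolding noise_vec_def g_def .
    fix t :: nat assume t: "1 \<le> t"
    have "lincomb {..<m} (\<lambda>i. (snd (S i) - h t i) / m) (\<lambda>i. \<psi> (fst (S i)))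
      = lincomb {..<m} (\<lambda>i. (snd (S i) - hyp m S t (fst (S i))) / m) (\<lambda>i. \<psi> (fst (S i)))"
      unfolding lincomb_def by (intro ext sum.cong refl) (simp add: h_eq)
    thus "iterate m S (Suc t) = (\<lambda>z. iterate m S t z
        + 1 / L * lincomb {..<m} (\<lambda>i. (snd (S i) - h t i) / m) (\<lambda>i. \<psi> (fst (S i))) z)"
      using iterate_Suc[OF t, of m S] by simp
  qed (fact v_mem iterate_mem[OF S] m sample_feature[OF S] L_pos u_range u_mono u_lipschitz
        g_def h_def start_dist \<kappa> T)+
  then obtain t where t: "t \<in> {1..T}" and near: "hnorm ip (\<lambda>z. iterate m S t z - v z) \<le> B"
    and e: "(\<Sum>i<m. (g i - h t i)\<^sup>2) / m \<le> 2 * (3 * \<eta>\<^sup>2 + 2 * L * r + 2 * L * \<eta> * B + \<kappa>)"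
    unfolding r_def by blast
  have cut: "cut_loss m t S z = (hyp m S t (fst z) - noiseless (fst z))\<^sup>2" for z
    using near near_iff[OF S] by (simp add: cut_loss_def)
  have "(\<Sum>i<m. cut_loss m t S (S i)) \<le> (\<Sum>i<m. 2 * (g i - h t i)\<^sup>2 + 2 * L * \<bar>\<xi> (fst (S i))\<bar>)"
  proof (rule sum_mono)
    fix i assume "i \<in> {..<m}"
    hence i: "i < m" by simp
    define a b where "a = g i - h t i" "b = noiseless (fst (S i)) - target (fst (S i))"
    have "0 \<le> (a - b)\<^sup>2" by simp
    hence "(a + b)\<^sup>2 \<le> 2 * a\<^sup>2 + 2 * b\<^sup>2" by (simp add: power2_sum power2_diff)
    moreover have "b\<^sup>2 \<le> L * \<bar>\<xi> (fst (S i))\<bar>"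
      unfolding a_b_def using sp[OF i] by (intro target_noiseless_le) auto
    moreover have "cut_loss m t S (S i) = (a + b)\<^sup>2"
      unfolding cut a_b_def g_def h_eq[OF i] by (simp add: power2_commute)
    ultimately show "cut_loss m t S (S i) \<le> 2 * (g i - h t i)\<^sup>2 + 2 * L * \<bar>\<xi> (fst (S i))\<bar>"
      by (simp add: a_b_def)
  qed
  hence "(\<Sum>i<m. cut_loss m t S (S i)) / m \<le> (\<Sum>i<m. 2 * (g i - h t i)\<^sup>2 + 2 * L * \<bar>\<xi> (fst (S i))\<bar>) / m"
    by (rule divide_right_mono) simp
  also have "\<dots> = 2 * ((\<Sum>i<m. (g i - h t i)\<^sup>2) / m) + 2 * L * r"
    by (simp add: r_def sum.distrib sum_distrib_left[symmetric] add_divide_distrib)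
  finally have emp: "(\<Sum>i<m. cut_loss m t S (S i)) / m \<le> 2 * ((\<Sum>i<m. (g i - h t i)\<^sup>2) / m) + 2 * L * r" .
  have "sq_err (hyp m S t) \<le> 2 * (\<integral>z. cut_loss m t S z \<partial>D) + 2 * L * sqrt \<epsilon>"
    unfolding cut excess_err_hyp[OF S, symmetric]
    by (intro excess_err_le_noiseless hyp_measurable1[OF S] hyp_range)
  also have "\<dots> \<le> 2 * (2 * (2 * (3 * \<eta>\<^sup>2 + 2 * L * r + 2 * L * \<eta> * B + \<kappa>)) + 2 * L * r + \<gamma>) + 2 * L * sqrt \<epsilon>"
    using gap[OF t] emp e by simp
  also have "\<dots> = 24 * \<eta>\<^sup>2 + 20 * (L * r) + 16 * L * \<eta> * B + 8 * \<kappa> + 2 * \<gamma> + 2 * L * sqrt \<epsilon>"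
    by (simp add: algebra_simps)
  also have "\<dots> \<le> 24 * \<eta>\<^sup>2 + 20 * (L * \<rho>) + 16 * L * \<eta> * B + 8 * \<kappa> + 2 * \<gamma> + 2 * L * sqrt \<epsilon>"
    using mult_left_mono[OF r, of L] L_pos by simp
  finally show ?thesis using t by (intro bexI[of _ t]) (simp_all add: mult.assoc)
qed

text \<open>\<open>F1\<close>, \<open>F2\<close> and \<open>F3\<close> are the failures of the noise
  bound, of the \<xi> average and of generalization. Each costs \<open>exp (- l)\<close>, and
  selection costs the rest.\<close>

lemma success_prob:
  fixes m N T :: nat and l \<theta> \<kappa> b :: real
  assumes m: "0 < m" and N: "0 < N" and \<kappa>: "0 < \<kappa>" and T: "B\<^sup>2 * L\<^sup>2 \<le> T * \<kappa>" "1 \<le> T" and l: "0 < l"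
    and b: "3 * (24 * (1 / sqrt m + sqrt (2 * l / m))\<^sup>2 + 20 * L * (min M (sqrt \<epsilon> + M * sqrt (l / m)))
        + 16 * L * (1 / sqrt m + sqrt (2 * l / m)) * B + 8 * \<kappa>
        + 2 * ((4 * L * B + 2 * L * B * sqrt l) / sqrt m) + 2 * L * sqrt \<epsilon>) + 32 * \<theta> / N \<le> b"
  shows "1 - (3 * exp (- l) + (T + 1) * exp (- \<theta>)) \<le> measure (PS m \<Otimes>\<^sub>M PS N) (success T m N b)"
proof -
  interpret P: prob_space "PS m" by (rule prob_space_PS)
  define \<eta> where "\<eta> = 1 / sqrt m + sqrt (2 * l / m)"
  define F1 where "F1 = {S \<in> space (PS m). 1 / sqrt m + sqrt (2 * l / m)
    < sqrt (\<Sum>i<m. \<Sum>j<m. residual (S i) * residual (S j) * K (fst (S i)) (fst (S j))) / m}"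
  define F2 where "F2 = {S \<in> space (PS m). sqrt \<epsilon> + M * sqrt (l / m) < (\<Sum>i<m. \<bar>\<xi> (fst (S i))\<bar>) / m}"
  define F3 where "F3 = {S \<in> space (PS m). \<exists>t\<in>{1..T}. (4 * L * B + 2 * L * B * sqrt l) / sqrt m
      < (\<integral>z. cut_loss m t S z \<partial>D) - (\<Sum>i<m. cut_loss m t S (S i)) / m}"
  have F1: "F1 \<in> sets (PS m)"
  proof -
    have [measurable]: "(\<lambda>S. \<Sum>i<m. \<Sum>j<m. residual (S i) * residual (S j) * K (fst (S i)) (fst (S j))) \<in> borel_measurable (PS m)"
      by (intro borel_measurable_sum borel_measurable_times kernel_pair_measurable
          measurable_compose[OF sample_measurable residual_measurable] sample_fst_measurable) auto
    show ?thesis unfolding F1_def by measurable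
  qed
  have F2: "F2 \<in> sets (PS m)"
  proof -
    have [measurable]: "(\<lambda>S. \<Sum>i<m. \<bar>\<xi> (fst (S i))\<bar>) \<in> borel_measurable (PS m)"
      by (intro borel_measurable_sum borel_measurable_abs measurable_compose[OF sample_fst_measurable xi_measurable]) auto
    show ?thesis unfolding F2_def by measurable
  qed
  have F3: "F3 \<in> sets (PS m)"
  proof -
    have [measurable]: "(\<lambda>S. \<integral>z. cut_loss m t S z \<partial>D) \<in> borel_measurable (PS m)" for t
      by (intro borel_measurable_lebesgue_integral cut_loss_measurable)
    have [measurable]: "(\<lambda>S. \<Sum>i<m. cut_loss m t S (S i)) \<in> borel_measurable (PS m)" for t
    proof (rule borel_measurable_sum)
      fix i assume "i \<in> {..<m}"
      hence "(\<lambda>S. (S, S i)) \<in> PS m \<rightarrow>\<^sub>M PS m \<Otimes>\<^sub>M D"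
        by (intro measurable_Pair measurable_ident) auto
      from measurable_compose[OF this cut_loss_measurable[of m t]]
      show "(\<lambda>S. cut_loss m t S (S i)) \<in> borel_measurable (PS m)" by simp
    qed
    show ?thesis unfolding F3_def by measurable
  qed
  show ?thesis
  proof (rule pair_prob_ge[where F = "F1 \<union> F2 \<union> F3"])
    have "P.prob (F1 \<union> F2 \<union> F3) \<le> P.prob F1 + P.prob F2 + P.prob F3"
      using measure_Un_le[of "F1 \<union> F2" "PS m" F3] measure_Un_le[of F1 "PS m" F2] F1 F2 F3 by simp
    also have "\<dots> \<le> exp (- l) + exp (- l) + exp (- l)"
      unfolding F1_def F2_def F3_def
      by (intro add_mono noise_bound xi_average_bound cut_loss_generalizes m l T(2))
    finally show "P.prob (F1 \<union> F2 \<union> F3) \<le> 3 * exp (- l)" by simp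
    fix S assume S: "S \<in> space (PS m)" "S \<notin> F1 \<union> F2 \<union> F3"
    \<comment> \<open>This trivial bound is kept beside the concentration bound because the
      fourth-root rate needs it when \<open>sqrt (l / m)\<close> is large.\<close>
    have xi_le_M: "(\<Sum>i<m. \<bar>\<xi> (fst (S i))\<bar>) / m \<le> M"
    proof -
      have "(\<Sum>i<m. \<bar>\<xi> (fst (S i))\<bar>) \<le> (\<Sum>i<m. M)"
        using measurable_space[OF sample_measurable S(1)] by (intro sum_mono xi_abs_le) auto
      thus ?thesis using m by (simp add: field_simps)
    qed
    have "\<exists>t\<in>{1..T}. sq_err (hyp m S t)
      \<le> 24 * \<eta>\<^sup>2 + 20 * L * min M (sqrt \<epsilon> + M * sqrt (l / m)) + 16 * L * \<eta> * B + 8 * \<kappa>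
        + 2 * ((4 * L * B + 2 * L * B * sqrt l) / sqrt m) + 2 * L * sqrt \<epsilon>"
    proof (rule good_sample[OF m S(1) \<kappa> T])
      show "hnorm ip (noise_vec m S) \<le> \<eta>"
        using S unfolding \<eta>_def by (auto simp: F1_def noise_vec_norm_eq)
      show "(\<Sum>i<m. \<bar>\<xi> (fst (S i))\<bar>) / m \<le> min M (sqrt \<epsilon> + M * sqrt (l / m))"
        using S xi_le_M by (auto simp: F2_def)
      show "(\<integral>z. cut_loss m t S z \<partial>D) - (\<Sum>i<m. cut_loss m t S (S i)) / m
          \<le> (4 * L * B + 2 * L * B * sqrt l) / sqrt m" if "t \<in> {1..T}" for t
        using S that by (auto simp: F3_def not_less)
    qed
    then obtain t0 where t0: "t0 \<in> {1..T}" and "sq_err (hyp m S t0)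
      \<le> 24 * \<eta>\<^sup>2 + 20 * L * min M (sqrt \<epsilon> + M * sqrt (l / m)) + 16 * L * \<eta> * B + 8 * \<kappa>
        + 2 * ((4 * L * B + 2 * L * B * sqrt l) / sqrt m) + 2 * L * sqrt \<epsilon>" by blast
    hence "3 * sq_err (hyp m S t0) + 32 * \<theta> / N \<le> 3 * (24 * \<eta>\<^sup>2 + 20 * L * min M (sqrt \<epsilon> + M * sqrt (l / m))
        + 16 * L * \<eta> * B + 8 * \<kappa> + 2 * ((4 * L * B + 2 * L * B * sqrt l) / sqrt m) + 2 * L * sqrt \<epsilon>) + 32 * \<theta> / N"
      by (intro add_right_mono mult_left_mono) auto
    also have "\<dots> \<le> b" using b unfolding \<eta>_def .
    finally have err0: "3 * sq_err (hyp m S t0) + 32 * \<theta> / N \<le> b" .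
    interpret Q: prob_space "PS N" by (rule prob_space_PS)
    have "Q.prob {A \<in> space (PS N). (S, A) \<notin> success T m N b}
      \<le> Q.prob {A \<in> space (PS N). \<exists>r. is_arg_min (\<lambda>t. heldout_err m N S A t) (\<lambda>t. t \<in> {1..T}) r
          \<and> 3 * sq_err (hyp m S t0) + 32 * \<theta> / N < sq_err (hyp m S r)}"
    proof (rule Q.finite_measure_mono)
      show "{A \<in> space (PS N). (S, A) \<notin> success T m N b}
        \<subseteq> {A \<in> space (PS N). \<exists>r. is_arg_min (\<lambda>t. heldout_err m N S A t) (\<lambda>t. t \<in> {1..T}) r
          \<and> 3 * sq_err (hyp m S t0) + 32 * \<theta> / N < sq_err (hyp m S r)}"
      proof safe
        fix A assume A: "A \<in> space (PS N)" and "(S, A) \<notin> success T m N b"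
        then obtain r where "r \<in> {1..T}" "\<forall>t\<in>{1..T}. \<not> heldout_err m N S A t < heldout_err m N S A r"
          and "b < sq_err (hyp m S r)"
          using S(1) unfolding success_eq by (auto simp: space_pair_measure not_le)
        thus "\<exists>r. is_arg_min (\<lambda>t. heldout_err m N S A t) (\<lambda>t. t \<in> {1..T}) r
          \<and> 3 * sq_err (hyp m S t0) + 32 * \<theta> / N < sq_err (hyp m S r)"
          using err0 unfolding is_arg_min_def by (intro exI[of _ r]) auto
      qed
      have [measurable]: "(\<lambda>A. heldout_err m N S A t) \<in> borel_measurable (PS N)" for t
        by (intro borel_measurable_sum borel_measurable_power borel_measurable_diff
              measurable_compose[OF sample_fst_measurable hyp_measurable1[OF S(1)]] sample_snd_measurable) auto
      have eq: "{A \<in> space (PS N). \<exists>r. is_arg_min (\<lambda>t. heldout_err m N S A t) (\<lambda>t. t \<in> {1..T}) r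
          \<and> 3 * sq_err (hyp m S t0) + 32 * \<theta> / N < sq_err (hyp m S r)}
        = {A \<in> space (PS N). \<exists>r\<in>{1..T}. (\<forall>t\<in>{1..T}. \<not> heldout_err m N S A t < heldout_err m N S A r)
          \<and> 3 * sq_err (hyp m S t0) + 32 * \<theta> / N < sq_err (hyp m S r)}"
        unfolding is_arg_min_def by blast
      show "{A \<in> space (PS N). \<exists>r. is_arg_min (\<lambda>t. heldout_err m N S A t) (\<lambda>t. t \<in> {1..T}) r
          \<and> 3 * sq_err (hyp m S t0) + 32 * \<theta> / N < sq_err (hyp m S r)} \<in> sets (PS N)"
        unfolding eq by measurable
    qed
    also have "\<dots> \<le> (T + 1) * exp (- \<theta>)"
      by (intro selection_bound hyp_measurable1[OF S(1)] hyp_range N t0)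
    finally show "Q.prob {A \<in> space (PS N). (S, A) \<notin> success T m N b} \<le> (T + 1) * exp (- \<theta>)" .
  qed (use F1 F2 F3 in \<open>auto intro: prob_space_PS success_sets\<close>)
qed

text \<open>All coefficients of the first hypothesis are 0, so it is the constant \<open>u 0\<close>
  and differs from the noiseless target by at most \<open>L * B\<close>. The bound holds for every
  sample, without any probability.\<close>

lemma success_single_iteration:
  assumes b: "2 * (L * B)\<^sup>2 + 2 * L * sqrt \<epsilon> \<le> b"
  shows "success 1 m N b = space (PS m \<Otimes>\<^sub>M PS N)"
proof -
  have "sq_err (hyp m S 1) \<le> b" if S: "S \<in> space (PS m)" for S
  proof -
    have "(hyp m S 1 (fst z) - noiseless (fst z))\<^sup>2 \<le> (L * B)\<^sup>2" if z: "z \<in> space D" for z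
    proof -
      have x: "fst z \<in> X" using z by (auto simp: space_D)
      have "hyp m S 1 (fst z) = u 0" by (simp add: alphatron_hyp_def kernel_hyp_def)
      hence "\<bar>hyp m S 1 (fst z) - noiseless (fst z)\<bar> \<le> L * \<bar>ip v (\<psi> (fst z))\<bar>"
        using u_lip[of 0 "ip v (\<psi> (fst z))"] by simp
      also have "\<dots> \<le> L * (B * 1)"
      proof (rule mult_left_mono)
        have "\<bar>ip v (\<psi> (fst z))\<bar> \<le> hnorm ip v * hnorm ip (\<psi> (fst z))"
          using X_memD[OF x] by (intro cauchy_schwarz v_mem) auto
        also have "\<dots> \<le> B * 1"
          using X_memD[OF x] v_norm B_pos hnorm_nonneg by (intro mult_mono) auto
        finally show "\<bar>ip v (\<psi> (fst z))\<bar> \<le> B * 1" .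
      qed (use L_pos in simp)
      finally have "\<bar>hyp m S 1 (fst z) - noiseless (fst z)\<bar>\<^sup>2 \<le> (L * B)\<^sup>2"
        by (intro power_mono) auto
      thus ?thesis by simp
    qed
    hence "(\<integral>z. (hyp m S 1 (fst z) - noiseless (fst z))\<^sup>2 \<partial>D) \<le> (\<integral>z. (L * B)\<^sup>2 \<partial>D)"
    proof (intro integral_mono)
      note [measurable] = hyp_measurable1[OF S, of 1]
      show "integrable D (\<lambda>z. (hyp m S 1 (fst z) - noiseless (fst z))\<^sup>2)"
      proof (rule integrable_bounded[of _ "(L * B)\<^sup>2"])
        fix z assume "z \<in> space D"
        thus "\<bar>(hyp m S 1 (fst z) - noiseless (fst z))\<^sup>2\<bar> \<le> (L * B)\<^sup>2"
          using \<open>\<And>z. z \<in> space D \<Longrightarrow> (hyp m S 1 (fst z) - noiseless (fst z))\<^sup>2 \<le> (L * B)\<^sup>2\<close> by simp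
      qed measurable
    qed auto
    hence "2 * (\<integral>z. (hyp m S 1 (fst z) - noiseless (fst z))\<^sup>2 \<partial>D) + 2 * L * sqrt \<epsilon> \<le> b"
      using b by (simp add: prob_space)
    thus ?thesis
      using excess_err_le_noiseless[OF hyp_measurable1[OF S] hyp_range, of 1] excess_err_hyp[OF S, of 1] by simp
  qed
  thus ?thesis
    unfolding success_eq by (auto simp: space_pair_measure)
qed

end

section \<open>The rate\<close>

text \<open>The lower bound on \<tau> converts \<open>1 / sqrt m\<close>,
  \<open>sqrt (l / m)\<close> and the noise level into at most \<open>a * q\<close>,
  \<open>b * q\<close> and \<open>k * q\<close>. \<open>s\<close> stands for the fourth root and
  \<open>t\<close> for \<theta> / \<open>N\<close>. Terms of order \<open>q\<^sup>2\<close> become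
  multiples of \<open>B * L * q\<close> through \<open>large\<close>, which makes \<open>c\<close>
  depend on \<open>C\<close>.\<close>

lemma rate_bound:
  fixes L B M e q s \<tau> \<tau>0 l m C t :: real
  defines "a \<equiv> 1 / sqrt \<tau>0" and "b \<equiv> sqrt (1 + ln 4 / \<tau>0)"
  defines "k \<equiv> a + sqrt 2 * b"
  defines "c \<equiv> 3 * (24 * k\<^sup>2 * C + 16 * k + 8 + 8 * a + 4 * b) + 32 * (1 + ln 8 / \<tau>0) * C / \<tau>0 + 66 + 60 * sqrt b"
  assumes pos: "0 < L" "0 < B" "0 < M" "0 \<le> e" "0 < \<tau>0" "0 < m" "0 < C"
    and \<tau>: "\<tau>0 \<le> \<tau>" and q: "q = sqrt (\<tau> / m)" and s: "0 \<le> s" "s\<^sup>2 = q"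
    and large: "q \<le> C * B * L" and l: "l = ln 4 + \<tau>" and t: "t \<le> (1 + ln 8 / \<tau>0) / m"
  shows "3 * (24 * (1 / sqrt m + sqrt (2 * l / m))\<^sup>2 + 20 * L * (min M (e + M * sqrt (l / m)))
        + 16 * L * (1 / sqrt m + sqrt (2 * l / m)) * B + 8 * (B * L * q)
        + 2 * ((4 * L * B + 2 * L * B * sqrt l) / sqrt m) + 2 * L * e) + 32 * t
      \<le> c * (L * e + L * M * s + B * L * q)"
proof -
  have \<tau>pos: "0 < \<tau>" using \<tau> pos by simp
  have q0: "0 < q" unfolding q using \<tau>pos pos by simp
  have a0: "0 < a" unfolding a_def using pos by simp
  have ln4: "0 < ln (4::real)" "0 < ln (8::real)" by simp_all
  have b0: "0 < b" unfolding b_def using pos ln4 by (simp add: add_pos_pos)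
  have k0: "0 < k" unfolding k_def using a0 b0 by (simp add: add_pos_pos)
  define Z where "Z = B * L * q"
  have Z0: "0 < Z" unfolding Z_def using pos q0 by simp
  have qq: "q\<^sup>2 \<le> C * Z"
  proof -
    have "q * q \<le> (C * B * L) * q" using large q0 by (intro mult_right_mono) auto
    thus ?thesis by (simp add: Z_def power2_eq_square mult_ac)
  qed
  have h1: "1 / sqrt m \<le> a * q"
  proof -
    have "1 \<le> sqrt (\<tau> / \<tau>0)" using \<tau> pos by simp
    hence "1 / sqrt m \<le> sqrt (\<tau> / \<tau>0) / sqrt m" using pos by (intro divide_right_mono) auto
    also have "\<dots> = a * q" by (simp add: a_def q real_sqrt_divide)
    finally show ?thesis .
  qed
  have h2: "sqrt (l / m) \<le> b * q"
  proof -
    have "ln 4 * 1 \<le> ln 4 * (\<tau> / \<tau>0)" using \<tau> pos ln4 by (intro mult_left_mono) auto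
    hence "l \<le> (1 + ln 4 / \<tau>0) * \<tau>" by (simp add: l distrib_right)
    hence "l / m \<le> (1 + ln 4 / \<tau>0) * \<tau> / m" using pos by (intro divide_right_mono) auto
    hence "sqrt (l / m) \<le> sqrt ((1 + ln 4 / \<tau>0) * (\<tau> / m))" by (intro real_sqrt_le_mono) simp
    thus ?thesis by (simp only: b_def q real_sqrt_mult)
  qed
  define \<eta> where "\<eta> = 1 / sqrt m + sqrt (2 * l / m)"
  have \<eta>: "\<eta> \<le> k * q"
  proof -
    have "sqrt (2 * l / m) = sqrt 2 * sqrt (l / m)"
      by (simp only: real_sqrt_mult[symmetric] times_divide_eq_right)
    also have "\<dots> \<le> sqrt 2 * (b * q)" by (intro mult_left_mono h2) simp
    finally have "\<eta> \<le> a * q + sqrt 2 * (b * q)" unfolding \<eta>_def using h1 by (intro add_mono)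
    thus ?thesis by (simp only: k_def distrib_right mult.assoc)
  qed
  have l0: "0 < l" unfolding l using \<tau>pos ln4 by (intro add_pos_pos)
  have \<eta>0: "0 \<le> \<eta>" unfolding \<eta>_def using l0 pos by simp
  have A1: "\<eta>\<^sup>2 \<le> k\<^sup>2 * C * Z"
  proof -
    have "\<eta>\<^sup>2 \<le> (k * q)\<^sup>2" using \<eta> \<eta>0 by (intro power_mono)
    also have "\<dots> = k\<^sup>2 * q\<^sup>2" by (rule power_mult_distrib)
    also have "\<dots> \<le> k\<^sup>2 * (C * Z)" by (intro mult_left_mono qq) simp
    finally show ?thesis by (simp only: mult.assoc)
  qed
  have A2: "L * min M (e + M * sqrt (l / m)) \<le> L * e + sqrt b * (L * M * s)"
  proof -
    have bs: "sqrt (b * q) = sqrt b * s"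
      using s by (simp add: real_sqrt_mult flip: s(2))
    \<comment> \<open>If \<open>b * q \<le> 1\<close> its square root only increases it; otherwise
      the right-hand side already exceeds the trivial bound \<open>M\<close>.\<close>
    have "min M (e + M * sqrt (l / m)) \<le> e + M * sqrt (b * q)"
    proof (cases "b * q \<le> 1")
      case True
      have "b * q = sqrt (b * q) * sqrt (b * q)" using b0 q0 by simp
      also have "\<dots> \<le> sqrt (b * q) * 1" using True b0 q0 by (intro mult_left_mono) auto
      finally have "b * q \<le> sqrt (b * q)" by simp
      hence "sqrt (l / m) \<le> sqrt (b * q)" using h2 by (rule order_trans[rotated])
      hence "M * sqrt (l / m) \<le> M * sqrt (b * q)" using pos by (intro mult_left_mono) auto
      thus ?thesis by simp
    next
      case False
      hence "M * 1 \<le> M * sqrt (b * q)" using pos by (intro mult_left_mono) auto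
      hence "M \<le> e + M * sqrt (b * q)" using pos by linarith
      thus ?thesis by (rule min.coboundedI1)
    qed
    hence "L * min M (e + M * sqrt (l / m)) \<le> L * (e + M * sqrt (b * q))"
      using pos by (intro mult_left_mono) auto
    thus ?thesis unfolding bs by (simp only: distrib_left mult_ac)
  qed
  have A3: "L * \<eta> * B \<le> k * Z"
  proof -
    have "(L * B) * \<eta> \<le> (L * B) * (k * q)" using pos by (intro mult_left_mono \<eta>) auto
    thus ?thesis by (simp add: Z_def mult_ac)
  qed
  have A4: "(4 * L * B + 2 * L * B * sqrt l) / sqrt m \<le> (4 * a + 2 * b) * Z"
  proof -
    have "(4 * L * B + 2 * L * B * sqrt l) / sqrt m = (4 * L * B) * (1 / sqrt m) + (2 * L * B) * sqrt (l / m)"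
      by (simp add: add_divide_distrib real_sqrt_divide)
    also have "\<dots> \<le> (4 * L * B) * (a * q) + (2 * L * B) * (b * q)"
      using pos by (intro add_mono mult_left_mono h1 h2) auto
    also have "\<dots> = (4 * a + 2 * b) * Z" by (simp add: Z_def algebra_simps)
    finally show ?thesis .
  qed
  define j where "j = (1 + ln 8 / \<tau>0) * C / \<tau>0"
  have j0: "0 \<le> j" unfolding j_def using pos ln4 by simp
  have A5: "t \<le> j * Z"
  proof -
    have "\<tau>0 / m \<le> q\<^sup>2" using \<tau> pos \<tau>pos by (simp add: q divide_right_mono)
    hence "\<tau>0 / m \<le> C * Z" using qq by linarith
    hence "1 / m \<le> C * Z / \<tau>0" using pos by (simp add: pos_le_divide_eq mult.commute)
    hence "(1 + ln 8 / \<tau>0) * (1 / m) \<le> (1 + ln 8 / \<tau>0) * (C * Z / \<tau>0)"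
      using pos ln4 by (intro mult_left_mono) auto
    hence "(1 + ln 8 / \<tau>0) / m \<le> j * Z" unfolding j_def by simp
    thus ?thesis using t by linarith
  qed
  define cZ where "cZ = 3 * (24 * k\<^sup>2 * C + 16 * k + 8 + 8 * a + 4 * b) + 32 * j"
  have c: "c = cZ + 66 + 60 * sqrt b" unfolding c_def cZ_def j_def by simp
  \<comment> \<open>\<open>c\<close> is the sum of the coefficients of the three rate terms, so it
    dominates each. The 66 is 3 times 20 + 2, from the \<xi> average and from the change of
    target.\<close>
  have cZ0: "0 \<le> cZ" unfolding cZ_def using pos k0 a0 b0 j0 by simp
  have Le: "0 \<le> L * e" and LMs: "0 \<le> L * M * s" using pos s by auto
  have sb0: "0 \<le> sqrt b" using b0 by simp
  have "3 * (24 * \<eta>\<^sup>2 + 20 * (L * min M (e + M * sqrt (l / m))) + 16 * (L * \<eta> * B) + 8 * Z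
        + 2 * ((4 * L * B + 2 * L * B * sqrt l) / sqrt m) + 2 * (L * e)) + 32 * t
      \<le> 3 * (24 * (k\<^sup>2 * C * Z) + 20 * (L * e + sqrt b * (L * M * s)) + 16 * (k * Z) + 8 * Z
        + 2 * ((4 * a + 2 * b) * Z) + 2 * (L * e)) + 32 * (j * Z)"
    by (intro add_mono mult_left_mono A1 A2 A3 A4 A5 order_refl) auto
  also have "\<dots> = cZ * Z + 66 * (L * e) + 60 * sqrt b * (L * M * s)"
    unfolding cZ_def by (simp add: algebra_simps)
  also have "\<dots> \<le> c * Z + c * (L * e) + c * (L * M * s)"
  proof (intro add_mono mult_right_mono Le LMs)
    show "cZ \<le> c" "66 \<le> c" "60 * sqrt b \<le> c" unfolding c using cZ0 sb0 by auto
  qed (use Z0 in simp)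
  also have "\<dots> = c * (L * e + L * M * s + Z)" by (simp only: distrib_left add_ac)
  finally show ?thesis unfolding \<eta>_def Z_def by (simp only: mult.assoc)
qed

text \<open>Both thresholds \<open>C0\<close> and \<open>C0'\<close> can be 1: \<open>T\<close> has
  only to exceed \<open>B * L / q\<close> and \<open>N\<close> to exceed
  \<open>m * ln (T / \<delta>)\<close>. The constant \<open>c\<close> depends on \<delta>0 and,
  affinely, on \<open>C\<close>.\<close>

theorem theorem1:
  fixes \<delta>0 :: real
  assumes "0 < \<delta>0" and "\<delta>0 < 1"
  shows "\<exists>C0>0. \<exists>C0'>0. \<forall>C\<ge>C0. \<forall>C'\<ge>C0'. \<exists>c>0.
    \<forall>Z H ip D n X K \<psi> v u \<xi> L B M \<epsilon>.
      alphatron_setting Z H ip D n X K \<psi> v u \<xi> L B M \<epsilon> \<longrightarrow>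
      (\<forall>m \<delta>. m \<ge> 1 \<longrightarrow> 0 < \<delta> \<longrightarrow> \<delta> \<le> \<delta>0 \<longrightarrow>
        (let T = num_iter C B L m \<delta>;
             N = num_heldout C' m T \<delta>
         in \<P>((S, A) in PiM {..<m} (\<lambda>_. D) \<Otimes>\<^sub>M PiM {..<N} (\<lambda>_. D).
               \<forall>h. alphatron_output u K (1 / L) T m N S A h \<longrightarrow>
                   excess_err (restrict_space (euclid n) X) D h
                     \<le> c * (L * sqrt \<epsilon> + L * M * root 4 (ln (1 / \<delta>) / real m)
                            + B * L * sqrt (ln (1 / \<delta>) / real m)))
            \<ge> 1 - \<delta>))"
proof -
  define \<tau>0 where "\<tau>0 = ln (1 / \<delta>0)"
  have \<tau>0: "0 < \<tau>0" unfolding \<tau>0_def using assms by simp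
  define a b where "a = 1 / sqrt \<tau>0" "b = sqrt (1 + ln 4 / \<tau>0)"
  define k where "k = a + sqrt 2 * b"
  define c where "c C = 3 * (24 * k\<^sup>2 * C + 16 * k + 8 + 8 * a + 4 * b)
      + 32 * (1 + ln 8 / \<tau>0) * C / \<tau>0 + 66 + 60 * sqrt b" for C :: real
  have ab: "0 \<le> a" "0 \<le> b" "0 \<le> k" unfolding k_def a_b_def using \<tau>0 by simp_all
  have c66: "66 \<le> c C" if "1 \<le> C" for C
    unfolding c_def using ab \<tau>0 that by simp
  have main: "1 - \<delta> \<le> \<P>((S, A) in PiM {..<m} (\<lambda>_. D) \<Otimes>\<^sub>M PiM {..<N} (\<lambda>_. D).
        \<forall>h. alphatron_output u K (1 / L) T m N S A h \<longrightarrow>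
          excess_err (restrict_space (euclid n) X) D h
            \<le> c C * (L * sqrt \<epsilon> + L * M * root 4 (ln (1 / \<delta>) / real m) + B * L * sqrt (ln (1 / \<delta>) / real m)))"
    if C: "1 \<le> C" and C': "1 \<le> C'" and setting: "alphatron_setting Z H ip D n X K \<psi> v u \<xi> L B M \<epsilon>"
      and m: "1 \<le> m" and \<delta>: "0 < \<delta>" "\<delta> \<le> \<delta>0"
      and T_def: "T = num_iter C B L m \<delta>" and N_def: "N = num_heldout C' m T \<delta>"
    for C C' Z H ip D n X K \<psi> v u \<xi> L B M \<epsilon> m \<delta> T N
  proof -
    interpret alphatron_setting Z H ip D n X K \<psi> v u \<xi> L B M \<epsilon> by fact
    interpret PP: pair_prob_space "PS m" "PS N"
      unfolding pair_prob_space_def pair_sigma_finite_def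
      by (intro conjI prob_space_PS prob_space_imp_sigma_finite)
    define \<tau> where "\<tau> = ln (1 / \<delta>)"
    define q where "q = sqrt (\<tau> / m)"
    define s where "s = root 4 (\<tau> / m)"
    have \<tau>: "\<tau>0 \<le> \<tau>" unfolding \<tau>0_def \<tau>_def using \<delta> assms by (simp add: frac_le)
    have \<tau>m: "0 < \<tau> / m" using \<tau> \<tau>0 m by simp
    have q0: "0 < q" unfolding q_def using \<tau>m by simp
    have s: "0 \<le> s" "s\<^sup>2 = q"
    proof -
      show s0: "0 \<le> s" unfolding s_def using \<tau>m by simp
      have "(s\<^sup>2)\<^sup>2 = s ^ 4" by (simp flip: power_mult)
      also have "\<dots> = \<tau> / m" unfolding s_def using \<tau>m by (simp add: real_root_pow_pos2)
      finally show "s\<^sup>2 = q" unfolding q_def by (intro real_sqrt_unique[symmetric]) auto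
    qed
    define rate where "rate = c C * (L * sqrt \<epsilon> + L * M * s + B * L * q)"
    have \<epsilon>: "0 \<le> sqrt \<epsilon>"
      by (rule order_trans[OF Bochner_Integration.integral_nonneg integral_abs_xi_le]) simp
    define x where "x = C * B * L * sqrt (real m / \<tau>)"
    \<comment> \<open>Ties the case split on the unrounded iteration count to the comparison of
      \<open>q\<close> with \<open>C * B * L\<close>: \<open>x \<le> 1\<close> means
      \<open>C * B * L \<le> q\<close>.\<close>
    have xq: "x * q = C * B * L"
    proof -
      have "sqrt (real m / \<tau>) * q = 1"
        unfolding q_def real_sqrt_mult[symmetric] using \<tau> \<tau>0 m by simp
      thus ?thesis unfolding x_def by simp
    qed
    have x0: "0 < x" unfolding x_def using C B_pos L_pos \<tau> \<tau>0 m by simp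
    have T: "T = nat \<lceil>x\<rceil>" unfolding T_def num_iter_def x_def \<tau>_def by simp
    have T1: "1 \<le> T" and Tx: "x \<le> T" unfolding T using x0 by linarith+
    have succ: "1 - \<delta> \<le> measure (PS m \<Otimes>\<^sub>M PS N) (success T m N rate)"
    proof (cases "x \<le> 1")
      case True
      hence "\<lceil>x\<rceil> = 1" using x0 by (intro ceiling_unique) auto
      hence "T = 1" unfolding T by simp
      have "C * B * L \<le> q" using xq True q0 mult_right_mono[of x 1 q] by simp
      moreover have "1 * (B * L) \<le> C * (B * L)" using C B_pos L_pos by (intro mult_right_mono) auto
      ultimately have "B * L \<le> q" by (simp add: mult.assoc)
      hence "(B * L) * (B * L) \<le> (B * L) * q" using B_pos L_pos by (intro mult_left_mono) auto
      moreover have "(L * B)\<^sup>2 = (B * L) * (B * L)" by (simp add: power2_eq_square mult_ac)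
      moreover have "0 \<le> L * M * s" using L_pos M_pos s by simp
      ultimately have "2 * (L * B)\<^sup>2 + 2 * L * sqrt \<epsilon> \<le> 2 * (L * sqrt \<epsilon> + L * M * s + B * L * q)"
        by simp
      also have "\<dots> \<le> rate"
        unfolding rate_def using c66[OF C] \<epsilon> s q0 L_pos M_pos B_pos by (intro mult_right_mono) auto
      finally have "success 1 m N rate = space (PS m \<Otimes>\<^sub>M PS N)"
        by (rule success_single_iteration)
      thus ?thesis using \<delta> \<open>T = 1\<close> by (simp add: PP.prob_space)
    next
      case False
      hence large: "q \<le> C * B * L" using xq q0 mult_right_mono[of 1 x q] by simp
      define \<mu> where "\<mu> = ln (T / \<delta>)"
      have \<mu>: "\<tau>0 \<le> \<mu>"
      proof -
        have "1 / \<delta> \<le> T / \<delta>" using T1 \<delta> by (intro divide_right_mono) auto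
        hence "\<tau> \<le> \<mu>" unfolding \<tau>_def \<mu>_def using \<delta> T1 by (subst ln_le_cancel_iff) auto
        thus ?thesis using \<tau> by simp
      qed
      have N: "m * \<mu> \<le> N"
      proof -
        have "1 * (m * \<mu>) \<le> C' * (m * \<mu>)" using C' \<mu> \<tau>0 by (intro mult_right_mono) auto
        also have "\<dots> \<le> N"
          unfolding N_def num_heldout_def \<mu>_def mult.assoc by (rule of_nat_ceiling)
        finally show ?thesis by simp
      qed
      have m\<mu>: "0 < m * \<mu>" using m \<mu> \<tau>0 by simp
      have N0: "0 < N" using N m\<mu> by (cases N) auto
      \<comment> \<open>The failure budget: \<open>exp (- l)\<close> is a quarter of \<delta> and is
        spent three times, while \<open>(T + 1) * exp (- \<theta>)\<close> is at most the last
        quarter, since \<open>T + 1 \<le> 2 * T\<close>.\<close>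
      define l \<theta> where "l = ln 4 + \<tau>" "\<theta> = ln 8 + \<mu>"
      have l0: "0 < l" unfolding l_\<theta>_def using \<tau> \<tau>0 by (intro add_pos_pos) auto
      have \<theta>: "\<theta> / N \<le> (1 + ln 8 / \<tau>0) / m"
      proof -
        have "ln 8 * 1 \<le> ln 8 * (\<mu> / \<tau>0)" using \<mu> \<tau>0 by (intro mult_left_mono) auto
        hence "\<theta> \<le> (1 + ln 8 / \<tau>0) * \<mu>" unfolding l_\<theta>_def by (simp add: distrib_right)
        moreover have "0 \<le> \<theta>" unfolding l_\<theta>_def using \<mu> \<tau>0 by (intro add_nonneg_nonneg) auto
        ultimately have "\<theta> / N \<le> ((1 + ln 8 / \<tau>0) * \<mu>) / (m * \<mu>)"
          using N m\<mu> by (intro frac_le) auto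
        moreover have "\<mu> \<noteq> 0" using \<mu> \<tau>0 by simp
        ultimately show ?thesis by simp
      qed
      have "1 - (3 * exp (- l) + (T + 1) * exp (- \<theta>)) \<le> measure (PS m \<Otimes>\<^sub>M PS N) (success T m N rate)"
      proof (rule success_prob[OF _ N0 _ _ T1 l0])
        \<comment> \<open>The decrease per step is set to \<kappa> = \<open>B * L * q\<close>, the
          target rate. As \<open>T \<ge> x\<close> and \<open>x * q = C * B * L\<close>, the
          \<open>T\<close> steps exhaust the initial squared distance.\<close>
        show "0 < B * L * q" using B_pos L_pos q0 by simp
        have "B\<^sup>2 * L\<^sup>2 = 1 * (B * L) * (B * L)" by (simp add: power2_eq_square)
        also have "\<dots> \<le> C * (B * L) * (B * L)"
          using C B_pos L_pos by (intro mult_right_mono) auto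
        also have "\<dots> = x * (B * L * q)" using xq by (simp add: mult_ac)
        also have "\<dots> \<le> T * (B * L * q)" using Tx B_pos L_pos q0 by (intro mult_right_mono) auto
        finally show "B\<^sup>2 * L\<^sup>2 \<le> T * (B * L * q)" .
        show "3 * (24 * (1 / sqrt m + sqrt (2 * l / m))\<^sup>2 + 20 * L * (min M (sqrt \<epsilon> + M * sqrt (l / m)))
          + 16 * L * (1 / sqrt m + sqrt (2 * l / m)) * B + 8 * (B * L * q)
          + 2 * ((4 * L * B + 2 * L * B * sqrt l) / sqrt m) + 2 * L * sqrt \<epsilon>) + 32 * \<theta> / N \<le> rate"
          unfolding rate_def c_def k_def a_b_def times_divide_eq_right[symmetric, of 32 \<theta>]
          by (rule rate_bound[OF L_pos B_pos M_pos \<epsilon> \<tau>0 _ _ \<tau> q_def s large l_\<theta>_def(1) \<theta>])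
             (use m C in auto)
      qed (use m in simp)
      moreover have "3 * exp (- l) + (T + 1) * exp (- \<theta>) \<le> \<delta>"
      proof -
        have "exp (- l) = \<delta> / 4"
          unfolding l_\<theta>_def \<tau>_def using \<delta> by (simp add: exp_diff exp_minus ln_div)
        moreover have "exp (- \<theta>) = \<delta> / (8 * T)"
          unfolding l_\<theta>_def \<mu>_def using \<delta> T1 by (simp add: exp_diff exp_minus ln_div)
        moreover have "(T + 1) * (\<delta> / (8 * T)) \<le> (2 * T) * (\<delta> / (8 * T))"
          using T1 \<delta> by (intro mult_right_mono) auto
        moreover have "(2 * T) * (\<delta> / (8 * T)) = \<delta> / 4" using T1 by simp
        ultimately show ?thesis by simp
      qed
      ultimately show ?thesis by linarith
    qed
    thus ?thesis
      unfolding success_def rate_def s_def q_def \<tau>_def .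
  qed
  show ?thesis
  proof (rule exI[of _ 1], rule conjI, simp, rule exI[of _ 1], rule conjI, simp, intro allI impI)
    fix C C' :: real
    assume C: "1 \<le> C" and C': "1 \<le> C'"
    have "0 < c C" using c66[OF C] by simp
    thus "\<exists>c>0. \<forall>Z H ip D n X K \<psi> v u \<xi> L B M \<epsilon>.
      alphatron_setting Z H ip D n X K \<psi> v u \<xi> L B M \<epsilon> \<longrightarrow>
      (\<forall>m \<delta>. m \<ge> 1 \<longrightarrow> 0 < \<delta> \<longrightarrow> \<delta> \<le> \<delta>0 \<longrightarrow>
        (let T = num_iter C B L m \<delta>;
             N = num_heldout C' m T \<delta>
         in \<P>((S, A) in PiM {..<m} (\<lambda>_. D) \<Otimes>\<^sub>M PiM {..<N} (\<lambda>_. D).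
               \<forall>h. alphatron_output u K (1 / L) T m N S A h \<longrightarrow>
                   excess_err (restrict_space (euclid n) X) D h
                     \<le> c * (L * sqrt \<epsilon> + L * M * root 4 (ln (1 / \<delta>) / real m)
                            + B * L * sqrt (ln (1 / \<delta>) / real m)))
            \<ge> 1 - \<delta>))"
      unfolding Let_def
      by (intro exI[of _ "c C"] conjI allI impI) (assumption, rule main[OF C C' _ _ _ _ refl refl])
  qed
qed

end
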